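(* Let $\mathcal{G}=(\mathcal{G}^{(0)},E)$ be a hyperbolic graph of bounded valency. Then there exists an ideal bicombing $q:(\partial\mathcal{G})^2\to\ell^\infty(E)$ on $\mathcal{G}$ which is weak-* continuous, quasigeodesic, of bounded area, and equivariant under the automorphism group of $\mathcal{G}$.
   Context: Graphs are in Serre's sense: a graph $\mathcal{G}=(\mathcal{G}^{(0)},E)$ has a vertex set $\mathcal{G}^{(0)}$, a set $E$ of (oriented) edges with an involution $e\mapsto\bar e$, and initial/terminal maps $e\mapsto e_-$, $e\mapsto e_+$. Graphs are connected, and the geometric realization (also denoted $\mathcal{G}$) carries the path metric $d$ with unit edge length. Bounded valency: there is a uniform bound on the number of edges issuing from a vertex. Hyperbolic means that the geometric realization is Gromov-hyperbolic; $\partial\mathcal{G}$ is its Gromov boundary and $\overline{\mathcal{G}}=\mathcal{G}\sqcup\partial\mathcal{G}$ has the usual topology. A subgraph $U\subseteq\mathcal{G}$ is a graph neighbourhood of $\xi\in\partial\mathcal{G}$ if $U$ is the restriction to $\mathcal{G}$ of a neighbourhood of $\xi$ in $\overline{\mathcal{G}}$. For $f:E\to\mathbf{R}$ ($\mathcal{G}$ locally finite) the boundary is $\partial f(v)=\sum_{e_+=v}f(e)-\sum_{e_-=v}f(e)$, $v\in\mathcal{G}^{(0)}$. The support of $f$ is the closure of the union of the edges where $f$ does not vanish. For a subgraph $V$, $f|_V$ is the restriction of $f$ to the edges of $V$ (extended by $0$). An ideal bicombing on $\mathcal{G}$ is a map $q:(\partial\mathcal{G})^2\to\ell^\infty(E)$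 such that: (i) $\partial q[\xi,\eta]=0$ for all $\xi,\eta\in\partial\mathcal{G}$; (ii) for all distinct $\xi_+,\xi_-\in\partial\mathcal{G}$ and all disjoint graph neighbourhoods $V_\pm$ of $\xi_\pm$, the function $\partial(q[\xi_-,\xi_+]|_{V_\pm})$ is finitely supported of sum $\mp1$. $q$ has bounded area if $\|q[\xi,\eta]+q[\eta,\zeta]+q[\zeta,\xi]\|_1$ is finite and uniformly bounded over $\xi,\eta,\zeta\in\partial\mathcal{G}$. $q$ is quasigeodesic if there is a constant $C$ such that for all $\xi,\eta\in\partial\mathcal{G}$ the support of $q[\xi,\eta]$ lies in the $C$-neighbourhood of any geodesic from $\xi$ to $\eta$. The weak-* topology on $\ell^\infty(E)$ is that of the dual of $\ell^1(E)$. Equivariance is with respect to the natural actions of the automorphism group on $\partial\mathcal{G}$ and on $\ell^\infty(E)$. *)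

theory Defs
  imports
    "HOL-Analysis.Analysis"
    "Graph_Theory.Graph_Theory"
begin

section \<open>Gromov hyperbolic spaces and their boundary\<close>

definition gromov_product :: "('p \<Rightarrow> 'p \<Rightarrow> real) \<Rightarrow> 'p \<Rightarrow> 'p \<Rightarrow> 'p \<Rightarrow> real" where
  "gromov_product d w x y = (d x w + d y w - d x y) / 2"

definition gromov_hyperbolic :: "'p set \<Rightarrow> ('p \<Rightarrow> 'p \<Rightarrow> real) \<Rightarrow> bool" where
  "gromov_hyperbolic M d \<longleftrightarrow>
    (\<exists>\<delta>. \<forall>w\<in>M. \<forall>x\<in>M. \<forall>y\<in>M. \<forall>z\<in>M.
      gromov_product d w x z \<ge> min (gromov_product d w x y) (gromov_product d w y z) - \<delta>)"

text \<open>The Gromov boundary consists of classes of sequences converging to infinity; the two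
  indices below tend to infinity independently.\<close>

definition asymptotic :: "'p set \<Rightarrow> ('p \<Rightarrow> 'p \<Rightarrow> real) \<Rightarrow> (nat \<Rightarrow> 'p) \<Rightarrow> (nat \<Rightarrow> 'p) \<Rightarrow> bool" where
  "asymptotic M d x y \<longleftrightarrow>
    (\<forall>w\<in>M. filterlim (\<lambda>(i, j). gromov_product d w (x i) (y j)) at_top
      (sequentially \<times>\<^sub>F sequentially))"

definition gromov_sequences :: "'p set \<Rightarrow> ('p \<Rightarrow> 'p \<Rightarrow> real) \<Rightarrow> (nat \<Rightarrow> 'p) set" where
  "gromov_sequences M d = {x. range x \<subseteq> M \<and> asymptotic M d x x}"

definition gromov_boundary :: "'p set \<Rightarrow> ('p \<Rightarrow> 'p \<Rightarrow> real) \<Rightarrow> (nat \<Rightarrow> 'p) set set" where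
  "gromov_boundary M d =
    gromov_sequences M d //
      {(x, y). x \<in> gromov_sequences M d \<and> y \<in> gromov_sequences M d \<and> asymptotic M d x y}"

text \<open>Points of the space and points at infinity are kept apart as \<open>Inl\<close> and \<open>Inr\<close>. The Gromov
  product extends to them as the supremum of the lower limits over all representing sequences.\<close>

definition gromov_completion ::
    "'p set \<Rightarrow> ('p \<Rightarrow> 'p \<Rightarrow> real) \<Rightarrow> ('p + (nat \<Rightarrow> 'p) set) set" where
  "gromov_completion M d = M <+> gromov_boundary M d"

definition representing_sequences :: "'p + (nat \<Rightarrow> 'p) set \<Rightarrow> (nat \<Rightarrow> 'p) set" where
  "representing_sequences a = (case a of Inl p \<Rightarrow> {\<lambda>_. p} | Inr \<xi> \<Rightarrow> \<xi>)"

definition ext_gromov_product ::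
    "('p \<Rightarrow> 'p \<Rightarrow> real) \<Rightarrow> 'p \<Rightarrow> 'p + (nat \<Rightarrow> 'p) set \<Rightarrow> 'p + (nat \<Rightarrow> 'p) set \<Rightarrow> ereal" where
  "ext_gromov_product d w a b =
    (SUP (x, y) \<in> representing_sequences a \<times> representing_sequences b.
      Liminf (sequentially \<times>\<^sub>F sequentially) (\<lambda>(i, j). ereal (gromov_product d w (x i) (y j))))"

definition completion_open ::
    "'p set \<Rightarrow> ('p \<Rightarrow> 'p \<Rightarrow> real) \<Rightarrow> ('p + (nat \<Rightarrow> 'p) set) set \<Rightarrow> bool" where
  "completion_open M d U \<longleftrightarrow>
    U \<subseteq> gromov_completion M d \<and>
    openin (Metric_space.mtopology M d) (Inl -` U) \<and>
    (\<forall>\<xi>. Inr \<xi> \<in> U \<longrightarrow>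
      (\<forall>w\<in>M. \<exists>R::real. {a \<in> gromov_completion M d. ext_gromov_product d w (Inr \<xi>) a > ereal R} \<subseteq> U))"

lemma istopology_completion_open: "istopology (completion_open M d)"
proof -
  have "completion_open M d (S \<inter> T)" if S: "completion_open M d S" and T: "completion_open M d T" for S T
    unfolding completion_open_def
  proof (intro conjI allI impI ballI)
    show "S \<inter> T \<subseteq> gromov_completion M d"
      using S by (auto simp: completion_open_def)
    show "openin (Metric_space.mtopology M d) (Inl -` (S \<inter> T))"
      using S T by (auto simp: completion_open_def)
  next
    fix \<xi> w assume "Inr \<xi> \<in> S \<inter> T" and "w \<in> M"
    then obtain R R' :: real
      where "{a \<in> gromov_completion M d. ext_gromov_product d w (Inr \<xi>) a > ereal R} \<subseteq> S"
        and "{a \<in> gromov_completion M d. ext_gromov_product d w (Inr \<xi>) a > ereal R'} \<subseteq> T"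
      using S T unfolding completion_open_def by (meson IntD1 IntD2)
    then have "{a \<in> gromov_completion M d. ext_gromov_product d w (Inr \<xi>) a > ereal (max R R')} \<subseteq> S \<inter> T"
      by (auto simp: subset_iff)
    then show "\<exists>R::real. {a \<in> gromov_completion M d. ext_gromov_product d w (Inr \<xi>) a > ereal R} \<subseteq> S \<inter> T"
      by blast
  qed
  moreover have "completion_open M d (\<Union>\<K>)" if \<K>: "\<forall>K\<in>\<K>. completion_open M d K" for \<K>
    unfolding completion_open_def
  proof (intro conjI allI impI ballI)
    show "\<Union>\<K> \<subseteq> gromov_completion M d"
      using \<K> by (auto simp: completion_open_def)
    show "openin (Metric_space.mtopology M d) (Inl -` \<Union>\<K>)"
      using \<K> by (auto simp: completion_open_def vimage_Union)
  next
    fix \<xi> w assume "Inr \<xi> \<in> \<Union>\<K>" and "w \<in> M"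
    then obtain K and R :: real where "K \<in> \<K>"
      and "{a \<in> gromov_completion M d. ext_gromov_product d w (Inr \<xi>) a > ereal R} \<subseteq> K"
      using \<K> unfolding completion_open_def by (meson UnionE)
    then show "\<exists>R::real. {a \<in> gromov_completion M d. ext_gromov_product d w (Inr \<xi>) a > ereal R} \<subseteq> \<Union>\<K>"
      by blast
  qed
  ultimately show ?thesis
    by (simp add: istopology_def)
qed

definition completion_topology ::
    "'p set \<Rightarrow> ('p \<Rightarrow> 'p \<Rightarrow> real) \<Rightarrow> ('p + (nat \<Rightarrow> 'p) set) topology" where
  "completion_topology M d = topology (completion_open M d)"

definition boundary_topology :: "'p set \<Rightarrow> ('p \<Rightarrow> 'p \<Rightarrow> real) \<Rightarrow> (nat \<Rightarrow> 'p) set topology" where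
  "boundary_topology M d = pullback_topology (gromov_boundary M d) Inr (completion_topology M d)"

definition geodesic_line ::
    "'p set \<Rightarrow> ('p \<Rightarrow> 'p \<Rightarrow> real) \<Rightarrow> (nat \<Rightarrow> 'p) set \<Rightarrow> (nat \<Rightarrow> 'p) set \<Rightarrow> (real \<Rightarrow> 'p) \<Rightarrow> bool" where
  "geodesic_line M d \<xi> \<eta> \<gamma> \<longleftrightarrow>
    range \<gamma> \<subseteq> M \<and> (\<forall>s t. d (\<gamma> s) (\<gamma> t) = \<bar>s - t\<bar>) \<and>
    (\<lambda>n. \<gamma> (- real n)) \<in> \<xi> \<and> (\<lambda>n. \<gamma> (real n)) \<in> \<eta>"


section \<open>Graphs in the sense of Serre\<close>

text \<open>A graph is a locale instance \<open>bidirected_digraph G arev\<close>: the oriented edges are the arcs,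
  \<open>tail\<close> and \<open>head\<close> are the initial and terminal maps, and \<open>arev\<close> is the involution, which has no
  fixed arc. Loops and multiple edges are allowed.\<close>

definition bounded_valency :: "('v, 'e) pre_digraph \<Rightarrow> bool" where
  "bounded_valency G \<longleftrightarrow>
    (\<exists>N. \<forall>v\<in>verts G. finite (out_arcs G v) \<and> card (out_arcs G v) \<le> N)"

subsection \<open>Geometric realization\<close>

text \<open>A point of the realization is an equivalence class. It is a singleton \<open>{Inl v}\<close> for a
  vertex \<open>v\<close>, or the class of a pair \<open>(e, t)\<close> with \<open>0 < t < 1\<close>, identified with \<open>(arev e, 1 - t)\<close>.\<close>

type_synonym ('v, 'e) point = "('v + 'e \<times> real) set"

definition edge_point ::
    "('v, 'e) pre_digraph \<Rightarrow> ('e \<Rightarrow> 'e) \<Rightarrow> 'e \<Rightarrow> real \<Rightarrow> ('v, 'e) point" where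
  "edge_point G arev e t =
    (if t \<le> 0 then {Inl (tail G e)}
     else if t \<ge> 1 then {Inl (head G e)}
     else {Inr (e, t), Inr (arev e, 1 - t)})"

definition edge_segment :: "('v, 'e) pre_digraph \<Rightarrow> ('e \<Rightarrow> 'e) \<Rightarrow> 'e \<Rightarrow> ('v, 'e) point set" where
  "edge_segment G arev e = edge_point G arev e ` {0..1}"

definition realization :: "('v, 'e) pre_digraph \<Rightarrow> ('e \<Rightarrow> 'e) \<Rightarrow> ('v, 'e) point set" where
  "realization G arev = (\<lambda>v. {Inl v}) ` verts G \<union> (\<Union>e\<in>arcs G. edge_segment G arev e)"

text \<open>A triple \<open>(e, s, t)\<close> is the linear path in the edge \<open>e\<close> from parameter \<open>s\<close> to parameter \<open>t\<close>.
  The path metric is the infimum of the lengths of the concatenations of such paths. The value 0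
  outside the realization is the convention required by \<open>Metric_space\<close>.\<close>

fun pl_path :: "('v, 'e) pre_digraph \<Rightarrow> ('e \<Rightarrow> 'e) \<Rightarrow>
    ('v, 'e) point \<Rightarrow> ('e \<times> real \<times> real) list \<Rightarrow> ('v, 'e) point \<Rightarrow> bool" where
  "pl_path G arev x [] y \<longleftrightarrow> x = y"
| "pl_path G arev x ((e, s, t) # p) y \<longleftrightarrow>
    e \<in> arcs G \<and> s \<in> {0..1} \<and> t \<in> {0..1} \<and> x = edge_point G arev e s \<and>
    pl_path G arev (edge_point G arev e t) p y"

definition pl_length :: "('e \<times> real \<times> real) list \<Rightarrow> real" where
  "pl_length p = (\<Sum>(e, s, t)\<leftarrow>p. \<bar>s - t\<bar>)"

definition path_metric :: "('v, 'e) pre_digraph \<Rightarrow> ('e \<Rightarrow> 'e) \<Rightarrow>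
    ('v, 'e) point \<Rightarrow> ('v, 'e) point \<Rightarrow> real" where
  "path_metric G arev x y =
    (if x \<in> realization G arev \<and> y \<in> realization G arev
     then INF p \<in> {p. pl_path G arev x p y}. pl_length p else 0)"

definition hyperbolic_graph :: "('v, 'e) pre_digraph \<Rightarrow> ('e \<Rightarrow> 'e) \<Rightarrow> bool" where
  "hyperbolic_graph G arev \<longleftrightarrow> gromov_hyperbolic (realization G arev) (path_metric G arev)"

type_synonym ('v, 'e) end_point = "(nat \<Rightarrow> ('v, 'e) point) set"

definition graph_boundary :: "('v, 'e) pre_digraph \<Rightarrow> ('e \<Rightarrow> 'e) \<Rightarrow> ('v, 'e) end_point set" where
  "graph_boundary G arev = gromov_boundary (realization G arev) (path_metric G arev)"

definition graph_neighbourhood :: "('v, 'e) pre_digraph \<Rightarrow> ('e \<Rightarrow> 'e) \<Rightarrow>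
    ('v, 'e) end_point \<Rightarrow> ('v, 'e) pre_digraph \<Rightarrow> bool" where
  "graph_neighbourhood G arev \<xi> U \<longleftrightarrow>
    subgraph U G \<and> arev ` arcs U \<subseteq> arcs U \<and>
    (\<exists>N \<subseteq> gromov_completion (realization G arev) (path_metric G arev).
      (\<exists>W. openin (completion_topology (realization G arev) (path_metric G arev)) W \<and>
        Inr \<xi> \<in> W \<and> W \<subseteq> N) \<and>
      realization U arev = Inl -` N)"

subsection \<open>Functions on edges\<close>

definition edge_boundary :: "('v, 'e) pre_digraph \<Rightarrow> ('e \<Rightarrow> real) \<Rightarrow> 'v \<Rightarrow> real" where
  "edge_boundary G f v = (\<Sum>e\<in>in_arcs G v. f e) - (\<Sum>e\<in>out_arcs G v. f e)"

definition edge_support ::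
    "('v, 'e) pre_digraph \<Rightarrow> ('e \<Rightarrow> 'e) \<Rightarrow> ('e \<Rightarrow> real) \<Rightarrow> ('v, 'e) point set" where
  "edge_support G arev f =
    Metric_space.mtopology (realization G arev) (path_metric G arev)
      closure_of (\<Union>e\<in>{e \<in> arcs G. f e \<noteq> 0}. edge_segment G arev e)"

definition edge_restrict :: "('v, 'e) pre_digraph \<Rightarrow> ('e \<Rightarrow> real) \<Rightarrow> 'e \<Rightarrow> real" where
  "edge_restrict V f e = (if e \<in> arcs V then f e else 0)"

text \<open>Functions on a set \<open>E\<close> are represented by functions that vanish outside \<open>E\<close>.\<close>

definition ell_infinity :: "'e set \<Rightarrow> ('e \<Rightarrow> real) set" where
  "ell_infinity E = {f. bounded (f ` E) \<and> (\<forall>e. e \<notin> E \<longrightarrow> f e = 0)}"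

definition ell_one :: "'e set \<Rightarrow> ('e \<Rightarrow> real) set" where
  "ell_one E = {h. (\<lambda>e. \<bar>h e\<bar>) summable_on E \<and> (\<forall>e. e \<notin> E \<longrightarrow> h e = 0)}"

definition weak_star_topology :: "'e set \<Rightarrow> ('e \<Rightarrow> real) topology" where
  "weak_star_topology E =
    topology_generated_by
      {{f \<in> ell_infinity E. (\<Sum>\<^sub>\<infinity>e\<in>E. h e * f e) \<in> W} | h W. h \<in> ell_one E \<and> open W}"

lemma topspace_weak_star_topology: "topspace (weak_star_topology E) = ell_infinity E"
proof -
  have "(\<lambda>_. 0) \<in> ell_one E"
    by (simp add: ell_one_def)
  then have "ell_infinity E \<in>
      {{f \<in> ell_infinity E. (\<Sum>\<^sub>\<infinity>e\<in>E. h e * f e) \<in> W} | h W. h \<in> ell_one E \<and> open W}"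
    by (auto intro!: exI[of _ "\<lambda>_. 0"] exI[of _ UNIV])
  then show ?thesis
    unfolding weak_star_topology_def topology_generated_by_topspace by blast
qed


section \<open>Automorphisms\<close>

definition graph_automorphism ::
    "('v, 'e) pre_digraph \<Rightarrow> ('e \<Rightarrow> 'e) \<Rightarrow> ('v \<Rightarrow> 'v) \<Rightarrow> ('e \<Rightarrow> 'e) \<Rightarrow> bool" where
  "graph_automorphism G arev \<phi> \<psi> \<longleftrightarrow>
    bij_betw \<phi> (verts G) (verts G) \<and> bij_betw \<psi> (arcs G) (arcs G) \<and>
    (\<forall>e\<in>arcs G. tail G (\<psi> e) = \<phi> (tail G e) \<and> head G (\<psi> e) = \<phi> (head G e) \<and>
      \<psi> (arev e) = arev (\<psi> e))"

definition point_action ::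
    "('v \<Rightarrow> 'v) \<Rightarrow> ('e \<Rightarrow> 'e) \<Rightarrow> ('v, 'e) point \<Rightarrow> ('v, 'e) point" where
  "point_action \<phi> \<psi> x = map_sum \<phi> (map_prod \<psi> id) ` x"

definition boundary_action ::
    "('v \<Rightarrow> 'v) \<Rightarrow> ('e \<Rightarrow> 'e) \<Rightarrow> ('v, 'e) end_point \<Rightarrow> ('v, 'e) end_point" where
  "boundary_action \<phi> \<psi> \<xi> = (\<lambda>x. point_action \<phi> \<psi> \<circ> x) ` \<xi>"

definition ell_infinity_action :: "'e set \<Rightarrow> ('e \<Rightarrow> 'e) \<Rightarrow> ('e \<Rightarrow> real) \<Rightarrow> 'e \<Rightarrow> real" where
  "ell_infinity_action E \<psi> f e = (if e \<in> E then f (inv_into E \<psi> e) else 0)"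


section \<open>Ideal bicombings\<close>

type_synonym ('v, 'e) bicombing = "('v, 'e) end_point \<Rightarrow> ('v, 'e) end_point \<Rightarrow> 'e \<Rightarrow> real"

text \<open>In the last clause a bicombing is thought of as a unit flow from \<open>\<xi>\<close> (with
  graph neighbourhood \<open>U\<close>) to \<open>\<eta>\<close> (with graph neighbourhood \<open>V\<close>).\<close>

definition ideal_bicombing ::
    "('v, 'e) pre_digraph \<Rightarrow> ('e \<Rightarrow> 'e) \<Rightarrow> ('v, 'e) bicombing \<Rightarrow> bool" where
  "ideal_bicombing G arev q \<longleftrightarrow>
    (\<forall>\<xi>\<in>graph_boundary G arev. \<forall>\<eta>\<in>graph_boundary G arev. q \<xi> \<eta> \<in> ell_infinity (arcs G)) \<and>
    (\<forall>\<xi>\<in>graph_boundary G arev. \<forall>\<eta>\<in>graph_boundary G arev. \<forall>v\<in>verts G.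
      edge_boundary G (q \<xi> \<eta>) v = 0) \<and>
    (\<forall>\<xi>\<in>graph_boundary G arev. \<forall>\<eta>\<in>graph_boundary G arev. \<forall>U V.
      \<xi> \<noteq> \<eta> \<and> graph_neighbourhood G arev \<xi> U \<and> graph_neighbourhood G arev \<eta> V \<and>
      realization U arev \<inter> realization V arev = {} \<longrightarrow>
      (let f = edge_boundary G (edge_restrict U (q \<xi> \<eta>));
           g = edge_boundary G (edge_restrict V (q \<xi> \<eta>))
       in finite {v \<in> verts G. f v \<noteq> 0} \<and> (\<Sum>v | v \<in> verts G \<and> f v \<noteq> 0. f v) = 1 \<and>
          finite {v \<in> verts G. g v \<noteq> 0} \<and> (\<Sum>v | v \<in> verts G \<and> g v \<noteq> 0. g v) = - 1))"

definition weak_star_continuous ::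
    "('v, 'e) pre_digraph \<Rightarrow> ('e \<Rightarrow> 'e) \<Rightarrow> ('v, 'e) bicombing \<Rightarrow> bool" where
  "weak_star_continuous G arev q \<longleftrightarrow>
    (let B = boundary_topology (realization G arev) (path_metric G arev)
     in continuous_map (prod_topology B B) (weak_star_topology (arcs G)) (\<lambda>(\<xi>, \<eta>). q \<xi> \<eta>))"

definition quasigeodesic ::
    "('v, 'e) pre_digraph \<Rightarrow> ('e \<Rightarrow> 'e) \<Rightarrow> ('v, 'e) bicombing \<Rightarrow> bool" where
  "quasigeodesic G arev q \<longleftrightarrow>
    (\<exists>C. \<forall>\<xi>\<in>graph_boundary G arev. \<forall>\<eta>\<in>graph_boundary G arev. \<forall>\<gamma>.
      geodesic_line (realization G arev) (path_metric G arev) \<xi> \<eta> \<gamma> \<longrightarrow>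
      (\<forall>x\<in>edge_support G arev (q \<xi> \<eta>). \<exists>t. path_metric G arev x (\<gamma> t) \<le> C))"

definition bounded_area ::
    "('v, 'e) pre_digraph \<Rightarrow> ('e \<Rightarrow> 'e) \<Rightarrow> ('v, 'e) bicombing \<Rightarrow> bool" where
  "bounded_area G arev q \<longleftrightarrow>
    (\<exists>K. \<forall>\<xi>\<in>graph_boundary G arev. \<forall>\<eta>\<in>graph_boundary G arev. \<forall>\<zeta>\<in>graph_boundary G arev.
      (\<lambda>e. \<bar>q \<xi> \<eta> e + q \<eta> \<zeta> e + q \<zeta> \<xi> e\<bar>) summable_on arcs G \<and>
      (\<Sum>\<^sub>\<infinity>e\<in>arcs G. \<bar>q \<xi> \<eta> e + q \<eta> \<zeta> e + q \<zeta> \<xi> e\<bar>) \<le> K)"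

definition automorphism_equivariant ::
    "('v, 'e) pre_digraph \<Rightarrow> ('e \<Rightarrow> 'e) \<Rightarrow> ('v, 'e) bicombing \<Rightarrow> bool" where
  "automorphism_equivariant G arev q \<longleftrightarrow>
    (\<forall>\<phi> \<psi>. graph_automorphism G arev \<phi> \<psi> \<longrightarrow>
      (\<forall>\<xi>\<in>graph_boundary G arev. \<forall>\<eta>\<in>graph_boundary G arev.
        q (boundary_action \<phi> \<psi> \<xi>) (boundary_action \<phi> \<psi> \<eta>) =
        ell_infinity_action (arcs G) \<psi> (q \<xi> \<eta>)))"

end

theory Submission
  imports Defs
begin

text \<open>For vertices \<open>v\<close> and \<open>b\<close>, a Markov chain descending from \<open>b\<close> towards \<open>v\<close> along geodesics,
  one sphere around \<open>v\<close> at a time, ends in a probability measure on the sphere of radius \<open>L\<close> around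
  \<open>v\<close>. Chains from \<open>b\<close> and \<open>b'\<close> meet with a definite probability on every sphere below their Gromov
  product, so that this measure depends exponentially little on \<open>b\<close>. Smeared over balls, these measures
  are the transition probabilities of a second chain, which moves from \<open>v\<close> towards the target \<open>b\<close>.
  Two chains of the second kind with the same target, but different sources, again couple at an
  exponential rate, because the smearing makes up for their difference in phase. Joining the
  successive points by random geodesics turns the second chain into a unit flow from \<open>a\<close> to \<open>b\<close> which
  stays near the geodesics and whose value at an edge depends exponentially little on both \<open>a\<close> and
  \<open>b\<close>, measured by Gromov products based at the edge. All choices are uniform averages, hence
  equivariant. Antisymmetrizing in \<open>a\<close> and \<open>b\<close>, the flows of the sides of a triangle cancel
  exponentially away from its centre, which bounds the area. Finally the exponential estimates let
  \<open>a\<close> and \<open>b\<close> tend to boundary points, and all properties pass to the limit.\<close>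

section \<open>Finitely supported means\<close>

text \<open>Each chain takes care of one end. The step law at \<open>v\<close> sees the target only
  through a chain that starts there and forgets its start while descending; nothing is known about
  how this law varies with \<open>v\<close>, so forgetting the source requires chains that really
  merge. Merging requires a common possible next point. For the first chain the slack in
  \<open>Lev\<close> provides it. For the second chain, whose steps have length \<open>L\<close>,
  two chains in one tube could stay out of phase forever; the balls of radius \<open>R0\<close>
  overlap as soon as the heights, that is, the distances to the target, differ by at most
  \<open>16 * De\<close>, and a chain that is higher by more is advanced alone. \<open>L\<close>
  exceeds \<open>R0\<close> by enough that each step still lowers the height, and by the four-point
  inequality a step of this length replaces the old deviation from a geodesic by a fixed one, so
  deviations do not add up. No clever coupling is constructed: the product of two means suffices,
  since a shared point of two sets of size at most \<open>n\<close> gives the diagonal a mass of at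
  least \<open>1 / n^2\<close>.\<close>

definition avg :: "'a set \<Rightarrow> ('a \<Rightarrow> real) \<Rightarrow> real" where
  "avg S f = (\<Sum>s\<in>S. f s) / real (card S)"

text \<open>A finitely supported probability measure is encoded by its expectation functional, so
  that chains compose by function application (\<open>mean_bind\<close>) and the weights stay
  existential.\<close>

definition mean_on :: "'a set \<Rightarrow> (('a \<Rightarrow> real) \<Rightarrow> real) \<Rightarrow> bool" where
  "mean_on S E \<longleftrightarrow> finite S \<and>
    (\<exists>w. (\<forall>s\<in>S. 0 \<le> w s) \<and> (\<Sum>s\<in>S. w s) = 1 \<and> (\<forall>f. E f = (\<Sum>s\<in>S. w s * f s)))"

lemma mean_onE:
  assumes "mean_on S E"
  obtains w where "finite S" "\<And>s. s \<in> S \<Longrightarrow> 0 \<le> w s" "(\<Sum>s\<in>S. w s) = 1"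
    "\<And>f. E f = (\<Sum>s\<in>S. w s * f s)"
  using assms unfolding mean_on_def by blast

lemma mean_avg:
  assumes "finite S" "S \<noteq> {}" shows "mean_on S (avg S)"
  unfolding mean_on_def
proof (intro conjI exI[of _ "\<lambda>_. 1 / real (card S)"] allI)
  fix f show "avg S f = (\<Sum>s\<in>S. 1 / real (card S) * f s)"
    by (simp add: avg_def sum_divide_distrib)
qed (use assms in auto)

lemma mean_on_mono:
  assumes "mean_on S E" "S \<subseteq> T" "finite T" shows "mean_on T E"
proof -
  obtain w where w: "finite S" "\<And>s. s \<in> S \<Longrightarrow> 0 \<le> w s" "(\<Sum>s\<in>S. w s) = 1"
    "\<And>f. E f = (\<Sum>s\<in>S. w s * f s)"
    using assms(1) by (rule mean_onE) auto
  define w' where "w' s = (if s \<in> S then w s else 0)" for s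
  have eq: "(\<Sum>s\<in>T. w' s * f s) = (\<Sum>s\<in>S. w s * f s)" for f :: "'a \<Rightarrow> real"
    by (rule sum.mono_neutral_cong_right) (use assms in \<open>auto simp: w'_def\<close>)
  show ?thesis
    unfolding mean_on_def
  proof (intro conjI exI[of _ w'] allI ballI)
    show "(\<Sum>s\<in>T. w' s) = 1" using eq[of "\<lambda>_. 1"] w(3) by simp
    show "E f = (\<Sum>s\<in>T. w' s * f s)" for f using eq w(4) by simp
    show "0 \<le> w' s" for s using w(2) by (simp add: w'_def)
  qed (use assms in auto)
qed

lemma mean_bind:
  assumes E: "mean_on S E" and F: "\<And>s. s \<in> S \<Longrightarrow> mean_on T (F s)"
  shows "mean_on T (\<lambda>f. E (\<lambda>s. F s f))"
proof -
  obtain w where w: "finite S" "\<And>s. s \<in> S \<Longrightarrow> 0 \<le> w s" "(\<Sum>s\<in>S. w s) = 1"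
    "\<And>f. E f = (\<Sum>s\<in>S. w s * f s)"
    using E by (rule mean_onE) auto
  have "\<exists>u. (\<forall>t\<in>T. 0 \<le> u t) \<and> (\<Sum>t\<in>T. u t) = 1 \<and> (\<forall>f. F s f = (\<Sum>t\<in>T. u t * f t))"
    if "s \<in> S" for s
    using F[OF that] unfolding mean_on_def by blast
  then obtain u where u: "\<And>s t. s \<in> S \<Longrightarrow> t \<in> T \<Longrightarrow> 0 \<le> u s t" "\<And>s. s \<in> S \<Longrightarrow> (\<Sum>t\<in>T. u s t) = 1"
    "\<And>s f. s \<in> S \<Longrightarrow> F s f = (\<Sum>t\<in>T. u s t * f t)"
    by metis
  have "S \<noteq> {}" using w(3) by auto
  then have "finite T" using F unfolding mean_on_def by blast
  have eq: "(\<Sum>t\<in>T. (\<Sum>s\<in>S. w s * u s t) * f t) = (\<Sum>s\<in>S. w s * (\<Sum>t\<in>T. u s t * f t))"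
    for f :: "'b \<Rightarrow> real"
    by (simp add: sum_distrib_left sum_distrib_right mult.assoc) (rule sum.swap)
  show ?thesis unfolding mean_on_def
  proof (intro conjI exI[of _ "\<lambda>t. \<Sum>s\<in>S. w s * u s t"] allI ballI)
    show "finite T" by fact
    show "0 \<le> (\<Sum>s\<in>S. w s * u s t)" if "t \<in> T" for t
      using u(1) w(2) that by (intro sum_nonneg mult_nonneg_nonneg) auto
    show "(\<Sum>t\<in>T. \<Sum>s\<in>S. w s * u s t) = 1"
      using eq[of "\<lambda>_. 1"] u(2) w(3) by simp
    show "E (\<lambda>s. F s f) = (\<Sum>t\<in>T. (\<Sum>s\<in>S. w s * u s t) * f t)" for f
      unfolding eq w(4) using u(3) by (intro sum.cong) auto
  qed
qed

lemma mean_cong: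
  assumes "mean_on S E" "\<And>s. s \<in> S \<Longrightarrow> f s = g s" shows "E f = E g"
  using assms(1) by (rule mean_onE) (use assms(2) in \<open>auto intro!: sum.cong\<close>)

lemma mean_const: "mean_on S E \<Longrightarrow> E (\<lambda>_. c) = c"
  by (erule mean_onE) (simp flip: sum_distrib_right)

lemma mean_diff: "mean_on S E \<Longrightarrow> E (\<lambda>s. f s - g s) = E f - E g"
  by (erule mean_onE) (simp add: sum_subtractf right_diff_distrib)

lemma mean_sum: "mean_on S E \<Longrightarrow> E (\<lambda>s. \<Sum>i\<in>I. f i s) = (\<Sum>i\<in>I. E (f i))"
  by (erule mean_onE) (simp add: sum_distrib_left, rule sum.swap)

lemma mean_mono:
  assumes "mean_on S E" "\<And>s. s \<in> S \<Longrightarrow> f s \<le> g s" shows "E f \<le> E g"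
  using assms(1) by (rule mean_onE) (use assms(2) in \<open>auto intro!: sum_mono mult_left_mono\<close>)

lemma mean_le: "mean_on S E \<Longrightarrow> (\<And>s. s \<in> S \<Longrightarrow> f s \<le> c) \<Longrightarrow> E f \<le> c"
  using mean_mono[of S E f "\<lambda>_. c"] mean_const by fastforce

lemma mean_ge: "mean_on S E \<Longrightarrow> (\<And>s. s \<in> S \<Longrightarrow> c \<le> f s) \<Longrightarrow> c \<le> E f"
  using mean_mono[of S E "\<lambda>_. c" f] mean_const by fastforce

lemma mean_near:
  assumes "mean_on S E" "\<And>s. s \<in> S \<Longrightarrow> \<bar>f s - r\<bar> \<le> B" shows "\<bar>E f - r\<bar> \<le> B"
proof -
  have "E f \<le> r + B" by (rule mean_le[OF assms(1)]) (use assms(2) in force)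
  moreover have "r - B \<le> E f" by (rule mean_ge[OF assms(1)]) (use assms(2) in force)
  ultimately show ?thesis by linarith
qed

text \<open>Integrates the pointwise bound against the product of the two means, that is, under the
  independent coupling.\<close>

lemma mean_near2:
  assumes "mean_on S E" "mean_on T F" "\<And>s t. s \<in> S \<Longrightarrow> t \<in> T \<Longrightarrow> \<bar>f s - g t\<bar> \<le> B"
  shows "\<bar>E f - F g\<bar> \<le> B"
proof (rule mean_near[OF assms(1)])
  fix s assume "s \<in> S"
  have "\<bar>F g - f s\<bar> \<le> B"
    by (rule mean_near[OF assms(2)]) (use assms(3)[OF \<open>s \<in> S\<close>] in force)
  then show "\<bar>f s - F g\<bar> \<le> B" by linarith
qed

lemma avg_image: "inj_on h S \<Longrightarrow> avg (h ` S) f = avg S (\<lambda>s. f (h s))"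
  by (simp add: avg_def sum.reindex card_image)

text \<open>Under the independent coupling of the two uniform measures the pair
  \<open>(z, z)\<close> has mass at least \<open>1 / n^2\<close> and contributes nothing; every
  other pair contributes at most \<open>B\<close>.\<close>

lemma avg_overlap:
  assumes fin: "finite S" "finite T" and z: "z \<in> S" "z \<in> T" and c: "card S \<le> n" "card T \<le> n"
    and B: "\<And>s t. s \<in> S \<Longrightarrow> t \<in> T \<Longrightarrow> \<bar>f s - f t\<bar> \<le> B"
  shows "\<bar>avg S f - avg T f\<bar> \<le> (1 - 1 / (real n)\<^sup>2) * B"
proof -
  have B0: "0 \<le> B" using B[OF z] by simp
  have S: "card S > 0" and T: "card T > 0" using fin z by (auto simp: card_gt_0_iff)
  have "(\<Sum>s\<in>S. \<Sum>t\<in>T. f s - f t) = (\<Sum>s\<in>S. real (card T) * f s - sum f T)"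
    by (simp add: sum_subtractf)
  also have "\<dots> = real (card T) * sum f S - real (card S) * sum f T"
    by (simp add: sum_subtractf sum_distrib_left)
  finally have eq: "(avg S f - avg T f) * (real (card S) * real (card T)) = (\<Sum>s\<in>S. \<Sum>t\<in>T. f s - f t)"
  proof -
    have "(avg S f - avg T f) * (real (card S) * real (card T)) =
        real (card T) * sum f S - real (card S) * sum f T"
      using S T by (simp add: avg_def field_simps)
    then show "(\<Sum>s\<in>S. \<Sum>t\<in>T. f s - f t) = real (card T) * sum f S - real (card S) * sum f T \<Longrightarrow> ?thesis"
      by simp
  qed
  have "\<bar>\<Sum>s\<in>S. \<Sum>t\<in>T. f s - f t\<bar> = \<bar>\<Sum>p\<in>S\<times>T. f (fst p) - f (snd p)\<bar>"
    by (simp add: sum.cartesian_product case_prod_beta)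
  also have "\<dots> = \<bar>\<Sum>p\<in>S\<times>T - {(z,z)}. f (fst p) - f (snd p)\<bar>"
    using fin z by (subst sum.remove[of _ "(z,z)"]) auto
  also have "\<dots> \<le> (\<Sum>p\<in>S\<times>T - {(z,z)}. \<bar>f (fst p) - f (snd p)\<bar>)" by (rule sum_abs)
  also have "\<dots> \<le> (\<Sum>p\<in>S\<times>T - {(z,z)}. B)" by (rule sum_mono) (use B in auto)
  also have "\<dots> = (real (card S) * real (card T) - 1) * B"
    using fin z S T by (simp add: card_Diff_singleton card_cartesian_product of_nat_diff)
  finally have "\<bar>avg S f - avg T f\<bar> * (real (card S) * real (card T)) \<le> (real (card S) * real (card T) - 1) * B"
    unfolding eq[symmetric] by (simp add: abs_mult)
  then have 1: "\<bar>avg S f - avg T f\<bar> \<le> (1 - 1 / (real (card S) * real (card T))) * B"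
    using S T by (simp add: field_simps)
  have "real (card S) * real (card T) \<le> (real n)\<^sup>2"
    unfolding power2_eq_square using c by (intro mult_mono) auto
  then have "1 / (real n)\<^sup>2 \<le> 1 / (real (card S) * real (card T))"
    using S T c by (intro divide_left_mono mult_pos_pos) (auto simp: zero_less_mult_iff)
  then have "(1 - 1 / (real (card S) * real (card T))) * B \<le> (1 - 1 / (real n)\<^sup>2) * B"
    using B0 by (intro mult_right_mono) auto
  then show ?thesis using 1 by linarith
qed


section \<open>Discrete hyperbolic geometry\<close>

text \<open>Distances are natural numbers and hyperbolicity is stated for sums of distances, without
  subtraction; \<open>De\<close> thus plays the role of twice a hyperbolicity constant for Gromov
  products.\<close>

locale hyperbolic_space =
  fixes V :: "'v set" and d :: "'v \<Rightarrow> 'v \<Rightarrow> nat" and De :: nat and NB :: "nat \<Rightarrow> nat"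
  assumes d_self: "x \<in> V \<Longrightarrow> d x x = 0"
    and d_sym: "x \<in> V \<Longrightarrow> y \<in> V \<Longrightarrow> d x y = d y x"
    and d_tri: "x \<in> V \<Longrightarrow> y \<in> V \<Longrightarrow> z \<in> V \<Longrightarrow> d x z \<le> d x y + d y z"
    and four_point: "x \<in> V \<Longrightarrow> y \<in> V \<Longrightarrow> z \<in> V \<Longrightarrow> w \<in> V \<Longrightarrow>
      d x z + d y w \<le> d x y + d z w + De \<or> d x z + d y w \<le> d y z + d x w + De"
    and geodesic: "x \<in> V \<Longrightarrow> y \<in> V \<Longrightarrow> k \<le> d x y \<Longrightarrow> \<exists>z\<in>V. d x z = k \<and> d z y = d x y - k"
    and ball_finite: "x \<in> V \<Longrightarrow> finite {y \<in> V. d x y \<le> r}"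
    and ball_card: "x \<in> V \<Longrightarrow> card {y \<in> V. d x y \<le> r} \<le> NB r"
    and De_pos: "1 \<le> De"
begin

text \<open>All constants of the construction are multiples of \<open>De\<close>, so that the estimates are linear
  arithmetic.\<close>

definition L :: nat where "L = 16 * De"

text \<open>The slack \<open>De\<close> makes the sets of two nearby points overlap, which is what
  allows two descending chains to meet.\<close>

definition Lev :: "'v \<Rightarrow> nat \<Rightarrow> 'v \<Rightarrow> 'v set" where
  "Lev v k x = {y \<in> V. d v y = k * L \<and> d v y + d y x \<le> d v x + De}"

fun mu :: "'v \<Rightarrow> nat \<Rightarrow> ('v \<Rightarrow> real) \<Rightarrow> 'v \<Rightarrow> real" where
  "mu v 0 f x = f x"
| "mu v (Suc k) f x = avg (Lev v (Suc k) x) (mu v k f)"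

text \<open>The excess \<open>2 * De\<close>, unlike the \<open>De\<close> of \<open>Lev\<close>, is
  one that survives arbitrarily many steps of the chain.\<close>

definition shadow :: "'v \<Rightarrow> nat \<Rightarrow> 'v \<Rightarrow> 'v set" where
  "shadow v r b = {y \<in> V. d v y = r \<and> d v y + d y b \<le> d v b + 2 * De}"

lemma Lev_finite: "v \<in> V \<Longrightarrow> finite (Lev v k x)"
  by (rule finite_subset[OF _ ball_finite[of v "k * L"]]) (auto simp: Lev_def)

lemma Lev_nonempty:
  assumes "v \<in> V" "x \<in> V" "k * L \<le> d v x" shows "Lev v k x \<noteq> {}"
  using geodesic[OF assms] assms(3) by (force simp: Lev_def)

text \<open>The excess over a geodesic to \<open>b\<close> does not grow: after a drop of at least
  \<open>L\<close> the four-point inequality bounds it by \<open>De\<close> from \<open>Lev\<close>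
  plus its own error \<open>De\<close>, whatever it was before. Only the first step, out of
  \<open>b\<close> itself, may be shorter than \<open>L\<close>, and there the old excess is zero;
  hence the disjunction.\<close>

lemma mu_split:
  assumes v: "v \<in> V" and b: "b \<in> V" and j: "1 \<le> j"
  shows "j \<le> k \<Longrightarrow> x \<in> V \<Longrightarrow> d v x + d x b \<le> d v b + 2 * De \<Longrightarrow>
    k * L + L \<le> d v x \<or> x = b \<Longrightarrow> k * L \<le> d v x \<Longrightarrow>
    \<exists>E. mean_on (shadow v (j * L) b) E \<and>
      (\<forall>f. mu v k f x = E (mu v (j - 1) f))"
proof (induction k arbitrary: x)
  case 0 then show ?case using j by simp
next
  case (Suc k)
  let ?S = "shadow v (j * L) b"
  have finS: "finite ?S"
    by (rule finite_subset[OF _ ball_finite[of v "j * L"]]) (use v in \<open>auto simp: shadow_def\<close>)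
  have Lev: "d v y + d y b \<le> d v b + 2 * De" if "y \<in> Lev v (Suc k) x" for y
  proof -
    have y: "y \<in> V" "d v y = Suc k * L" "d v y + d y x \<le> d v x + De"
      using that by (auto simp: Lev_def)
    have "L = 16 * De" by (rule L_def)
    then show ?thesis
      using four_point[OF v y(1) Suc.prems(2) b] Suc.prems(3-5) y
        d_sym[OF y(1) Suc.prems(2)] d_sym[OF Suc.prems(2) b] mult_Suc[of k L] d_self[OF b] De_pos
      by (cases "x = b") (simp, linarith)
  qed
  have ne: "Lev v (Suc k) x \<noteq> {}" by (rule Lev_nonempty) (use Suc v in auto)
  have fin: "finite (Lev v (Suc k) x)" by (rule Lev_finite) fact
  show ?case
  proof (cases "j = Suc k")
    case True
    have "mean_on ?S (avg (Lev v (Suc k) x))"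
      by (rule mean_on_mono[OF mean_avg[OF fin ne] _ finS]) (use Lev True in \<open>auto simp: Lev_def shadow_def\<close>)
    then show ?thesis using True by (intro exI[of _ "avg (Lev v (Suc k) x)"]) simp
  next
    case False
    have "\<exists>E. mean_on ?S E \<and> (\<forall>f. mu v k f y = E (mu v (j - 1) f))" if y: "y \<in> Lev v (Suc k) x" for y
      by (rule Suc.IH) (use Suc.prems False y Lev[OF y] in \<open>auto simp: Lev_def\<close>)
    then obtain F where F: "\<And>y. y \<in> Lev v (Suc k) x \<Longrightarrow> mean_on ?S (F y)"
      "\<And>y f. y \<in> Lev v (Suc k) x \<Longrightarrow> mu v k f y = F y (mu v (j - 1) f)"
      using bchoice[of "Lev v (Suc k) x" "\<lambda>y E. mean_on ?S E \<and> (\<forall>f. mu v k f y = E (mu v (j - 1) f))"]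
      by blast
    show ?thesis
    proof (intro exI[of _ "\<lambda>f. avg (Lev v (Suc k) x) (\<lambda>y. F y f)"] conjI allI)
      show "mean_on ?S (\<lambda>f. avg (Lev v (Suc k) x) (\<lambda>y. F y f))"
        by (rule mean_bind[OF mean_avg[OF fin ne]]) (use F in auto)
      show "mu v (Suc k) f x = avg (Lev v (Suc k) x) (\<lambda>y. F y (mu v (j - 1) f))" for f
        unfolding mu.simps by (rule mean_cong[OF mean_avg[OF fin ne]]) (use F in auto)
    qed
  qed
qed

text \<open>Lower bound from \<open>avg_overlap\<close> for the chance of merging at one level; the
  \<open>+ 2\<close> keeps it strictly between 0 and 1.\<close>

definition epsL :: real where "epsL = 1 / (real (NB (L + De) + 2))\<^sup>2"

lemma epsL: "0 < epsL" "epsL < 1"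
proof -
  have "1 < (real (NB (L + De) + 2))\<^sup>2" by (intro one_less_power) auto
  then show "0 < epsL" "epsL < 1" by (auto simp: epsL_def)
qed

text \<open>A point \<open>y0\<close> on a geodesic from \<open>v\<close> to \<open>x\<close> is a
  possible next point for both chains, and any two possible next points are again
  \<open>4 * De\<close>-close, so that every level gains a factor \<open>1 - epsL\<close>.\<close>

lemma mu_contract:
  assumes v: "v \<in> V" and f: "\<And>y z. y \<in> V \<Longrightarrow> z \<in> V \<Longrightarrow> d v y = L \<Longrightarrow> d v z = L \<Longrightarrow> \<bar>f y - f z\<bar> \<le> B"
  shows "x \<in> V \<Longrightarrow> x' \<in> V \<Longrightarrow> d v x = Suc k * L \<Longrightarrow> d v x' = Suc k * L \<Longrightarrow> d x x' \<le> 4 * De \<Longrightarrow>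
    \<bar>mu v k f x - mu v k f x'\<bar> \<le> (1 - epsL) ^ k * B"
proof (induction k arbitrary: x x')
  case 0 then show ?case using f[of x x'] by simp
next
  case (Suc k)
  have LD: "L = 16 * De" by (rule L_def)
  obtain y0 where y0: "y0 \<in> V" "d v y0 = Suc k * L" "d y0 x = L"
    using geodesic[OF v, of x "Suc k * L"] Suc.prems by auto
  have z: "y0 \<in> Lev v (Suc k) x"
    using y0 Suc.prems by (auto simp: Lev_def)
  have z': "y0 \<in> Lev v (Suc k) x'"
    using four_point[of v x y0 x'] four_point[of v y0 x x'] y0 Suc.prems v LD d_sym[of y0 x] d_sym[of x' x] d_sym[of v x] d_sym[of v x']
     d_sym[of y0 x']
    by (auto simp: Lev_def)
  have card: "card (Lev v (Suc k) u) \<le> NB (L + De) + 2" if "u \<in> V" "d v u = Suc (Suc k) * L" for u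
  proof -
    have "Lev v (Suc k) u \<subseteq> {y \<in> V. d u y \<le> L + De}"
      using that d_sym[of u] by (auto simp: Lev_def)
    then have "card (Lev v (Suc k) u) \<le> card {y \<in> V. d u y \<le> L + De}"
      by (rule card_mono[OF ball_finite[OF that(1)]])
    then show ?thesis using ball_card[OF that(1), of "L + De"] by linarith
  qed
  have "\<bar>avg (Lev v (Suc k) x) (mu v k f) - avg (Lev v (Suc k) x') (mu v k f)\<bar>
     \<le> (1 - 1 / (real (NB (L + De) + 2))\<^sup>2) * ((1 - epsL) ^ k * B)"
  proof (rule avg_overlap[OF Lev_finite Lev_finite z z' card card])
    fix s t assume s: "s \<in> Lev v (Suc k) x" and t: "t \<in> Lev v (Suc k) x'"
    have "d s t \<le> 4 * De"
    proof -
      have s': "s \<in> V" "d v s = Suc k * L" "d v s + d s x \<le> d v x + De"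
        and t': "t \<in> V" "d v t = Suc k * L" "d v t + d t x' \<le> d v x' + De"
        using s t by (auto simp: Lev_def)
      have 1: "d s x' \<le> L + 2 * De"
        using four_point[OF v s'(1) Suc.prems(1,2)] s' Suc.prems(3-5) LD De_pos
          mult_Suc[of "Suc k" L] by linarith
      show ?thesis
        using four_point[OF v t'(1) Suc.prems(2) s'(1)] s' t' 1 Suc.prems(3-5) LD De_pos
          mult_Suc[of "Suc k" L] d_sym[OF s'(1) t'(1)] d_sym[OF s'(1) Suc.prems(2)] by linarith
    qed
    then show "\<bar>mu v k f s - mu v k f t\<bar> \<le> (1 - epsL) ^ k * B"
      by (intro Suc.IH) (use s t in \<open>auto simp: Lev_def\<close>)
  qed (use v Suc.prems in auto)
  then show ?case by (simp add: epsL_def mult.assoc)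
qed


section \<open>The exit law of the descending chain on the sphere of radius \<open>L\<close>\<close>

definition dir :: "'v \<Rightarrow> ('v \<Rightarrow> real) \<Rightarrow> 'v \<Rightarrow> real" where
  "dir v f b = mu v (d v b div L) f b"

lemma L_pos: "0 < L"
  using De_pos by (simp add: L_def)

lemma dir_mean:
  assumes v: "v \<in> V" and b: "b \<in> V" and far: "L \<le> d v b"
  shows "mean_on (shadow v L b) (\<lambda>f. dir v f b)"
proof -
  have "1 \<le> d v b div L" using div_le_mono[OF far, of L] L_pos by simp
  then obtain E where "mean_on (shadow v (1 * L) b) E"
    "\<And>f. mu v (d v b div L) f b = E (mu v (1 - 1) f)"
    using mu_split[OF v b, of 1 "d v b div L" b] b d_self[OF b] by auto
  moreover have "mu v 0 f = f" for f by (rule ext) simp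
  moreover have "(\<lambda>f. dir v f b) = E"
    using calculation(2,3) by (intro ext) (simp add: dir_def)
  ultimately show ?thesis by simp
qed

text \<open>Two chains descending towards \<open>v\<close> from \<open>b\<close> and \<open>b'\<close> run at distance at most \<open>4 * De\<close> of each
  other from the level of their Gromov product on, and each further level gives them another
  chance of meeting.\<close>

lemma dir_far:
  assumes v: "v \<in> V" and b: "b \<in> V" and b': "b' \<in> V" and j: "1 \<le> j"
    and s: "d b b' + 2 * (j * L) \<le> d v b + d v b'"
    and f: "\<And>y. y \<in> V \<Longrightarrow> d v y = L \<Longrightarrow> \<bar>f y\<bar> \<le> K"
  shows "\<bar>dir v f b - dir v f b'\<bar> \<le> (1 - epsL) ^ (j - 1) * (2 * K)"
proof -
  have jb: "j * L \<le> d v b" and jb': "j * L \<le> d v b'"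
    using s d_tri[OF v b b'] d_tri[OF v b' b] d_sym[OF b b'] by linarith+
  then have k: "j \<le> d v b div L" "j \<le> d v b' div L"
    using L_pos by (simp_all add: less_eq_div_iff_mult_less_eq)
  obtain E where E: "mean_on (shadow v (j * L) b) E"
    "\<And>f. mu v (d v b div L) f b = E (mu v (j - 1) f)"
    using mu_split[OF v b j k(1), of b] b d_self[OF b] by auto
  obtain F where F: "mean_on (shadow v (j * L) b') F"
    "\<And>f. mu v (d v b' div L) f b' = F (mu v (j - 1) f)"
    using mu_split[OF v b' j k(2), of b'] b' d_self[OF b'] by auto
  show ?thesis
    unfolding dir_def E(2) F(2)
  proof (rule mean_near2[OF E(1) F(1)])
    fix y z assume "y \<in> shadow v (j * L) b"
      and "z \<in> shadow v (j * L) b'"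
    then have y: "y \<in> V" "d v y = j * L" "d v y + d y b \<le> d v b + 2 * De"
      and z: "z \<in> V" "d v z = j * L" "d v z + d z b' \<le> d v b' + 2 * De" by (auto simp: shadow_def)
    \<comment> \<open>By \<open>s\<close> the Gromov product of \<open>b\<close> and
      \<open>b'\<close> is at least \<open>j * L\<close>, so a point of the shadow of
      \<open>b\<close> at that level is also nearly on a geodesic to \<open>b'\<close>.\<close>
    have 1: "d y b' + d v y \<le> d v b' + 3 * De"
      using four_point[OF v y(1) b b'] y s by linarith
    have "d y z \<le> 4 * De"
      using four_point[OF v z(1) b' y(1)] y z 1 d_sym[OF y(1) z(1)] d_sym[OF y(1) b'] by linarith
    moreover have "\<bar>f y - f z\<bar> \<le> 2 * K" if "y \<in> V" "z \<in> V" "d v y = L" "d v z = L" for y z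
      using f[OF that(1,3)] f[OF that(2,4)] by linarith
    ultimately show "\<bar>mu v (j - 1) f y - mu v (j - 1) f z\<bar> \<le> (1 - epsL) ^ (j - 1) * (2 * K)"
      using mu_contract[OF v, of f "2 * K" y z "j - 1"] y z j by auto
  qed
qed

text \<open>Estimates are in terms of twice a Gromov product, so one level of height
  \<open>L\<close> amounts to \<open>2 * L\<close> units; the rate makes these worth exactly one
  factor \<open>1 - epsL\<close>.\<close>

definition thL :: real where "thL = - ln (1 - epsL) / (2 * real L)"

lemma thL_pos: "0 < thL"
  unfolding thL_def using epsL L_pos by (intro divide_pos_pos) auto

lemma exp_thL: "exp (- (2 * real L * thL)) = 1 - epsL"
  using epsL L_pos by (simp add: thL_def)

text \<open>Turns the factors of \<open>dir_far\<close> into an exponential. The loss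
  \<open>4 * L\<close> pays for rounding \<open>s\<close> down to whole levels and for the one level
  missing in the exponent \<open>j - 1\<close>.\<close>

lemma dir_target:
  assumes v: "v \<in> V" and b: "b \<in> V" and b': "b' \<in> V" and far: "L \<le> d v b" "L \<le> d v b'"
    and s: "d b b' + s \<le> d v b + d v b'"
    and f: "\<And>y. y \<in> V \<Longrightarrow> d v y = L \<Longrightarrow> \<bar>f y\<bar> \<le> K"
  shows "\<bar>dir v f b - dir v f b'\<bar> \<le> 2 * K * exp (- thL * (real s - 4 * real L))"
proof -
  obtain y where "y \<in> V" "d v y = L" using geodesic[OF v b far(1)] by auto
  then have K: "0 \<le> K" using f[of y] by linarith
  define j where "j = s div (2 * L)"
  have js: "2 * (j * L) \<le> s" "s < 2 * (j * L) + 2 * L"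
  proof -
    have "s = j * (2 * L) + s mod (2 * L)" unfolding j_def by (rule div_mult_mod_eq[symmetric])
    moreover have "s mod (2 * L) < 2 * L" using L_pos by simp
    ultimately show "2 * (j * L) \<le> s" "s < 2 * (j * L) + 2 * L" by linarith+
  qed
  show ?thesis
  proof (cases "j = 0")
    case True
    then have "real s \<le> 4 * real L" using js by simp
    then have "0 \<le> - thL * (real s - 4 * real L)"
      using thL_pos by (simp add: mult_nonneg_nonpos)
    then have "1 \<le> exp (- thL * (real s - 4 * real L))" by simp
    then have "2 * K * 1 \<le> 2 * K * exp (- thL * (real s - 4 * real L))"
      using K by (intro mult_left_mono) auto
    moreover have "\<bar>dir v f b - dir v f b'\<bar> \<le> 2 * K"
    proof (rule mean_near2[OF dir_mean[OF v b far(1)] dir_mean[OF v b' far(2)]])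
      fix y z assume "y \<in> shadow v L b"
        "z \<in> shadow v L b'"
      then show "\<bar>f y - f z\<bar> \<le> 2 * K" using f[of y] f[of z] by (force simp: shadow_def)
    qed
    ultimately show ?thesis by linarith
  next
    case False
    then have j: "1 \<le> j" by simp
    have "(1 - epsL) ^ (j - 1) = exp (- (2 * real L * thL)) ^ (j - 1)" by (simp only: exp_thL)
    also have "\<dots> = exp (real (j - 1) * - (2 * real L * thL))" by (rule exp_of_nat_mult[symmetric])
    also have "\<dots> \<le> exp (- thL * (real s - 4 * real L))"
    proof -
      have "real s \<le> 2 * (real j * real L) + 2 * real L"
      proof -
        have "real s \<le> real (2 * (j * L) + 2 * L)" using js(2) by (simp only: of_nat_le_iff)
        then show ?thesis by simp
      qed
      then have "real s - 4 * real L \<le> real (j - 1) * (2 * real L)"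
        using j by (simp add: of_nat_diff algebra_simps)
      then have "thL * (real s - 4 * real L) \<le> thL * (real (j - 1) * (2 * real L))"
        using thL_pos by (intro mult_left_mono) auto
      then show ?thesis by (simp add: mult_ac)
    qed
    finally have "(1 - epsL) ^ (j - 1) * (2 * K) \<le> exp (- thL * (real s - 4 * real L)) * (2 * K)"
      using K by (intro mult_right_mono) auto
    moreover have "\<bar>dir v f b - dir v f b'\<bar> \<le> (1 - epsL) ^ (j - 1) * (2 * K)"
      by (rule dir_far[OF v b b' j _ f]) (use s js in linarith)+
    ultimately show ?thesis by (simp add: mult_ac)
  qed
qed


section \<open>The chain moving towards a target\<close>

definition nball :: "'v \<Rightarrow> nat \<Rightarrow> 'v set" where
  "nball x r = {y \<in> V. d x y \<le> r}"

text \<open>Half of \<open>22 * De\<close>, the largest distance in \<open>balls_overlap\<close>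
  between the centres of the balls of two chains that are advanced together.\<close>

definition R0 :: nat where "R0 = 11 * De"

definition step :: "'v \<Rightarrow> ('v \<Rightarrow> real) \<Rightarrow> 'v \<Rightarrow> real" where
  "step v f b = dir v (\<lambda>y. avg (nball y R0) f) b"

definition nxt :: "'v \<Rightarrow> 'v \<Rightarrow> 'v set" where
  "nxt v b = {z \<in> V. \<exists>y\<in>V. d v y = L \<and> d v y + d y b \<le> d v b + 2 * De \<and> d y z \<le> R0}"

definition tube :: "'v \<Rightarrow> 'v \<Rightarrow> nat \<Rightarrow> 'v set" where
  "tube u b k = {v \<in> V. d u v + d v b \<le> d u b + k}"

lemma mean_ball: "y \<in> V \<Longrightarrow> mean_on (nball y r) (avg (nball y r))"
  using ball_finite[of y r] d_self[of y] by (intro mean_avg) (auto simp: nball_def)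

lemma nxt_finite: "v \<in> V \<Longrightarrow> b \<in> V \<Longrightarrow> finite (nxt v b)"
proof (rule finite_subset[OF _ ball_finite])
  show "nxt v b \<subseteq> {y \<in> V. d v y \<le> L + R0}" if "v \<in> V" "b \<in> V"
  proof
    fix z assume "z \<in> nxt v b"
    then obtain y where "z \<in> V" "y \<in> V" "d v y = L" "d y z \<le> R0" by (auto simp: nxt_def)
    then show "z \<in> {y \<in> V. d v y \<le> L + R0}" using d_tri[of v y z] that by auto
  qed
qed

lemma step_mean:
  assumes v: "v \<in> V" and b: "b \<in> V" and far: "L \<le> d v b"
  shows "mean_on (nxt v b) (\<lambda>f. step v f b)"
  unfolding step_def
proof (rule mean_bind[OF dir_mean[OF assms]])
  fix y assume y: "y \<in> shadow v L b"
  show "mean_on (nxt v b) (avg (nball y R0))"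
    by (rule mean_on_mono[OF mean_ball]) (use y nxt_finite v b in \<open>auto simp: nxt_def nball_def shadow_def\<close>)
qed

text \<open>\<open>27 = 16 + 11\<close> is step length plus smearing; the guaranteed progress
  \<open>3 = 16 - 2 - 11\<close> is step length minus shadow excess minus smearing.\<close>

lemma nxt_bounds:
  assumes "v \<in> V" "b \<in> V" "z \<in> nxt v b"
  shows "z \<in> V" "d v z \<le> 27 * De" "d z b + 3 * De \<le> d v b" "d v b \<le> d z b + 27 * De"
proof -
  obtain y where y: "z \<in> V" "y \<in> V" "d v y = 16 * De" "d v y + d y b \<le> d v b + 2 * De" "d y z \<le> 11 * De"
    using assms(3) by (auto simp: nxt_def L_def R0_def)
  show "z \<in> V" by fact
  show "d v z \<le> 27 * De" using d_tri[of v y z] y assms by auto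
  then show "d v b \<le> d z b + 27 * De" using d_tri[of v z b] y assms by auto
  show "d z b + 3 * De \<le> d v b" using d_tri[of z y b] d_sym[of z y] y assms by auto
qed

text \<open>A step of length \<open>L\<close> is long enough for the four-point inequality to forget
  a deviation of up to \<open>26 * De\<close>. The smearing then adds at most
  \<open>22 * De\<close>, so the chain never leaves its tube.\<close>

lemma center_tube:
  assumes u: "u \<in> V" and b: "b \<in> V" and v: "v \<in> tube u b (26 * De)"
    and y: "y \<in> V" "d v y = L" "d v y + d y b \<le> d v b + 2 * De"
  shows "y \<in> tube u b (3 * De)"
proof -
  have v': "v \<in> V" "d u v + d v b \<le> d u b + 26 * De" using v by (auto simp: tube_def)
  have "d u y + d y b \<le> d u b + 3 * De"
    using four_point[OF u v'(1) y(1) b] y v' by (simp add: L_def) linarith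
  then show ?thesis using y by (simp add: tube_def)
qed

lemma nxt_tube:
  assumes u: "u \<in> V" and b: "b \<in> V" and v: "v \<in> tube u b (26 * De)" and z: "z \<in> nxt v b"
  shows "z \<in> tube u b (25 * De)"
proof -
  obtain y where y: "z \<in> V" "y \<in> V" "d v y = L" "d v y + d y b \<le> d v b + 2 * De" "d y z \<le> 11 * De"
    using z by (auto simp: nxt_def R0_def)
  have "d u y + d y b \<le> d u b + 3 * De"
    using center_tube[OF u b v y(2-4)] by (simp add: tube_def)
  then have "d u z + d z b \<le> d u b + 25 * De"
    using d_tri[OF u y(2) y(1)] d_tri[OF y(1,2) b] d_sym[OF y(1,2)] y by linarith
  then show ?thesis using y by (simp add: tube_def)
qed

lemma tube_mono: "v \<in> tube u b k \<Longrightarrow> k \<le> l \<Longrightarrow> v \<in> tube u b l"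
  by (simp add: tube_def)

text \<open>The expected total cost of the chain from \<open>v\<close> to \<open>b\<close>, where \<open>c v z\<close> is the cost of moving from
  \<open>v\<close> to \<open>z\<close>. The test in the recursive call holds for all points reached by the step and is only
  there for termination.\<close>

function flow :: "('v \<Rightarrow> 'v \<Rightarrow> real) \<Rightarrow> 'v \<Rightarrow> 'v \<Rightarrow> real" where
  "flow c b v = (if d v b \<le> 2 * L then c v b
    else step v (\<lambda>z. c v z + (if d z b < d v b then flow c b z else 0)) b)"
  by pat_completeness auto
termination by (relation "Wellfounded.measure (\<lambda>(c, b, v). d v b)") auto

declare flow.simps [simp del]

lemma flow_near: "d v b \<le> 2 * L \<Longrightarrow> flow c b v = c v b"
  by (simp add: flow.simps)

lemma flow_step:
  assumes "v \<in> V" "b \<in> V" "2 * L < d v b"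
  shows "flow c b v = step v (\<lambda>z. c v z + flow c b z) b"
proof -
  have "flow c b v = step v (\<lambda>z. c v z + (if d z b < d v b then flow c b z else 0)) b"
    using assms by (subst flow.simps) simp
  also have "\<dots> = step v (\<lambda>z. c v z + flow c b z) b"
  proof (rule mean_cong[OF step_mean])
    fix z assume "z \<in> nxt v b"
    then show "c v z + (if d z b < d v b then flow c b z else 0) = c v z + flow c b z"
      using nxt_bounds(3)[of v b z] assms De_pos by auto
  qed (use assms in auto)
  finally show ?thesis .
qed

text \<open>The costs of interest are carried by a single edge with tail \<open>x\<close>.\<close>

definition local_cost :: "('v \<Rightarrow> 'v \<Rightarrow> real) \<Rightarrow> 'v \<Rightarrow> bool" where
  "local_cost c x \<longleftrightarrow> x \<in> V \<and> (\<forall>v\<in>V. \<forall>z\<in>V. 0 \<le> c v z \<and> c v z \<le> real (d v z) \<and>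
    (c v z \<noteq> 0 \<longrightarrow> d v x + d x z \<le> d v z))"

section \<open>Support and size of the flow through one edge\<close>

lemma local_costD:
  assumes "local_cost c x"
  shows "x \<in> V" "v \<in> V \<Longrightarrow> z \<in> V \<Longrightarrow> 0 \<le> c v z" "v \<in> V \<Longrightarrow> z \<in> V \<Longrightarrow> c v z \<le> real (d v z)"
    "v \<in> V \<Longrightarrow> z \<in> V \<Longrightarrow> c v z \<noteq> 0 \<Longrightarrow> d v x + d x z \<le> d v z"
  using assms by (auto simp: local_cost_def)

text \<open>The chain stays in the tube, and each of its moves, including the last one of length at
  most \<open>2 * L = 32 * De\<close>, is too short to pass through \<open>x\<close>.\<close>

lemma flow_zero_tube:
  assumes c: "local_cost c x" and u: "u \<in> V" and b: "b \<in> V"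
    and far: "\<And>v. v \<in> tube u b (26 * De) \<Longrightarrow> 32 * De < d v x"
  shows "v \<in> tube u b (26 * De) \<Longrightarrow> flow c b v = 0"
proof (induction "d v b" arbitrary: v rule: less_induct)
  case less
  have v: "v \<in> V" using less.prems by (simp add: tube_def)
  show ?case
  proof (cases "d v b \<le> 2 * L")
    case True
    have "c v b = 0"
    proof (rule ccontr)
      assume "c v b \<noteq> 0"
      then show False using local_costD(4)[OF c v b] far[OF less.prems] True by (simp add: L_def)
    qed
    then show ?thesis using True by (simp add: flow_near)
  next
    case False
    have "flow c b v = step v (\<lambda>z. c v z + flow c b z) b" using False v b by (intro flow_step) auto
    also have "\<dots> = step v (\<lambda>z. 0) b"
    proof (rule mean_cong[OF step_mean])
      fix z assume z: "z \<in> nxt v b"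
      have "flow c b z = 0"
        by (rule less.hyps) (use nxt_bounds[OF v b z] nxt_tube[OF u b less.prems z] tube_mono De_pos in auto)
      moreover have "c v z = 0"
      proof (rule ccontr)
        assume "c v z \<noteq> 0"
        then show False
          using local_costD(4)[OF c v, of z] far[OF less.prems] nxt_bounds[OF v b z] by simp
      qed
      ultimately show "c v z + flow c b z = 0" by simp
    qed (use v b False in auto)
    also have "\<dots> = 0" by (rule mean_const[OF step_mean]) (use v b False in auto)
    finally show ?thesis .
  qed
qed

text \<open>\<open>90 = 26 + 2 * 32\<close>: a nonzero flow forces some point of the tube to be
  within \<open>32 * De\<close> of \<open>x\<close>.\<close>

lemma flow_support:
  assumes c: "local_cost c x" and u: "u \<in> V" and b: "b \<in> V" and nz: "flow c b u \<noteq> 0"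
  shows "d u x + d x b \<le> d u b + 90 * De"
proof -
  have "u \<in> tube u b (26 * De)" using u d_self by (simp add: tube_def)
  then obtain v where v: "v \<in> tube u b (26 * De)" "d v x \<le> 32 * De"
    using flow_zero_tube[OF c u b] nz by (metis not_le)
  have v': "v \<in> V" "d u v + d v b \<le> d u b + 26 * De" using v by (auto simp: tube_def)
  have x: "x \<in> V" using c by (rule local_costD)
  show ?thesis
    using d_tri[OF u v'(1) x] d_tri[OF x v'(1) b] d_sym[OF x v'(1)] v' v(2) by linarith
qed

lemma flow_nonneg:
  assumes c: "local_cost c x" and b: "b \<in> V"
  shows "v \<in> V \<Longrightarrow> 0 \<le> flow c b v"
proof (induction "d v b" arbitrary: v rule: less_induct)
  case less
  show ?case
  proof (cases "d v b \<le> 2 * L")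
    case True then show ?thesis using local_costD(2)[OF c less.prems b] by (simp add: flow_near)
  next
    case False
    then have "flow c b v = step v (\<lambda>z. c v z + flow c b z) b"
      using less.prems b by (intro flow_step) auto
    moreover have "0 \<le> step v (\<lambda>z. c v z + flow c b z) b"
    proof (rule mean_ge[OF step_mean])
      fix z assume z: "z \<in> nxt v b"
      have "0 \<le> flow c b z" using nxt_bounds[OF less.prems b z] De_pos by (intro less.hyps) auto
      then show "0 \<le> c v z + flow c b z"
        using local_costD(2)[OF c less.prems, of z] nxt_bounds[OF less.prems b z] by auto
    qed (use less.prems b False in auto)
    ultimately show ?thesis by simp
  qed
qed

text \<open>A move costs at most its length, hence at most \<open>32 * De\<close>; the other factor
  bounds the number of costly moves, since they happen only while the height is close to that of
  \<open>x\<close>.\<close>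

definition K0 :: real where "K0 = 32 * real De * (64 * real De + 1)"

lemma K0_pos: "0 < K0"
  using De_pos by (simp add: K0_def)

lemma flow_bound:
  assumes c: "local_cost c x" and b: "b \<in> V" and v: "v \<in> V"
  shows "flow c b v \<le> K0"
proof -
  define D where "D = real De"
  have D: "1 \<le> D" using De_pos by (simp add: D_def)
  define t where "t v = real (d v b) + 32 * D - real (d x b)" for v
  \<comment> \<open>\<open>32 * D * g (t v)\<close> is a potential that bounds the cost still to
    come: \<open>g\<close> is constant far above and far below the height of \<open>x\<close>, and a
    costly move lowers it by at least 1.\<close>
  define g where "g r = min (64 * D + 1) (max 0 (r + 1))" for r :: real
  have x: "x \<in> V" using c by (rule local_costD)
  have "v \<in> V \<Longrightarrow> flow c b v \<le> 32 * D * g (t v)" for v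
  proof (induction "d v b" arbitrary: v rule: less_induct)
    case less
    note v = less.prems
    have g0: "0 \<le> g r" for r using D by (simp add: g_def)
    show ?case
    proof (cases "d v b \<le> 2 * L")
      case True
      have "c v b \<le> 32 * D * g (t v)"
      proof (cases "c v b = 0")
        case True then show ?thesis using g0 D by simp
      next
        case False
        have "d v x + d x b \<le> d v b" using False by (rule local_costD(4)[OF c v b])
        then have "1 \<le> g (t v)" using D by (auto simp: g_def t_def)
        then have "32 * D * 1 \<le> 32 * D * g (t v)" using D by (intro mult_left_mono) auto
        moreover have "c v b \<le> 32 * D"
          using local_costD(3)[OF c v b] True by (simp add: L_def D_def)
        ultimately show ?thesis by simp
      qed
      then show ?thesis using True by (simp add: flow_near)
    next
      case False
      have "step v (\<lambda>z. c v z + flow c b z) b \<le> 32 * D * g (t v)"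
      proof (rule mean_le[OF step_mean])
        fix z assume z: "z \<in> nxt v b"
        note zb = nxt_bounds[OF v b z]
        have IH: "flow c b z \<le> 32 * D * g (t z)" using zb De_pos by (intro less.hyps) auto
        have tz: "t z \<le> t v - 3 * D" using zb(3) by (simp add: t_def D_def)
        show "c v z + flow c b z \<le> 32 * D * g (t v)"
        proof (cases "c v z = 0")
          case True
          have "g (t z) \<le> g (t v)" using tz D by (auto simp: g_def)
          then have "32 * D * g (t z) \<le> 32 * D * g (t v)" using D by (intro mult_left_mono) auto
          then show ?thesis using IH True by simp
        next
          case False
          have 1: "d v x + d x z \<le> d v z" using False by (rule local_costD(4)[OF c v zb(1)])
          then have "d v b \<le> d x b + 27 * De" "d x b \<le> d v b + 27 * De"
            using d_tri[OF v x b] d_tri[OF x v b] d_sym[OF x v] zb(2) by linarith+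
          then have 2: "real (d v b) \<le> real (d x b) + 27 * D" "real (d x b) \<le> real (d v b) + 27 * D"
            unfolding D_def by linarith+
          have gv: "g (t v) = t v + 1" using 2 D by (auto simp: g_def t_def)
          have "g (t z) \<le> t v" using 2 D tz by (auto simp: g_def t_def)
          then have "32 * D * g (t z) \<le> 32 * D * t v" using D by (intro mult_left_mono) auto
          moreover have "c v z \<le> 32 * D"
            using local_costD(3)[OF c v zb(1)] zb(2) by (simp add: D_def)
          ultimately show ?thesis using IH unfolding gv by (simp add: distrib_left)
        qed
      qed (use v b False in auto)
      then show ?thesis using flow_step[OF v b] False by simp
    qed
  qed
  then have "flow c b v \<le> 32 * D * g (t v)" using v by blast
  also have "\<dots> \<le> 32 * D * (64 * D + 1)" using D by (intro mult_left_mono) (auto simp: g_def)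
  finally show ?thesis by (simp add: K0_def D_def)
qed

lemma flow_diff_le:
  assumes "local_cost c x" "b \<in> V" "v \<in> V" "b' \<in> V" "v' \<in> V"
  shows "\<bar>flow c b v - flow c b' v'\<bar> \<le> K0"
  using flow_nonneg[OF assms(1,2,3)] flow_nonneg[OF assms(1,4,5)]
    flow_bound[OF assms(1,2,3)] flow_bound[OF assms(1,4,5)] by linarith

text \<open>So far above \<open>x\<close> no single move can pass through it; hence its cost
  vanishes and the flow is harmonic for the chain.\<close>

lemma flow_far:
  assumes c: "local_cost c x" and b: "b \<in> V" and v: "v \<in> V" and far: "d x b + 32 * De < d v b"
  shows "flow c b v = step v (flow c b) b"
proof -
  have "flow c b v = step v (\<lambda>z. c v z + flow c b z) b"
    using far by (intro flow_step v b) (simp add: L_def)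
  also have "\<dots> = step v (flow c b) b"
  proof (rule mean_cong[OF step_mean])
    fix z assume z: "z \<in> nxt v b"
    note zb = nxt_bounds[OF v b z]
    have "c v z = 0"
    proof (rule ccontr)
      assume "c v z \<noteq> 0"
      then have "d v x + d x z \<le> d v z" by (rule local_costD(4)[OF c v zb(1)])
      then show False using d_tri[OF v local_costD(1)[OF c] b] zb(2) far by linarith
    qed
    then show "c v z + flow c b z = flow c b z" by simp
  qed (use v b far in \<open>auto simp: L_def\<close>)
  finally show ?thesis .
qed


section \<open>Dependence on the source\<close>

definition epsM :: real where "epsM = 1 / (real (NB R0 + 2))\<^sup>2"

text \<open>One joint advance lowers \<open>mexp\<close> by at most
  \<open>54 * De * (1 + 40 * De)\<close>; the rate makes this loss cost exactly one factor
  \<open>1 - epsM\<close>.\<close>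

definition thM :: real where "thM = - ln (1 - epsM) / (54 * real De * (1 + 40 * real De))"

lemma epsM: "0 < epsM" "epsM < 1"
proof -
  have "1 < (real (NB R0 + 2))\<^sup>2" by (intro one_less_power) auto
  then show "0 < epsM" "epsM < 1" by (auto simp: epsM_def)
qed

lemma thM_pos: "0 < thM"
  unfolding thM_def using epsM De_pos by (intro divide_pos_pos mult_pos_pos) auto

lemma exp_thM: "(1 - epsM) * exp (thM * (54 * real De * (1 + 40 * real De))) = 1"
proof -
  have "0 < 54 * real De * (1 + 40 * real De)" using De_pos by (intro mult_pos_pos) auto
  then have "thM * (54 * real De * (1 + 40 * real De)) = - ln (1 - epsM)"
    unfolding thM_def by (metis less_numeral_extra(3) nonzero_eq_divide_eq)
  then show ?thesis using epsM by (simp add: exp_minus)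
qed

text \<open>Two chains with the same target in a common tube: when their heights differ by at most
  \<open>16 * De\<close>, both are advanced and meet with probability at least \<open>epsM\<close>; otherwise only the
  farther one is advanced, which decreases the difference of the heights. The exponent below does
  not decrease in the second case and decreases by a bounded amount in the first one.\<close>

definition mexp :: "'v \<Rightarrow> 'v \<Rightarrow> 'v \<Rightarrow> 'v \<Rightarrow> real" where
  "mexp x b v w = real (d v b) + real (d w b) - 2 * real (d x b)
    - 54 * real De * \<bar>real (d v b) - real (d w b)\<bar>"

text \<open>Once one chain is no more than \<open>32 * De\<close> above the height of
  \<open>x\<close>, only the trivial bound \<open>K0\<close> is left, and \<open>mexp\<close> is
  then at most \<open>64 * De\<close>.\<close>

definition KM :: real where "KM = K0 * exp (thM * (64 * real De))"

lemma KM_pos: "0 < KM"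
  using K0_pos by (simp add: KM_def)

text \<open>Inside a tube the distance of two points is at most the difference of their heights plus
  \<open>4 * De\<close>, here \<open>22 * De = 2 * R0\<close>; a suitable point on a geodesic
  between them lies in both balls.\<close>

lemma balls_overlap:
  assumes u: "u \<in> V" and b: "b \<in> V" and y: "y \<in> tube u b (3 * De)" and z: "z \<in> tube u b (3 * De)"
    and h: "d y b \<le> d z b + 18 * De" "d z b \<le> d y b + 18 * De"
  shows "nball y R0 \<inter> nball z R0 \<noteq> {}"
proof -
  have y': "y \<in> V" "d u y + d y b \<le> d u b + 3 * De" and z': "z \<in> V" "d u z + d z b \<le> d u b + 3 * De"
    using y z by (auto simp: tube_def)
  have "d y z \<le> 22 * De"
    using four_point[OF y'(1) u z'(1) b] y' z' h d_sym[OF y'(1) u] d_sym[OF z'(1) u] d_sym[OF u y'(1)]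
    by linarith
  moreover obtain w where "w \<in> V" "d y w = min (11 * De) (d y z)" "d w z = d y z - min (11 * De) (d y z)"
    using geodesic[OF y'(1) z'(1), of "min (11 * De) (d y z)"] by auto
  ultimately have "w \<in> nball y R0 \<inter> nball z R0"
    using d_sym[of w z] z'(1) by (auto simp: nball_def R0_def)
  then show ?thesis by blast
qed

lemma flow_merge:
  assumes c: "local_cost c x" and u: "u \<in> V" and b: "b \<in> V"
  shows "v \<in> tube u b (26 * De) \<Longrightarrow> w \<in> tube u b (26 * De) \<Longrightarrow>
    \<bar>flow c b v - flow c b w\<bar> \<le> KM * exp (- thM * mexp x b v w)"
proof (induction "d v b + d w b" arbitrary: v w rule: less_induct)
  case less
  \<comment> \<open>The case distinction below takes \<open>w\<close> to be the lower chain. The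
    induction hypothesis is restated as a premise so that the opposite order can use the same
    argument.\<close>
  have main: "\<bar>flow c b v - flow c b w\<bar> \<le> KM * exp (- thM * mexp x b v w)"
    if v: "v \<in> tube u b (26 * De)" and w: "w \<in> tube u b (26 * De)" and le: "d w b \<le> d v b"
      and IH: "\<And>v' w'. d v' b + d w' b < d v b + d w b \<Longrightarrow> v' \<in> tube u b (26 * De) \<Longrightarrow>
        w' \<in> tube u b (26 * De) \<Longrightarrow>
        \<bar>flow c b v' - flow c b w'\<bar> \<le> KM * exp (- thM * mexp x b v' w')"
    for v w
  proof -
    define D where "D = real De"
    have D: "1 \<le> D" using De_pos by (simp add: D_def)
    have D2: "D \<le> D * D" using D mult_left_mono[of 1 D D] by simp
    have vV: "v \<in> V" and wV: "w \<in> V" using v w by (auto simp: tube_def)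
    have le': "real (d w b) \<le> real (d v b)" using le by simp
    consider "d w b \<le> d x b + 32 * De"
      | "d x b + 32 * De < d w b" "d v b \<le> d w b + 16 * De"
      | "d x b + 32 * De < d w b" "d w b + 16 * De < d v b" by linarith
    then show ?thesis
    proof cases
      case 1
      then have "real (d w b) \<le> real (d x b) + 32 * D" unfolding D_def by linarith
      moreover have "54 * D * (real (d v b) - real (d w b)) \<ge> 1 * (real (d v b) - real (d w b))"
        using D le' by (intro mult_right_mono) auto
      ultimately have "mexp x b v w \<le> 64 * D"
        unfolding mexp_def using le' by (simp add: D_def)
      then have "thM * mexp x b v w \<le> thM * (64 * D)"
        using thM_pos by (intro mult_left_mono) auto
      then have "1 \<le> exp (thM * (64 * D) + - thM * mexp x b v w)" by simp
      then have "K0 * 1 \<le> K0 * (exp (thM * (64 * D)) * exp (- thM * mexp x b v w))"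
        unfolding exp_add using K0_pos by (intro mult_left_mono) auto
      then show ?thesis
        using flow_diff_le[OF c b vV b wV] by (simp add: KM_def D_def mult.assoc)
    next
      case 2
      \<comment> \<open>Bound after a joint advance: each height has dropped by between
        \<open>3 * D\<close> and \<open>27 * D\<close>, so their difference has become at most
        \<open>16 + 24 = 40\<close> times \<open>D\<close>.\<close>
      let ?B = "KM * exp (- thM * (mexp x b v w - 54 * D * (1 + 40 * D)))"
      have far: "L \<le> d v b" "L \<le> d w b" using 2 le by (auto simp: L_def)
      have "\<bar>step v (flow c b) b - step w (flow c b) b\<bar> \<le> (1 - epsM) * ?B"
        unfolding step_def
      proof (rule mean_near2[OF dir_mean[OF vV b far(1)] dir_mean[OF wV b far(2)]])
        fix y z assume "y \<in> shadow v L b"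
          and "z \<in> shadow w L b"
        then have y: "y \<in> V" "d v y = L" "d v y + d y b \<le> d v b + 2 * De"
          and z: "z \<in> V" "d w z = L" "d w z + d z b \<le> d w b + 2 * De" by (auto simp: shadow_def)
        have "d y b \<le> d z b + 18 * De" "d z b \<le> d y b + 18 * De"
          using y z 2(2) le d_tri[OF vV y(1) b] d_tri[OF wV z(1) b] by linarith+
        then obtain m where m: "m \<in> nball y R0" "m \<in> nball z R0"
          using balls_overlap[OF u b center_tube[OF u b v y] center_tube[OF u b w z]] by blast
        have card: "card (nball y R0) \<le> NB R0 + 2" if "y \<in> V" for y
          using ball_card[OF that, of R0] by (simp add: nball_def)
        show "\<bar>avg (nball y R0) (flow c b) - avg (nball z R0) (flow c b)\<bar> \<le> (1 - epsM) * ?B"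
          unfolding epsM_def
        proof (rule avg_overlap[OF _ _ m card[OF y(1)] card[OF z(1)]])
          show "finite (nball y R0)" "finite (nball z R0)"
            using ball_finite y z by (auto simp: nball_def)
          fix p q assume p: "p \<in> nball y R0" and q: "q \<in> nball z R0"
          have pn: "p \<in> nxt v b" and qn: "q \<in> nxt w b"
            using p q y z by (auto simp: nxt_def nball_def)
          note pb = nxt_bounds[OF vV b pn] and qb = nxt_bounds[OF wV b qn]
          have pt: "p \<in> tube u b (26 * De)" "q \<in> tube u b (26 * De)"
            using nxt_tube[OF u b v pn] nxt_tube[OF u b w qn] tube_mono by auto
          have "mexp x b v w - 54 * D * (1 + 40 * D) \<le> mexp x b p q"
          proof -
            have "d p b \<le> d q b + 40 * De" "d q b \<le> d p b + 40 * De"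
              using pb qb le 2(2) by linarith+
            then have "\<bar>real (d p b) - real (d q b)\<bar> \<le> 40 * D" unfolding D_def by linarith
            then have "54 * D * \<bar>real (d p b) - real (d q b)\<bar> \<le> 54 * D * (40 * D)"
              using D by (intro mult_left_mono) auto
            moreover have "0 \<le> 54 * D * \<bar>real (d v b) - real (d w b)\<bar>" using D by simp
            moreover have "real (d v b) \<le> real (d p b) + 27 * D" "real (d w b) \<le> real (d q b) + 27 * D"
              using pb qb unfolding D_def by linarith+
            ultimately show ?thesis unfolding mexp_def D_def[symmetric] distrib_left by linarith
          qed
          then have "thM * (mexp x b v w - 54 * D * (1 + 40 * D)) \<le> thM * mexp x b p q"
            using thM_pos by (intro mult_left_mono) auto
          then have "KM * exp (- thM * mexp x b p q) \<le> ?B"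
            using KM_pos by (intro mult_left_mono) auto
          moreover have "\<bar>flow c b p - flow c b q\<bar> \<le> KM * exp (- thM * mexp x b p q)"
            using pb qb De_pos by (intro IH pt) linarith
          ultimately show "\<bar>flow c b p - flow c b q\<bar> \<le> ?B" by linarith
        qed
      qed
      moreover have "(1 - epsM) * ?B = KM * exp (- thM * mexp x b v w)"
      proof -
        have "- thM * (mexp x b v w - 54 * D * (1 + 40 * D))
          = - thM * mexp x b v w + thM * (54 * D * (1 + 40 * D))" by (simp add: right_diff_distrib)
        then have "(1 - epsM) * ?B = KM * exp (- thM * mexp x b v w) *
          ((1 - epsM) * exp (thM * (54 * D * (1 + 40 * D))))" by (simp only: exp_add mult_ac)
        then show ?thesis using exp_thM by (simp add: D_def)
      qed
      moreover have "flow c b v = step v (flow c b) b" "flow c b w = step w (flow c b) b"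
        using 2 le by (auto intro!: flow_far[OF c b] vV wV)
      ultimately show ?thesis by (simp only:)
    next
      \<comment> \<open>Only \<open>v\<close> advances. The difference of heights shrinks by at
        least \<open>3 * De\<close>, and its weight \<open>54 * De\<close> in \<open>mexp\<close>
        more than repays the lost height of at most \<open>27 * De\<close>.\<close>
      case 3
      have "\<bar>step v (flow c b) b - flow c b w\<bar> \<le> KM * exp (- thM * mexp x b v w)"
      proof (rule mean_near[OF step_mean[OF vV b]])
        fix z assume z: "z \<in> nxt v b"
        note zb = nxt_bounds[OF vV b z]
        have zt: "z \<in> tube u b (26 * De)" using nxt_tube[OF u b v z] tube_mono by auto
        have "mexp x b v w \<le> mexp x b z w"
        proof -
          have "d z b + 3 * De \<le> d v b" "d w b + 3 * De \<le> d v b" "2 * d w b + 3 * De \<le> d z b + d v b"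
            using zb 3 by linarith+
          then have "real (d z b) + 3 * D \<le> real (d v b)" "real (d w b) + 3 * D \<le> real (d v b)"
            "2 * real (d w b) + 3 * D \<le> real (d z b) + real (d v b)" unfolding D_def by linarith+
          then have "\<bar>real (d z b) - real (d w b)\<bar> \<le> \<bar>real (d v b) - real (d w b)\<bar> - 3 * D"
            using D by linarith
          then have "54 * D * \<bar>real (d z b) - real (d w b)\<bar> \<le> 54 * D * (\<bar>real (d v b) - real (d w b)\<bar> - 3 * D)"
            using D by (intro mult_left_mono) auto
          moreover have "real (d v b) \<le> real (d z b) + 27 * D" using zb unfolding D_def by linarith
          ultimately show ?thesis using D D2
            unfolding mexp_def D_def[symmetric] right_diff_distrib by linarith
        qed
        then have "thM * mexp x b v w \<le> thM * mexp x b z w"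
          using thM_pos by (intro mult_left_mono) auto
        then have "KM * exp (- thM * mexp x b z w) \<le> KM * exp (- thM * mexp x b v w)"
          using KM_pos by (intro mult_left_mono) auto
        moreover have "\<bar>flow c b z - flow c b w\<bar> \<le> KM * exp (- thM * mexp x b z w)"
          using zb De_pos by (intro IH zt w) linarith
        ultimately show "\<bar>flow c b z - flow c b w\<bar> \<le> KM * exp (- thM * mexp x b v w)"
          by linarith
      qed (use 3 in \<open>simp add: L_def\<close>)
      then show ?thesis using flow_far[OF c b vV] 3 by simp
    qed
  qed
  show ?case
  proof (cases "d w b \<le> d v b")
    case True then show ?thesis by (rule main[OF less.prems _ less.hyps])
  next
    case False
    have "\<bar>flow c b w - flow c b v\<bar> \<le> KM * exp (- thM * mexp x b w v)"
    proof (rule main[OF less.prems(2,1)])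
      show "d v b \<le> d w b" using False by simp
      fix v' w' assume "d v' b + d w' b < d w b + d v b" "v' \<in> tube u b (26 * De)" "w' \<in> tube u b (26 * De)"
      then show "\<bar>flow c b v' - flow c b w'\<bar> \<le> KM * exp (- thM * mexp x b v' w')"
        by (intro less.hyps) auto
    qed
    moreover have "mexp x b w v = mexp x b v w"
      by (simp add: mexp_def abs_minus_commute)
    ultimately show ?thesis by (simp add: abs_minus_commute)
  qed
qed

text \<open>Above the height \<open>h\<close> the flow is harmonic, so the chain can be stopped when
  it first gets to height \<open>h\<close> or below; it then undershoots \<open>h\<close> by at most
  one move, \<open>27 * De\<close>.\<close>

lemma flow_advance:
  assumes c: "local_cost c x" and u: "u \<in> V" and b: "b \<in> V" and h: "d x b + 32 * De \<le> h"
    and near: "\<And>w. w \<in> tube u b (25 * De) \<Longrightarrow> d w b \<le> h \<Longrightarrow> h \<le> d w b + 27 * De \<Longrightarrow>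
      \<bar>flow c b w - r\<bar> \<le> B"
  shows "v \<in> tube u b (25 * De) \<Longrightarrow> h \<le> d v b + 27 * De \<Longrightarrow> \<bar>flow c b v - r\<bar> \<le> B"
proof (induction "d v b" arbitrary: v rule: less_induct)
  case less
  show ?case
  proof (cases "d v b \<le> h")
    case True then show ?thesis using near less.prems by blast
  next
    case False
    have v: "v \<in> V" using less.prems by (simp add: tube_def)
    have "\<bar>step v (flow c b) b - r\<bar> \<le> B"
    proof (rule mean_near[OF step_mean[OF v b]])
      fix z assume z: "z \<in> nxt v b"
      note zb = nxt_bounds[OF v b z]
      show "\<bar>flow c b z - r\<bar> \<le> B"
        by (rule less.hyps) (use zb De_pos nxt_tube[OF u b _ z] tube_mono[OF less.prems(1), of "26 * De"] False in auto)
    qed (use False h in \<open>simp add: L_def\<close>)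
    then show ?thesis using flow_far[OF c b v] False h by simp
  qed
qed

text \<open>\<open>236 = 182 + 2 * 27\<close> and \<open>1458 = 54 * 27\<close> bound the defect of
  \<open>mexp\<close> from \<open>s\<close> for two chains stopped just below \<open>h\<close>; the
  second summand covers all \<open>s\<close> up to \<open>300 * De\<close> by the trivial
  bound.\<close>

definition KS :: real where "KS = KM * exp (thM * (236 * real De + 1458 * real De * real De))
  + K0 * exp (thM * (300 * real De))"

lemma exp_shift:
  fixes th s a K r :: real
  assumes "0 \<le> th" "s \<le> a" "0 \<le> K" "r \<le> K"
  shows "r \<le> K * exp (th * a) * exp (- th * s)"
proof -
  have "th * s \<le> th * a" using assms by (intro mult_left_mono) auto
  then have "1 \<le> exp (th * a + - th * s)" by simp
  then have "K * 1 \<le> K * (exp (th * a) * exp (- th * s))"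
    unfolding exp_add using assms by (intro mult_left_mono) auto
  then show ?thesis using assms by (simp add: mult.assoc)
qed

text \<open>Both chains are stopped at a height \<open>h\<close> below the Gromov product of the
  sources based at \<open>b\<close>. There the tubes agree, so that \<open>flow_merge\<close>
  applies, and \<open>h\<close> is still about \<open>s / 2\<close> above the height of
  \<open>x\<close>.\<close>

theorem flow_source:
  assumes c: "local_cost c x" and a: "a \<in> V" and a': "a' \<in> V" and b: "b \<in> V"
    and s: "d a a' + s \<le> d a x + d a' x"
  shows "\<bar>flow c b a - flow c b a'\<bar> \<le> KS * exp (- thM * real s)"
proof -
  define D where "D = real De"
  have D: "1 \<le> D" using De_pos by (simp add: D_def)
  have x: "x \<in> V" using c by (rule local_costD)
  have KS: "0 \<le> KS" "K0 * exp (thM * (300 * D)) \<le> KS"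
    "KM * exp (thM * (236 * D + 1458 * D * D)) \<le> KS"
    using KM_pos K0_pos by (auto simp: KS_def D_def)
  have main: "\<bar>flow c b a - flow c b a'\<bar> \<le> KS * exp (- thM * real s)"
    if a: "a \<in> V" and a': "a' \<in> V" and s: "d a a' + s \<le> d a x + d a' x" and nz: "flow c b a \<noteq> 0" for a a'
  proof (cases "s \<le> 300 * De")
    case True
    have "\<bar>flow c b a - flow c b a'\<bar> \<le> K0 * exp (thM * (300 * D)) * exp (- thM * real s)"
      using flow_diff_le[OF c b a b a'] True thM_pos K0_pos D_def
      by (intro exp_shift) auto
    also have "\<dots> \<le> KS * exp (- thM * real s)" using KS by (intro mult_right_mono) auto
    finally show ?thesis .
  next
    case False
    \<comment> \<open>\<open>181 = 90 + 91\<close> adds the errors with which \<open>x\<close> lies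
      on geodesics from \<open>a\<close> and from \<open>a'\<close> to \<open>b\<close>; this is the
      largest height for which \<open>hh\<close> can be derived from them.\<close>
    define h where "h = d x b + (s - 181 * De) div 2"
    have h: "2 * h \<le> 2 * d x b + s - 181 * De" "2 * d x b + s \<le> 2 * h + 182 * De"
      "d x b + 32 * De \<le> h"
      using False De_pos by (auto simp: h_def)
    have sup: "d a x + d x b \<le> d a b + 90 * De" by (rule flow_support[OF c a b nz])
    have sup': "d a' x + d x b \<le> d a' b + 91 * De"
      using four_point[OF a a' b x] sup s False d_sym[OF b x] d_sym[OF a a'] d_sym[OF a' x] by linarith
    have hh: "d a a' + 2 * h \<le> d a b + d a' b" using sup sup' s h False by linarith
    then have hab: "h \<le> d a b" "h \<le> d a' b"
      using d_tri[OF a a' b] d_tri[OF a' a b] d_sym[OF a a'] by linarith+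
    have at: "a \<in> tube a b (25 * De)" "a' \<in> tube a' b (25 * De)" using a a' d_self by (auto simp: tube_def)
    have tube: "w \<in> tube a b (26 * De)" if "w \<in> tube a' b (25 * De)" "d w b \<le> h" for w
    proof -
      have w: "w \<in> V" "d a' w + d w b \<le> d a' b + 25 * De" using that by (auto simp: tube_def)
      have "d a w + d w b \<le> d a b + 26 * De"
        using four_point[OF a a' w(1) b] w hh that(2) d_sym[OF a a'] by linarith
      then show ?thesis using w by (simp add: tube_def)
    qed
    have "\<bar>flow c b a - flow c b a'\<bar> \<le> KS * exp (- thM * real s)"
    proof (rule flow_advance[OF c a b h(3) _ at(1)])
      fix v assume v: "v \<in> tube a b (25 * De)" "d v b \<le> h" "h \<le> d v b + 27 * De"
      have "\<bar>flow c b a' - flow c b v\<bar> \<le> KS * exp (- thM * real s)"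
      proof (rule flow_advance[OF c a' b h(3) _ at(2)])
        fix w assume w: "w \<in> tube a' b (25 * De)" "d w b \<le> h" "h \<le> d w b + 27 * De"
        have "\<bar>flow c b w - flow c b v\<bar> \<le> KM * exp (- thM * mexp x b w v)"
          by (rule flow_merge[OF c a b tube tube_mono[OF v(1)]]) (use w in auto)
        also have "\<dots> \<le> KM * exp (thM * (236 * D + 1458 * D * D)) * exp (- thM * real s)"
        proof -
          have "\<bar>real (d w b) - real (d v b)\<bar> \<le> 27 * D" unfolding D_def using v w by linarith
          then have "54 * D * \<bar>real (d w b) - real (d v b)\<bar> \<le> 54 * D * (27 * D)"
            using D by (intro mult_left_mono) auto
          moreover have "real (d v b) + real (d w b) - 2 * real (d x b) \<ge> real s - 236 * D"
            unfolding D_def using v w h by linarith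
          ultimately have "real s - (236 * D + 1458 * D * D) \<le> mexp x b w v"
            unfolding mexp_def D_def[symmetric] by linarith
          then have "thM * (real s - (236 * D + 1458 * D * D)) \<le> thM * mexp x b w v"
            using thM_pos by (intro mult_left_mono) auto
          then have "exp (- thM * mexp x b w v) \<le> exp (thM * (236 * D + 1458 * D * D) + - thM * real s)"
            by (simp add: right_diff_distrib)
          then show ?thesis unfolding exp_add mult.assoc using KM_pos by (intro mult_left_mono) auto
        qed
        also have "\<dots> \<le> KS * exp (- thM * real s)" using KS by (intro mult_right_mono) auto
        finally show "\<bar>flow c b w - flow c b v\<bar> \<le> KS * exp (- thM * real s)" .
      qed (use hab in auto)
      then show "\<bar>flow c b v - flow c b a'\<bar> \<le> KS * exp (- thM * real s)" by (simp add: abs_minus_commute)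
    qed (use hab in auto)
    then show ?thesis .
  qed
  show ?thesis
  proof (cases "flow c b a = 0")
    case False then show ?thesis by (intro main a a' s)
  next
    case True
    show ?thesis
    proof (cases "flow c b a' = 0")
      case True then show ?thesis using \<open>flow c b a = 0\<close> KS by simp
    next
      case False
      have "\<bar>flow c b a' - flow c b a\<bar> \<le> KS * exp (- thM * real s)"
        by (rule main) (use False s a a' d_sym[OF a a'] in auto)
      then show ?thesis by (simp add: abs_minus_commute)
    qed
  qed
qed


section \<open>Dependence on the target\<close>

lemma step_target:
  assumes v: "v \<in> V" and b: "b \<in> V" and b': "b' \<in> V" and far: "L \<le> d v b" "L \<le> d v b'"
    and s: "d b b' + s \<le> d v b + d v b'"
    and f: "\<And>z. z \<in> V \<Longrightarrow> d v z \<le> 27 * De \<Longrightarrow> \<bar>f z\<bar> \<le> K"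
  shows "\<bar>step v f b - step v f b'\<bar> \<le> 2 * K * exp (- thL * (real s - 64 * real De))"
proof -
  have "\<bar>avg (nball y R0) f\<bar> \<le> K" if y: "y \<in> V" "d v y = L" for y
  proof -
    have "\<bar>avg (nball y R0) f - 0\<bar> \<le> K"
    proof (rule mean_near[OF mean_ball[OF y(1)]])
      fix z assume z: "z \<in> nball y R0"
      then show "\<bar>f z - 0\<bar> \<le> K"
        using f[of z] d_tri[OF v y(1), of z] y(2) by (simp add: nball_def L_def R0_def)
    qed
    then show ?thesis by simp
  qed
  then show ?thesis
    using dir_target[OF v b b' far s, of "\<lambda>y. avg (nball y R0) f" K] by (simp add: step_def L_def)
qed

text \<open>The denominator sums the geometric series of one-step errors, which decay at rate
  \<open>thL\<close> in a height that drops by at least \<open>3 * De\<close> per step.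
  \<open>337 = 182 + 64 + 91\<close>: two deviations of \<open>x\<close> from geodesics, the loss in
  \<open>step_target\<close>, and the shift in \<open>t\<close>.\<close>

definition KT0 :: real where
  "KT0 = 2 * (27 * real De + K0) * exp (thL * (337 * real De)) / (exp (thL * (3 * real De)) - 1)"

definition KT :: real where
  "KT = KT0 * (exp (thL * (3 * real De)) + 1) + K0 * exp (thL * (300 * real De))"

text \<open>The step laws for the two targets differ at \<open>v\<close> by an amount decaying with
  the product of the targets seen from \<open>v\<close>, which grows with the distance of
  \<open>v\<close> from \<open>x\<close>. Along the chain towards \<open>x\<close> these errors form
  a geometric series.\<close>

theorem flow_target:
  assumes c: "local_cost c x" and b: "b \<in> V" and b': "b' \<in> V" and v: "v \<in> V"
    and s: "d b b' + s \<le> d b x + d b' x"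
  shows "\<bar>flow c b v - flow c b' v\<bar> \<le> KT * exp (- thL * real s)"
proof -
  define D where "D = real De"
  have D: "1 \<le> D" using De_pos by (simp add: D_def)
  have x: "x \<in> V" using c by (rule local_costD)
  \<comment> \<open>The accumulated error is bounded by \<open>K3 * (A - exp (- thL * t v))\<close>:
    the error of one step is absorbed by the change of the subtracted exponential when
    \<open>t\<close> drops by \<open>3 * D\<close>. This \<open>A\<close> keeps the bound
    nonnegative at next points where the flows agree.\<close>
  define A where "A = exp (thL * (3 * D)) + 1"
  define K3 where "K3 = KT0 * exp (- thL * real s)"
  define t where "t v = real (d v b') + 91 * D - real (d x b')" for v
  have e3: "1 < exp (thL * (3 * D))" using thL_pos D by simp
  have KT0: "0 < KT0" unfolding KT0_def D_def[symmetric] using e3 K0_pos D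
    by (intro divide_pos_pos mult_pos_pos) auto
  have "0 < KT"
    unfolding KT_def using KT0 K0_pos by (intro add_pos_pos mult_pos_pos exp_gt_zero zero_less_one)
  moreover have "K0 * exp (thL * (300 * D)) \<le> KT" "KT0 * A \<le> KT"
    using KT0 K0_pos e3 by (auto simp: KT_def D_def A_def)
  ultimately have KT: "0 < KT" "K0 * exp (thL * (300 * D)) \<le> KT" "KT0 * A \<le> KT" by auto
  have K3: "0 < K3" using KT0 by (simp add: K3_def)
  show ?thesis
  proof (cases "s \<le> 300 * De")
    case True
    have "\<bar>flow c b v - flow c b' v\<bar> \<le> K0 * exp (thL * (300 * D)) * exp (- thL * real s)"
      using flow_diff_le[OF c b v b' v] True thL_pos K0_pos D_def
      by (intro exp_shift) auto
    also have "\<dots> \<le> KT * exp (- thL * real s)" using KT by (intro mult_right_mono) auto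
    finally show ?thesis .
  next
    case False
    \<comment> \<open>The induction runs only over points where the flows differ. There one of them
      is nonzero, so \<open>x\<close> is nearly on a geodesic to that target, and by the large
      product of the targets also to the other.\<close>
    have geo: "d v x + d x b \<le> d v b + 91 * De" "d v x + d x b' \<le> d v b' + 91 * De"
      if v: "v \<in> V" and nz: "flow c b v \<noteq> flow c b' v" for v
    proof -
      consider "flow c b v \<noteq> 0" | "flow c b' v \<noteq> 0" using nz by fastforce
      then have "d v x + d x b \<le> d v b + 91 * De \<and> d v x + d x b' \<le> d v b' + 91 * De"
      proof cases
        case 1
        from flow_support[OF c v b 1] four_point[OF v x b b'] s False
          d_sym[OF b x] d_sym[OF b' x] show ?thesis by linarith
      next
        case 2
        from flow_support[OF c v b' 2] four_point[OF v x b' b] s False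
          d_sym[OF b x] d_sym[OF b' x] d_sym[OF b b'] show ?thesis by linarith
      qed
      then show "d v x + d x b \<le> d v b + 91 * De" "d v x + d x b' \<le> d v b' + 91 * De" by auto
    qed
    have "v \<in> V \<Longrightarrow> flow c b v \<noteq> flow c b' v \<Longrightarrow>
      \<bar>flow c b v - flow c b' v\<bar> \<le> K3 * (A - exp (- thL * t v))" for v
    proof (induction "d v b'" arbitrary: v rule: less_induct)
      case less
      note v = less.prems(1) and g = geo[OF less.prems]
      have xb: "s \<le> 2 * d x b" "s \<le> 2 * d x b'"
        using s d_tri[OF b b' x] d_tri[OF b' b x] d_sym[OF b x] d_sym[OF b' x] d_sym[OF b b'] by linarith+
      have far: "2 * L < d v b" "2 * L < d v b'" using g xb False by (auto simp: L_def)
      let ?f = "\<lambda>b z. c v z + flow c b z"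
      have 1: "\<bar>step v (?f b) b - step v (?f b) b'\<bar> \<le>
        2 * (27 * D + K0) * exp (- thL * (real (2 * d v x + s - 182 * De) - 64 * real De))"
      proof (rule step_target[OF v b b'])
        show "d b b' + (2 * d v x + s - 182 * De) \<le> d v b + d v b'"
          using g s False d_sym[OF b x] d_sym[OF b' x] by linarith
        fix z assume z: "z \<in> V" "d v z \<le> 27 * De"
        have "0 \<le> c v z" "c v z \<le> 27 * D"
          using local_costD(2,3)[OF c v z(1)] z(2) by (auto simp: D_def)
        then show "\<bar>c v z + flow c b z\<bar> \<le> 27 * D + K0"
          using flow_bound[OF c b z(1)] flow_nonneg[OF c b z(1)] by linarith
      qed (use far in auto)
      have e1: "exp (- thL * (real (2 * d v x + s - 182 * De) - 64 * real De)) \<le>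
        exp (thL * (337 * D)) * exp (- thL * real s) * exp (- thL * t v)"
      proof -
        have "t v \<le> real (d v x) + 91 * D"
          using d_tri[OF v x b'] by (simp add: t_def)
        moreover have "real (2 * d v x + s - 182 * De) = 2 * real (d v x) + real s - 182 * D"
          using False by (simp add: of_nat_diff D_def)
        ultimately have "real s + t v - 337 * D \<le> real (2 * d v x + s - 182 * De) - 64 * real De"
          unfolding D_def by linarith
        then have "thL * (real s + t v - 337 * D) \<le> thL * (real (2 * d v x + s - 182 * De) - 64 * real De)"
          using thL_pos by (intro mult_left_mono) auto
        then have "exp (- thL * (real (2 * d v x + s - 182 * De) - 64 * real De))
          \<le> exp (thL * (337 * D) + - thL * real s + - thL * t v)"
          by (simp add: algebra_simps)
        then show ?thesis by (simp only: exp_add)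
      qed
      have "\<bar>step v (?f b) b - step v (?f b) b'\<bar> \<le>
        2 * (27 * D + K0) * (exp (thL * (337 * D)) * exp (- thL * real s) * exp (- thL * t v))"
        by (rule order_trans[OF 1 mult_left_mono[OF e1]]) (use D K0_pos in auto)
      also have "\<dots> = KT0 * (exp (thL * (3 * D)) - 1) * exp (- thL * real s) * exp (- thL * t v)"
        using e3 thL_pos D by (simp add: KT0_def D_def[symmetric])
      also have "\<dots> = K3 * (exp (thL * (3 * D)) * exp (- thL * t v) - exp (- thL * t v))"
        by (simp add: K3_def algebra_simps)
      finally have 2: "\<bar>step v (?f b) b - step v (?f b) b'\<bar> \<le>
        K3 * (exp (thL * (3 * D)) * exp (- thL * t v) - exp (- thL * t v))" .
      have m: "mean_on (nxt v b') (\<lambda>f. step v f b')" using far by (intro step_mean v b') auto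
      have "step v (?f b) b' - step v (?f b') b' = step v (\<lambda>z. flow c b z - flow c b' z) b'"
        by (subst mean_diff[OF m, symmetric]) simp
      moreover have "\<bar>step v (\<lambda>z. flow c b z - flow c b' z) b' - 0\<bar> \<le>
        K3 * (A - exp (thL * (3 * D)) * exp (- thL * t v))"
      proof (rule mean_near[OF m])
        fix z assume z: "z \<in> nxt v b'"
        note zb = nxt_bounds[OF v b' z]
        show "\<bar>flow c b z - flow c b' z - 0\<bar> \<le> K3 * (A - exp (thL * (3 * D)) * exp (- thL * t v))"
        proof (cases "flow c b z = flow c b' z")
          case True
          have "real (d v x) + real (d x b') \<le> real (d v b') + 91 * D" using g(2) unfolding D_def by linarith
          then have "0 \<le> t v" by (simp add: t_def)
          then have "exp (- thL * t v) \<le> 1" using thL_pos by simp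
          then have "exp (thL * (3 * D)) * exp (- thL * t v) \<le> exp (thL * (3 * D)) * 1"
            by (intro mult_left_mono) auto
          then have "0 \<le> A - exp (thL * (3 * D)) * exp (- thL * t v)" unfolding A_def by linarith
          then show ?thesis using True K3 by simp
        next
          case False
          have IH: "\<bar>flow c b z - flow c b' z\<bar> \<le> K3 * (A - exp (- thL * t z))"
            using zb De_pos False by (intro less.hyps) auto
          have "t z \<le> t v - 3 * D" using zb(3) by (simp add: t_def D_def)
          then have "thL * t z \<le> thL * (t v - 3 * D)" using thL_pos by (intro mult_left_mono) auto
          then have "exp (thL * (3 * D) + - thL * t v) \<le> exp (- thL * t z)" by (simp add: right_diff_distrib)
          then have "K3 * (A - exp (- thL * t z)) \<le> K3 * (A - exp (thL * (3 * D)) * exp (- thL * t v))"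
            unfolding exp_add using K3 by (intro mult_left_mono) auto
          then show ?thesis using IH by simp
        qed
      qed
      moreover have "flow c b v = step v (?f b) b" "flow c b' v = step v (?f b') b'"
        using far by (auto intro!: flow_step v b b')
      ultimately show ?case using 2 unfolding right_diff_distrib by linarith
    qed
    then have D': "flow c b v \<noteq> flow c b' v \<Longrightarrow> \<bar>flow c b v - flow c b' v\<bar> \<le> K3 * (A - exp (- thL * t v))"
      using v by blast
    have "\<bar>flow c b v - flow c b' v\<bar> \<le> K3 * A"
    proof (cases "flow c b v = flow c b' v")
      case True
      have "0 < A" using e3 unfolding A_def by linarith
      then show ?thesis using True K3 by simp
    next
      case False
      have "K3 * (A - exp (- thL * t v)) \<le> K3 * A" using K3 by (intro mult_left_mono) auto
      then show ?thesis using D'[OF False] by linarith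
    qed
    also have "\<dots> \<le> KT * exp (- thL * real s)"
      using KT(3) by (simp add: K3_def mult_right_mono mult.commute mult.left_commute)
    finally show ?thesis .
  qed
qed

end


section \<open>Invariance under isometries\<close>

lemma avg_cong: "(\<And>s. s \<in> S \<Longrightarrow> f s = g s) \<Longrightarrow> avg S f = avg S g"
  by (simp add: avg_def cong: sum.cong)

context hyperbolic_space
begin

lemma mu_cong: "(\<And>y. y \<in> V \<Longrightarrow> f y = g y) \<Longrightarrow> x \<in> V \<Longrightarrow> mu v k f x = mu v k g x"
  by (induction k arbitrary: x) (auto intro!: avg_cong simp: Lev_def)

lemma step_cong: "(\<And>y. y \<in> V \<Longrightarrow> f y = g y) \<Longrightarrow> b \<in> V \<Longrightarrow> step v f b = step v g b"
  unfolding step_def dir_def by (intro mu_cong avg_cong) (auto simp: nball_def)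

context
  fixes \<phi> :: "'v \<Rightarrow> 'v"
  assumes bij: "bij_betw \<phi> V V" and iso: "\<And>v w. v \<in> V \<Longrightarrow> w \<in> V \<Longrightarrow> d (\<phi> v) (\<phi> w) = d v w"
begin

lemma isometry_in: "v \<in> V \<Longrightarrow> \<phi> v \<in> V"
  using bij by (auto simp: bij_betw_def)

lemma isometry_Collect: "(\<And>y. y \<in> V \<Longrightarrow> P (\<phi> y) \<longleftrightarrow> Q y) \<Longrightarrow> {y \<in> V. P y} = \<phi> ` {y \<in> V. Q y}"
proof (intro equalityI subsetI)
  fix x assume PQ: "\<And>y. y \<in> V \<Longrightarrow> P (\<phi> y) \<longleftrightarrow> Q y" and x: "x \<in> {y \<in> V. P y}"
  then obtain y where "y \<in> V" "x = \<phi> y" using bij by (auto simp: bij_betw_def)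
  then show "x \<in> \<phi> ` {y \<in> V. Q y}" using PQ x by blast
qed (use isometry_in in auto)

lemma isometry_inj: "S \<subseteq> V \<Longrightarrow> inj_on \<phi> S"
  using bij by (auto simp: bij_betw_def intro: inj_on_subset)

lemma mu_isometry: "v \<in> V \<Longrightarrow> x \<in> V \<Longrightarrow> mu (\<phi> v) k f (\<phi> x) = mu v k (\<lambda>y. f (\<phi> y)) x"
proof (induction k arbitrary: x)
  case (Suc k)
  have "Lev (\<phi> v) (Suc k) (\<phi> x) = \<phi> ` Lev v (Suc k) x"
    unfolding Lev_def by (rule isometry_Collect) (use Suc.prems iso in auto)
  moreover have "inj_on \<phi> (Lev v (Suc k) x)" by (rule isometry_inj) (auto simp: Lev_def)
  ultimately have "mu (\<phi> v) (Suc k) f (\<phi> x) = avg (Lev v (Suc k) x) (\<lambda>y. mu (\<phi> v) k f (\<phi> y))"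
    by (simp add: avg_image)
  also have "\<dots> = mu v (Suc k) (\<lambda>y. f (\<phi> y)) x"
    unfolding mu.simps by (rule avg_cong) (use Suc in \<open>auto simp: Lev_def\<close>)
  finally show ?case .
qed simp

lemma step_isometry:
  assumes "v \<in> V" "b \<in> V" shows "step (\<phi> v) f (\<phi> b) = step v (\<lambda>y. f (\<phi> y)) b"
proof -
  have "step (\<phi> v) f (\<phi> b) = mu v (d v b div L) (\<lambda>y. avg (nball (\<phi> y) R0) f) b"
    using assms iso by (simp add: step_def dir_def mu_isometry)
  also have "\<dots> = step v (\<lambda>y. f (\<phi> y)) b"
    unfolding step_def dir_def
  proof (rule mu_cong)
    fix y assume y: "y \<in> V"
    have "nball (\<phi> y) R0 = \<phi> ` nball y R0"
      unfolding nball_def by (rule isometry_Collect) (use y iso in auto)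
    moreover have "inj_on \<phi> (nball y R0)" by (rule isometry_inj) (auto simp: nball_def)
    ultimately show "avg (nball (\<phi> y) R0) f = avg (nball y R0) (\<lambda>y. f (\<phi> y))"
      by (simp add: avg_image)
  qed fact
  finally show ?thesis .
qed

text \<open>Two costs related by the isometry are allowed, because an automorphism moves the edge
  whose cost is counted.\<close>

lemma flow_isometry:
  assumes c: "\<And>v z. v \<in> V \<Longrightarrow> z \<in> V \<Longrightarrow> c' (\<phi> v) (\<phi> z) = c v z" and b: "b \<in> V"
  shows "v \<in> V \<Longrightarrow> flow c' (\<phi> b) (\<phi> v) = flow c b v"
proof (induction "d v b" arbitrary: v rule: less_induct)
  case less
  note v = less.prems
  show ?case
  proof (cases "d v b \<le> 2 * L")
    case True then show ?thesis using v b by (simp add: flow_near iso c)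
  next
    case False
    have "flow c' (\<phi> b) (\<phi> v) = step (\<phi> v) (\<lambda>z. c' (\<phi> v) z +
        (if d z (\<phi> b) < d (\<phi> v) (\<phi> b) then flow c' (\<phi> b) z else 0)) (\<phi> b)"
      using v b False by (subst flow.simps) (simp add: iso)
    also have "\<dots> = step v (\<lambda>z. c v z + (if d z b < d v b then flow c b z else 0)) b"
      unfolding step_isometry[OF v b] by (rule step_cong) (use v b c iso less.hyps in auto)
    also have "\<dots> = flow c b v" using False by (subst (2) flow.simps) simp
    finally show ?thesis .
  qed
qed

end

end


section \<open>Flows between vertices\<close>

text \<open>\<open>d\<close> remains a parameter; \<open>arc_dist\<close> and
  \<open>arc_towards\<close> are what random geodesics along arcs require of it.\<close>

locale hyperbolic_digraph = bidirected_digraph G arev + hyperbolic_space "verts G" d De NB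
  for G :: "('v, 'e) pre_digraph" and arev d De NB +
  fixes deg :: nat
  assumes d_eq: "v \<in> verts G \<Longrightarrow> w \<in> verts G \<Longrightarrow> d v w = 0 \<Longrightarrow> v = w"
    and arc_dist: "e \<in> arcs G \<Longrightarrow> d (tail G e) (head G e) \<le> 1"
    and arc_towards: "v \<in> verts G \<Longrightarrow> z \<in> verts G \<Longrightarrow> d v z = Suc k \<Longrightarrow> \<exists>e\<in>out_arcs G v. d (head G e) z = k"
    and out_finite: "v \<in> verts G \<Longrightarrow> finite (out_arcs G v)"
    and out_card: "v \<in> verts G \<Longrightarrow> card (out_arcs G v) \<le> deg"
begin

text \<open>Expected number of passages through \<open>e\<close> of a random geodesic of length
  \<open>k\<close> from \<open>v\<close> to \<open>z\<close>; passages through the reverse edge are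
  counted separately.\<close>

fun geod_flow :: "nat \<Rightarrow> 'v \<Rightarrow> 'v \<Rightarrow> 'e \<Rightarrow> real" where
  "geod_flow 0 v z e = 0"
| "geod_flow (Suc k) v z e = avg {f \<in> out_arcs G v. d (head G f) z = k}
     (\<lambda>f. of_bool (f = e) + geod_flow k (head G f) z e)"

definition cost :: "'e \<Rightarrow> 'v \<Rightarrow> 'v \<Rightarrow> real" where
  "cost e v z = geod_flow (d v z) v z e"

definition vflow :: "'v \<Rightarrow> 'v \<Rightarrow> 'e \<Rightarrow> real" where
  "vflow a b e = flow (cost e) b a"

lemma in_finite: "v \<in> verts G \<Longrightarrow> finite (in_arcs G v)"
  using out_finite by (simp add: in_arcs_eq)

lemma mean_first_arc:
  assumes "v \<in> verts G" "z \<in> verts G" "d v z = Suc k"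
  shows "mean_on {f \<in> out_arcs G v. d (head G f) z = k} (avg {f \<in> out_arcs G v. d (head G f) z = k})"
proof (rule mean_avg)
  show "finite {f \<in> out_arcs G v. d (head G f) z = k}"
    by (rule finite_subset[OF _ out_finite[OF assms(1)]]) auto
  show "{f \<in> out_arcs G v. d (head G f) z = k} \<noteq> {}" using arc_towards[OF assms] by blast
qed

lemma geod_flow_bounds:
  "v \<in> verts G \<Longrightarrow> z \<in> verts G \<Longrightarrow> d v z = k \<Longrightarrow> 0 \<le> geod_flow k v z e \<and> geod_flow k v z e \<le> real k"
proof (induction k arbitrary: v)
  case (Suc k)
  have "0 \<le> of_bool (f = e) + geod_flow k (head G f) z e \<and>
    of_bool (f = e) + geod_flow k (head G f) z e \<le> real (Suc k)"
    if "f \<in> {f \<in> out_arcs G v. d (head G f) z = k}" for f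
    using Suc.IH[of "head G f"] Suc.prems that by auto
  then show ?case
    using mean_le[OF mean_first_arc[OF Suc.prems]] mean_ge[OF mean_first_arc[OF Suc.prems]]
    by (auto simp del: of_nat_Suc)
qed simp

lemma geod_flow_support:
  assumes e: "e \<in> arcs G"
  shows "v \<in> verts G \<Longrightarrow> z \<in> verts G \<Longrightarrow> d v z = k \<Longrightarrow> geod_flow k v z e \<noteq> 0 \<Longrightarrow>
    d v (tail G e) + d (tail G e) z \<le> d v z"
proof (induction k arbitrary: v)
  case (Suc k)
  note m = mean_first_arc[OF Suc.prems(1-3)]
  let ?A = "{f \<in> out_arcs G v. d (head G f) z = k}"
  have "\<exists>f\<in>?A. of_bool (f = e) + geod_flow k (head G f) z e \<noteq> 0"
  proof (rule ccontr)
    assume "\<not> ?thesis"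
    then have "avg ?A (\<lambda>f. of_bool (f = e) + geod_flow k (head G f) z e) = avg ?A (\<lambda>_. 0)"
      by (intro avg_cong) blast
    then show False using mean_const[OF m, of 0] Suc.prems(4) by simp
  qed
  then obtain f where f: "f \<in> out_arcs G v" "d (head G f) z = k"
    "of_bool (f = e) + geod_flow k (head G f) z e \<noteq> (0::real)" by blast
  show ?case
  proof (cases "f = e")
    case True
    then show ?thesis using f Suc.prems d_self by auto
  next
    case False
    have h: "head G f \<in> verts G" "f \<in> arcs G" "tail G f = v" using f by auto
    have t: "tail G e \<in> verts G" using e by simp
    have "d (head G f) (tail G e) + d (tail G e) z \<le> d (head G f) z"
      by (rule Suc.IH) (use h f False Suc.prems in auto)
    then show ?thesis
      using d_tri[OF Suc.prems(1) h(1) t] arc_dist[OF h(2)] f h Suc.prems(3) by simp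
  qed
qed simp

lemma local_cost: "e \<in> arcs G \<Longrightarrow> local_cost (cost e) (tail G e)"
  unfolding local_cost_def cost_def using geod_flow_bounds geod_flow_support by auto

lemma edge_boundary_mean:
  assumes "mean_on S E"
  shows "edge_boundary G (\<lambda>e. E (F e)) y = E (\<lambda>s. edge_boundary G (\<lambda>e. F e s) y)"
  unfolding edge_boundary_def by (simp add: mean_diff[OF assms] mean_sum[OF assms])

lemma edge_boundary_add: "edge_boundary G (\<lambda>e. f e + g e) y = edge_boundary G f y + edge_boundary G g y"
  by (simp add: edge_boundary_def sum.distrib)

lemma edge_boundary_arc:
  assumes "y \<in> verts G" "f \<in> arcs G"
  shows "edge_boundary G (\<lambda>e. of_bool (f = e)) y = of_bool (y = head G f) - of_bool (y = tail G f)"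
  using assms in_finite out_finite by (auto simp: edge_boundary_def of_bool_def)

lemma geod_flow_boundary:
  assumes y: "y \<in> verts G"
  shows "v \<in> verts G \<Longrightarrow> z \<in> verts G \<Longrightarrow> d v z = k \<Longrightarrow>
    edge_boundary G (geod_flow k v z) y = of_bool (y = z) - of_bool (y = v)"
proof (induction k arbitrary: v)
  case 0
  then have "v = z" using d_eq by blast
  then show ?case by (simp add: edge_boundary_def)
next
  case (Suc k)
  note m = mean_first_arc[OF Suc.prems]
  have "edge_boundary G (geod_flow (Suc k) v z) y =
    avg {f \<in> out_arcs G v. d (head G f) z = k}
      (\<lambda>f. edge_boundary G (\<lambda>e. of_bool (f = e) + geod_flow k (head G f) z e) y)"
    unfolding geod_flow.simps by (rule edge_boundary_mean[OF m])
  also have "\<dots> = avg {f \<in> out_arcs G v. d (head G f) z = k} (\<lambda>_. of_bool (y = z) - of_bool (y = v))"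
    by (rule avg_cong) (use Suc y in \<open>auto simp: edge_boundary_add edge_boundary_arc\<close>)
  also have "\<dots> = of_bool (y = z) - of_bool (y = v)" by (rule mean_const[OF m])
  finally show ?case .
qed

text \<open>Each piece of the path is a unit flow from one point of the chain to the next, so the
  boundaries telescope before the mean is taken.\<close>

lemma vflow_boundary:
  assumes y: "y \<in> verts G" and b: "b \<in> verts G"
  shows "v \<in> verts G \<Longrightarrow> edge_boundary G (vflow v b) y = of_bool (y = b) - of_bool (y = v)"
proof (induction "d v b" arbitrary: v rule: less_induct)
  case less
  note v = less.prems
  show ?case
  proof (cases "d v b \<le> 2 * L")
    case True
    then have "vflow v b = geod_flow (d v b) v b" by (auto simp: vflow_def flow_near cost_def)
    then show ?thesis using geod_flow_boundary[OF y v b] by simp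
  next
    case False
    have m: "mean_on (nxt v b) (\<lambda>f. step v f b)" using False by (intro step_mean v b) auto
    have "vflow v b = (\<lambda>e. step v (\<lambda>z. cost e v z + vflow z b e) b)"
      using False v b by (auto simp: vflow_def fun_eq_iff intro!: flow_step)
    then have "edge_boundary G (vflow v b) y =
        step v (\<lambda>z. edge_boundary G (\<lambda>e. cost e v z + vflow z b e) y) b"
      by (simp add: edge_boundary_mean[OF m])
    also have "\<dots> = step v (\<lambda>_. of_bool (y = b) - of_bool (y = v)) b"
    proof (rule mean_cong[OF m])
      fix z assume z: "z \<in> nxt v b"
      note zb = nxt_bounds[OF v b z]
      have "edge_boundary G (vflow z b) y = of_bool (y = b) - of_bool (y = z)"
        using zb De_pos by (intro less.hyps) auto
      moreover have "edge_boundary G (\<lambda>e. cost e v z) y = of_bool (y = z) - of_bool (y = v)"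
        using geod_flow_boundary[OF y v zb(1)] by (simp add: cost_def)
      ultimately show "edge_boundary G (\<lambda>e. cost e v z + vflow z b e) y = of_bool (y = b) - of_bool (y = v)"
        by (simp add: edge_boundary_add)
    qed
    also have "\<dots> = of_bool (y = b) - of_bool (y = v)" by (rule mean_const[OF m])
    finally show ?thesis .
  qed
qed

lemma vflow_automorphism:
  assumes aut: "graph_automorphism G arev \<phi> \<psi>"
    and iso: "\<And>v w. v \<in> verts G \<Longrightarrow> w \<in> verts G \<Longrightarrow> d (\<phi> v) (\<phi> w) = d v w"
    and a: "a \<in> verts G" and b: "b \<in> verts G" and e: "e \<in> arcs G"
  shows "vflow (\<phi> a) (\<phi> b) (\<psi> e) = vflow a b e"
proof -
  have bij: "bij_betw \<phi> (verts G) (verts G)" "bij_betw \<psi> (arcs G) (arcs G)"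
    and ends: "\<And>e. e \<in> arcs G \<Longrightarrow> tail G (\<psi> e) = \<phi> (tail G e) \<and> head G (\<psi> e) = \<phi> (head G e)"
    using aut by (auto simp: graph_automorphism_def)
  have inj: "inj_on \<phi> (verts G)" "inj_on \<psi> (arcs G)" using bij by (auto simp: bij_betw_def)
  have sub: "\<psi> f \<in> arcs G" if "f \<in> arcs G" for f using bij that by (auto simp: bij_betw_def)
  have geod: "geod_flow k (\<phi> v) (\<phi> z) (\<psi> e) = geod_flow k v z e"
    if "v \<in> verts G" and z: "z \<in> verts G" for k v z
    using that(1)
  proof (induction k arbitrary: v)
    case (Suc k)
    let ?A = "{f \<in> out_arcs G v. d (head G f) z = k}"
    have eq: "{f \<in> out_arcs G (\<phi> v). d (head G f) (\<phi> z) = k} = \<psi> ` ?A"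
    proof (intro equalityI subsetI)
      fix f assume f: "f \<in> {f \<in> out_arcs G (\<phi> v). d (head G f) (\<phi> z) = k}"
      then obtain g where g: "g \<in> arcs G" "f = \<psi> g" using bij(2) by (auto simp: bij_betw_def)
      then have "tail G g = v" using f ends[OF g(1)] inj(1) Suc.prems by (auto dest: inj_onD)
      then show "f \<in> \<psi> ` ?A" using f g ends[OF g(1)] iso z by auto
    qed (use ends sub iso z in auto)
    have "geod_flow (Suc k) (\<phi> v) (\<phi> z) (\<psi> e) =
        avg ?A (\<lambda>f. of_bool (\<psi> f = \<psi> e) + geod_flow k (head G (\<psi> f)) (\<phi> z) (\<psi> e))"
      unfolding geod_flow.simps eq by (rule avg_image) (use inj in \<open>auto intro: inj_on_subset\<close>)
    also have "\<dots> = geod_flow (Suc k) v z e"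
      unfolding geod_flow.simps
      by (rule avg_cong) (use e inj ends Suc.IH in \<open>auto simp: inj_on_eq_iff\<close>)
    finally show ?case .
  qed simp
  show ?thesis
    unfolding vflow_def
    by (rule flow_isometry[OF bij(1) iso _ b a]) (use geod iso in \<open>auto simp: cost_def\<close>)
qed

end


section \<open>Bounded area for vertices\<close>

lemma sum_le_geometric:
  fixes f :: "'a \<Rightarrow> real" and g :: "'a \<Rightarrow> nat"
  assumes F: "finite F" and r: "0 < r" "r < 1" and K: "0 \<le> K"
    and f: "\<And>e. e \<in> F \<Longrightarrow> f e \<le> K * r ^ g e"
    and card: "\<And>n. card {e \<in> F. g e = n} \<le> C"
  shows "sum f F \<le> real C * K / (1 - r)"
proof -
  have "sum f F \<le> (\<Sum>e\<in>F. K * r ^ g e)" by (rule sum_mono) (rule f)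
  also have "\<dots> = (\<Sum>n\<in>g ` F. \<Sum>e | e \<in> F \<and> g e = n. K * r ^ g e)"
    by (rule sum.image_gen[OF F])
  also have "\<dots> = (\<Sum>n\<in>g ` F. real (card {e \<in> F. g e = n}) * (K * r ^ n))"
    by (intro sum.cong) auto
  also have "\<dots> \<le> (\<Sum>n\<in>g ` F. real C * (K * r ^ n))"
    using card K r by (intro sum_mono mult_right_mono) auto
  also have "\<dots> = real C * K * (\<Sum>n\<in>g ` F. r ^ n)" by (simp add: sum_distrib_left mult.assoc)
  also have "\<dots> \<le> real C * K * (\<Sum>n. r ^ n)"
    using F r K by (intro mult_left_mono sum_le_suminf summable_geometric) auto
  also have "(\<Sum>n. r ^ n) = 1 / (1 - r)" using r by (intro suminf_geometric) auto
  finally show ?thesis by simp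
qed

context hyperbolic_digraph
begin

text \<open>Twice the Gromov product, which is a natural number.\<close>

definition gp :: "'v \<Rightarrow> 'v \<Rightarrow> 'v \<Rightarrow> nat" where
  "gp x a b = d a x + d b x - d a b"

definition th :: real where "th = min thM thL"

definition KF :: real where "KF = KS + KT"

lemma th_pos: "0 < th"
  using thM_pos thL_pos by (simp add: th_def)

lemma KS_nonneg: "0 \<le> KS"
  using KM_pos K0_pos by (simp add: KS_def)

lemma KT_nonneg: "0 \<le> KT"
proof -
  have "1 \<le> exp (thL * (3 * real De))" using thL_pos by simp
  then show ?thesis using K0_pos by (auto simp: KT_def KT0_def intro!: add_nonneg_nonneg mult_nonneg_nonneg divide_nonneg_nonneg)
qed

lemma gp_sym: "x \<in> verts G \<Longrightarrow> a \<in> verts G \<Longrightarrow> b \<in> verts G \<Longrightarrow> gp x a b = gp x b a"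
  using d_sym[of a b] by (simp add: gp_def)

lemma gp_eq: "x \<in> verts G \<Longrightarrow> a \<in> verts G \<Longrightarrow> b \<in> verts G \<Longrightarrow> d a b + gp x a b = d a x + d b x"
  using d_tri[of a x b] d_sym[of b x] by (simp add: gp_def)

lemma gp_hyperbolic:
  assumes "x \<in> verts G" "a \<in> verts G" "b \<in> verts G" "c \<in> verts G"
  shows "gp x a b \<le> gp x a c + De \<or> gp x c b \<le> gp x a c + De"
  using four_point[of a x c b] gp_eq[of x a b] gp_eq[of x a c] gp_eq[of x c b]
    d_sym[of b x] d_sym[of c x] d_sym[of a x] d_sym[of c b] four_point[of a b c x] assms by auto

lemma vflow_source:
  assumes "e \<in> arcs G" "a \<in> verts G" "a' \<in> verts G" "b \<in> verts G"
  shows "\<bar>vflow a b e - vflow a' b e\<bar> \<le> KF * exp (- th * real (gp (tail G e) a a'))"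
proof -
  have "\<bar>vflow a b e - vflow a' b e\<bar> \<le> KS * exp (- thM * real (gp (tail G e) a a'))"
    unfolding vflow_def using assms gp_eq[of "tail G e" a a']
    by (intro flow_source[OF local_cost]) auto
  also have "\<dots> \<le> KF * exp (- th * real (gp (tail G e) a a'))"
    using KT_nonneg KS_nonneg by (intro mult_mono) (auto simp: KF_def th_def intro!: mult_right_mono)
  finally show ?thesis .
qed

lemma vflow_target:
  assumes "e \<in> arcs G" "a \<in> verts G" "b \<in> verts G" "b' \<in> verts G"
  shows "\<bar>vflow a b e - vflow a b' e\<bar> \<le> KF * exp (- th * real (gp (tail G e) b b'))"
proof -
  have "\<bar>vflow a b e - vflow a b' e\<bar> \<le> KT * exp (- thL * real (gp (tail G e) b b'))"
    unfolding vflow_def using assms gp_eq[of "tail G e" b b']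
    by (intro flow_target[OF local_cost]) auto
  also have "\<dots> \<le> KF * exp (- th * real (gp (tail G e) b b'))"
    using KT_nonneg KS_nonneg by (intro mult_mono) (auto simp: KF_def th_def intro!: mult_right_mono)
  finally show ?thesis .
qed

lemma vflow_support:
  assumes "e \<in> arcs G" "a \<in> verts G" "b \<in> verts G" "vflow a b e \<noteq> 0"
  shows "gp (tail G e) a b \<le> 90 * De"
  using flow_support[OF local_cost[OF assms(1)] assms(2,3)] assms gp_eq[of "tail G e" a b]
    d_sym[of b "tail G e"] by (simp add: vflow_def)

lemma vflow_bounds:
  assumes "e \<in> arcs G" "a \<in> verts G" "b \<in> verts G"
  shows "0 \<le> vflow a b e" "vflow a b e \<le> K0"
  using flow_nonneg[OF local_cost[OF assms(1)] assms(3,2)] flow_bound[OF local_cost[OF assms(1)] assms(3,2)]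
  by (auto simp: vflow_def)

definition qflow :: "'v \<Rightarrow> 'v \<Rightarrow> 'e \<Rightarrow> real" where
  "qflow a b e = (vflow a b e - vflow b a e) / 2"

lemma qflow_twice: "2 * qflow a b e = vflow a b e - vflow b a e"
  by (simp add: qflow_def)

lemma qflow_antisym: "qflow b a e = - qflow a b e"
  using qflow_twice[of a b e] qflow_twice[of b a e] by linarith

lemma qflow_support:
  assumes "e \<in> arcs G" "a \<in> verts G" "b \<in> verts G" "qflow a b e \<noteq> 0"
  shows "gp (tail G e) a b \<le> 90 * De"
proof -
  have "vflow a b e \<noteq> 0 \<or> vflow b a e \<noteq> 0" using assms(4) by (auto simp: qflow_def)
  moreover have "gp (tail G e) b a = gp (tail G e) a b" using assms by (intro gp_sym) auto
  ultimately show ?thesis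
    using vflow_support[OF assms(1-3)] vflow_support[OF assms(1,3,2)] by metis
qed

lemma qflow_bound:
  assumes "e \<in> arcs G" "a \<in> verts G" "b \<in> verts G"
  shows "\<bar>qflow a b e\<bar> \<le> K0"
  using vflow_bounds[OF assms] vflow_bounds[OF assms(1,3,2)] qflow_twice[of a b e] by linarith

lemma qflow_near:
  assumes "e \<in> arcs G" "a \<in> verts G" "b \<in> verts G" "a' \<in> verts G" "b' \<in> verts G"
  shows "\<bar>qflow a b e - qflow a' b' e\<bar> \<le>
    KF * exp (- th * real (gp (tail G e) a a')) + KF * exp (- th * real (gp (tail G e) b b'))"
  using vflow_source[OF assms(1,2,4,3)] vflow_target[OF assms(1,4,3,5)]
    vflow_source[OF assms(1,3,5,2)] vflow_target[OF assms(1,5,2,4)]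
    qflow_twice[of a b e] qflow_twice[of a' b' e] by linarith

lemma qflow_boundary:
  assumes "y \<in> verts G" "a \<in> verts G" "b \<in> verts G"
  shows "edge_boundary G (qflow a b) y = of_bool (y = b) - of_bool (y = a)"
proof -
  have "edge_boundary G (qflow a b) y = (edge_boundary G (vflow a b) y - edge_boundary G (vflow b a) y) / 2"
    by (simp add: edge_boundary_def qflow_def sum_subtractf sum_divide_distrib diff_divide_distrib)
  then show ?thesis using vflow_boundary[OF assms(1)] assms by simp
qed

definition KA :: real where "KA = KF + 3 * K0 * exp (th * (90 * real De))"

text \<open>Away from the side \<open>b c\<close> the area is the difference of the flows between \<open>a\<close> and \<open>b\<close> and
  the flows between \<open>a\<close> and \<open>c\<close>.\<close>

lemma area_decay:
  assumes e: "e \<in> arcs G" and a: "a \<in> verts G" and b: "b \<in> verts G" and c: "c \<in> verts G"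
  shows "\<bar>qflow a b e + qflow b c e + qflow c a e\<bar> \<le> KA * exp (- th) ^ gp (tail G e) b c"
proof -
  let ?E = "exp (- th * real (gp (tail G e) b c))"
  have E: "exp (- th) ^ gp (tail G e) b c = ?E"
    by (simp add: exp_of_nat_mult[symmetric] mult.commute)
  have KA: "KF \<le> KA" "3 * K0 * exp (th * (90 * real De)) \<le> KA"
    using K0_pos KT_nonneg KS_nonneg by (auto simp: KA_def KF_def)
  show ?thesis
  proof (cases "gp (tail G e) b c \<le> 90 * De")
    case True
    have "\<bar>qflow a b e + qflow b c e + qflow c a e\<bar> \<le> 3 * K0"
      using qflow_bound[OF e a b] qflow_bound[OF e b c] qflow_bound[OF e c a] by linarith
    then have "\<bar>qflow a b e + qflow b c e + qflow c a e\<bar> \<le> 3 * K0 * exp (th * (90 * real De)) * ?E"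
      using True th_pos K0_pos by (intro exp_shift) auto
    also have "\<dots> \<le> KA * ?E" using KA by (intro mult_right_mono) auto
    finally show ?thesis unfolding E .
  next
    case False
    then have "qflow b c e = 0" using qflow_support[OF e b c] by blast
    moreover have "\<bar>vflow a b e - vflow a c e\<bar> \<le> KF * ?E" by (rule vflow_target[OF e a b c])
    moreover have "\<bar>vflow b a e - vflow c a e\<bar> \<le> KF * ?E" by (rule vflow_source[OF e b c a])
    ultimately have "\<bar>qflow a b e + qflow b c e + qflow c a e\<bar> \<le> KF * ?E"
      using qflow_twice[of a b e] qflow_twice[of c a e] by linarith
    also have "\<dots> \<le> KA * ?E" using KA by (intro mult_right_mono) auto
    finally show ?thesis unfolding E .
  qed
qed

text \<open>Up to a constant of the triangle, \<open>2 * d a x\<close> equals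
  \<open>gp x a b + gp x a c - gp x b c\<close>. Points of one level are therefore at nearly the
  same distance from \<open>a\<close>, and being close to the side \<open>a b\<close> they are
  within \<open>91 + 91 + 1\<close> times \<open>De\<close> of each other.\<close>

lemma leg_card:
  assumes a: "a \<in> verts G" and b: "b \<in> verts G" and c: "c \<in> verts G" and F: "finite F" "F \<subseteq> arcs G"
    and leg: "\<And>e. e \<in> F \<Longrightarrow> gp (tail G e) a b \<le> 91 * De \<and> gp (tail G e) a c \<le> 91 * De"
  shows "card {e \<in> F. gp (tail G e) b c = n} \<le> NB (183 * De) * deg"
proof (cases "{e \<in> F. gp (tail G e) b c = n} = {}")
  case True then show ?thesis by (simp only: card.empty zero_le)
next
  case False
  then obtain f where f: "f \<in> F" "gp (tail G f) b c = n" by blast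
  let ?x = "tail G f"
  have x: "?x \<in> verts G" using f F by auto
  have "{e \<in> F. gp (tail G e) b c = n} \<subseteq> (\<Union>y\<in>{y \<in> verts G. d ?x y \<le> 183 * De}. out_arcs G y)"
  proof
    fix e assume e: "e \<in> {e \<in> F. gp (tail G e) b c = n}"
    let ?y = "tail G e"
    have y: "?y \<in> verts G" using e F by auto
    have 1: "2 * d a ?x \<le> 2 * d a ?y + 182 * De" "2 * d a ?y \<le> 2 * d a ?x + 182 * De"
      using gp_eq[OF x a b] gp_eq[OF x a c] gp_eq[OF x b c] gp_eq[OF y a b] gp_eq[OF y a c] gp_eq[OF y b c]
        leg[of e] leg[of f] e f by auto
    have "d ?x ?y \<le> 183 * De"
      using four_point[OF x a y b] gp_eq[OF x a b] gp_eq[OF y a b] leg[of e] leg[of f] e f 1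
        d_sym[OF x a] d_sym[OF x b] d_sym[OF y b] by auto
    then show "e \<in> (\<Union>y\<in>{y \<in> verts G. d ?x y \<le> 183 * De}. out_arcs G y)"
      using y e F by auto
  qed
  then have "card {e \<in> F. gp (tail G e) b c = n} \<le> card (\<Union>y\<in>{y \<in> verts G. d ?x y \<le> 183 * De}. out_arcs G y)"
    using ball_finite[OF x] out_finite by (intro card_mono finite_UN_I) auto
  also have "\<dots> \<le> (\<Sum>y\<in>{y \<in> verts G. d ?x y \<le> 183 * De}. card (out_arcs G y))"
    using ball_finite[OF x] by (rule card_UN_le)
  also have "\<dots> \<le> (\<Sum>y\<in>{y \<in> verts G. d ?x y \<le> 183 * De}. deg)"
    by (rule sum_mono) (use out_card in auto)
  also have "\<dots> \<le> NB (183 * De) * deg" using ball_card[OF x] by simp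
  finally show ?thesis .
qed

definition KAREA :: real where
  "KAREA = 3 * (real (NB (183 * De) * deg) * KA / (1 - exp (- th)))"

text \<open>An edge that carries one of the flows is near one side and, by hyperbolicity, near a
  second one (\<open>91 = 90 + 1\<close>), so three legs, one per corner, cover the area. On the leg
  at \<open>a\<close> the area decays exponentially in \<open>gp x b c\<close> and each level has
  boundedly many edges.\<close>

lemma area_bound:
  assumes a: "a \<in> verts G" and b: "b \<in> verts G" and c: "c \<in> verts G" and F: "finite F" "F \<subseteq> arcs G"
  shows "(\<Sum>e\<in>F. \<bar>qflow a b e + qflow b c e + qflow c a e\<bar>) \<le> KAREA"
proof -
  let ?A = "\<lambda>e. \<bar>qflow a b e + qflow b c e + qflow c a e\<bar>"
  let ?T = "\<lambda>a b c. {e \<in> F. gp (tail G e) a b \<le> 91 * De \<and> gp (tail G e) a c \<le> 91 * De}"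
  let ?B = "real (NB (183 * De) * deg) * KA / (1 - exp (- th))"
  have KA: "0 \<le> KA" using K0_pos KT_nonneg KS_nonneg by (simp add: KA_def KF_def)
  have leg: "sum ?A (?T a b c) \<le> ?B" if a: "a \<in> verts G" and b: "b \<in> verts G" and c: "c \<in> verts G"
    and A: "\<And>e. e \<in> F \<Longrightarrow> ?A e = \<bar>qflow a b e + qflow b c e + qflow c a e\<bar>" for a b c
  proof (rule sum_le_geometric[where g = "\<lambda>e. gp (tail G e) b c"])
    show "?A e \<le> KA * exp (- th) ^ gp (tail G e) b c" if "e \<in> ?T a b c" for e
      using area_decay[OF _ a b c, of e] A[of e] that F by auto
    show "card {e \<in> ?T a b c. gp (tail G e) b c = n} \<le> NB (183 * De) * deg" for n
      by (rule leg_card[OF a b c]) (use F in auto)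
  qed (use F th_pos KA in auto)
  have "sum ?A F \<le> sum ?A (?T a b c) + sum ?A (?T b c a) + sum ?A (?T c a b)"
  proof -
    have cover: "e \<in> ?T a b c \<union> ?T b c a \<union> ?T c a b" if e: "e \<in> F" "?A e \<noteq> 0" for e
    proof -
      have eG: "e \<in> arcs G" and x: "tail G e \<in> verts G" using e F by auto
      consider "qflow a b e \<noteq> 0" | "qflow b c e \<noteq> 0" | "qflow c a e \<noteq> 0" using e(2) by fastforce
      then show ?thesis
      proof cases
        case 1
        show ?thesis
          using qflow_support[OF eG a b 1] gp_hyperbolic[OF x a c b] gp_sym[OF x a b] gp_sym[OF x a c]
            gp_sym[OF x b c] e(1) by auto
      next
        case 2
        show ?thesis
          using qflow_support[OF eG b c 2] gp_hyperbolic[OF x b a c] gp_sym[OF x a b] gp_sym[OF x a c]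
            gp_sym[OF x b c] e(1) by auto
      next
        case 3
        show ?thesis
          using qflow_support[OF eG c a 3] gp_hyperbolic[OF x c b a] gp_sym[OF x a b] gp_sym[OF x a c]
            gp_sym[OF x b c] e(1) by auto
      qed
    qed
    have "sum ?A F = sum ?A {e \<in> F. ?A e \<noteq> 0}"
      using F by (intro sum.mono_neutral_right) auto
    also have "\<dots> \<le> sum ?A (?T a b c \<union> ?T b c a \<union> ?T c a b)"
      using F cover by (intro sum_mono2) auto
    also have "\<dots> \<le> sum ?A (?T a b c \<union> ?T b c a) + sum ?A (?T c a b)"
      using F by (subst sum.union_inter[symmetric]) (auto intro!: sum_nonneg)
    also have "sum ?A (?T a b c \<union> ?T b c a) \<le> sum ?A (?T a b c) + sum ?A (?T b c a)"
      using F by (subst sum.union_inter[symmetric]) (auto intro!: sum_nonneg)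
    finally show ?thesis by simp
  qed
  also have "\<dots> \<le> ?B + ?B + ?B"
    by (intro add_mono leg a b c) (auto simp: add_ac)
  also have "\<dots> = KAREA" by (simp add: KAREA_def)
  finally show ?thesis .
qed

end


section \<open>The path metric of the realization\<close>

definition gdist :: "('v, 'e) pre_digraph \<Rightarrow> 'v \<Rightarrow> 'v \<Rightarrow> nat" where
  "gdist G v w = (LEAST n. (v, w) \<in> arcs_ends G ^^ n)"

lemma relpow_sym: "sym R \<Longrightarrow> sym (R ^^ n)"
proof (induction n)
  case (Suc n)
  have "(y, x) \<in> R ^^ Suc n" if xy: "(x, y) \<in> R ^^ Suc n" for x y
  proof -
    obtain z where "(x, z) \<in> R ^^ n" "(z, y) \<in> R" using relpow_Suc_E[OF xy] by blast
    then show ?thesis using Suc by (intro relpow_Suc_I2[of y z]) (auto dest: symD)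
  qed
  then show ?case by (rule symI)
qed (auto intro: symI)

lemma pl_path_append: "pl_path G arev x p y \<Longrightarrow> pl_path G arev y q z \<Longrightarrow> pl_path G arev x (p @ q) z"
  by (induction p arbitrary: x) auto

lemma pl_length_append [simp]: "pl_length (p @ q) = pl_length p + pl_length q"
  by (simp add: pl_length_def)

lemma pl_length_Nil [simp]: "pl_length [] = 0"
  by (simp add: pl_length_def)

lemma pl_length_Cons [simp]: "pl_length ((e, s, t) # p) = \<bar>s - t\<bar> + pl_length p"
  by (simp add: pl_length_def)

lemma pl_length_nonneg: "0 \<le> pl_length p"
  by (induction p) auto

lemma pl_path_rev:
  "pl_path G arev x p y \<Longrightarrow> \<exists>q. pl_path G arev y q x \<and> pl_length q = pl_length p"
proof (induction p arbitrary: x)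
  case Nil then show ?case by (intro exI[of _ "[]"]) auto
next
  case (Cons a p)
  obtain e s t where a: "a = (e, s, t)" by (cases a)
  obtain q where q: "pl_path G arev y q (edge_point G arev e t)" "pl_length q = pl_length p"
    using Cons a by auto
  have "pl_path G arev (edge_point G arev e t) [(e, t, s)] x" using Cons.prems a by auto
  then show ?case
    using pl_path_append[OF q(1)] q(2) a by (intro exI[of _ "q @ [(e, t, s)]"]) auto
qed

text \<open>Meaningful only if \<open>f\<close> agrees on the two representatives of each interior point of an edge.\<close>

definition lift :: "('v + 'e \<times> real \<Rightarrow> real) \<Rightarrow> ('v, 'e) point \<Rightarrow> real" where
  "lift f x = f (SOME r. r \<in> x)"

lemma lift_vertex [simp]: "lift f {Inl v} = f (Inl v)"
  by (simp add: lift_def)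

lemma lift_pair: "f r = f r' \<Longrightarrow> lift f {r, r'} = f r"
  unfolding lift_def using someI[of "\<lambda>q. q \<in> {r, r'}" r] by auto

text \<open>Gives lower bounds for the path metric, an infimum over all paths, from a suitable test
  function.\<close>

lemma pl_path_lipschitz:
  assumes "\<And>e s t. e \<in> arcs G \<Longrightarrow> s \<in> {0..1} \<Longrightarrow> t \<in> {0..1} \<Longrightarrow>
    \<bar>f (edge_point G arev e s) - f (edge_point G arev e t)\<bar> \<le> \<bar>s - t\<bar>"
  shows "pl_path G arev x p y \<Longrightarrow> \<bar>f x - f y\<bar> \<le> pl_length p"
proof (induction p arbitrary: x)
  case (Cons a p)
  obtain e s t where a: "a = (e, s, t)" by (cases a)
  have "\<bar>f (edge_point G arev e s) - f (edge_point G arev e t)\<bar> \<le> \<bar>s - t\<bar>"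
    using Cons.prems a by (intro assms) auto
  moreover have "\<bar>f (edge_point G arev e t) - f y\<bar> \<le> pl_length p"
    using Cons.prems a by (intro Cons.IH) auto
  ultimately show ?case using Cons.prems a by auto
qed auto

section \<open>Combinatorial distance of a connected graph\<close>

locale connected_digraph = bidirected_digraph G arev for G :: "('v, 'e) pre_digraph" and arev +
  assumes conn: "Digraph_Component.connected G"
begin

abbreviation "dst \<equiv> gdist G"
abbreviation "M \<equiv> realization G arev"
abbreviation "pd \<equiv> path_metric G arev"
abbreviation "ept \<equiv> edge_point G arev"
abbreviation (input) "vpt v \<equiv> {Inl v}"

lemma arcs_ends_sym: "sym (arcs_ends G)"
  using sym_arcs by (simp add: symmetric_def)

lemma dst_relpow:
  assumes "v \<in> verts G" "w \<in> verts G"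
  shows "(v, w) \<in> arcs_ends G ^^ dst v w"
proof -
  have "v \<rightarrow>\<^sup>*\<^bsub>with_proj (mk_symmetric G)\<^esub> w"
    using conn assms unfolding Digraph_Component.connected_def strongly_connected_def
    by (auto simp: mk_symmetric_def)
  then have "v \<rightarrow>\<^sup>*\<^bsub>G\<^esub> w" using reachable_mk_symmetric_eq[OF sym_arcs] by simp
  then have "(v, w) \<in> (arcs_ends G)\<^sup>*" by (rule reachable_rtranclI)
  then obtain n where "(v, w) \<in> arcs_ends G ^^ n" by (auto simp: rtrancl_power)
  then show ?thesis unfolding gdist_def by (rule LeastI)
qed

lemma dst_le: "(v, w) \<in> arcs_ends G ^^ n \<Longrightarrow> dst v w \<le> n"
  unfolding gdist_def by (rule Least_le)

lemma relpow_verts: "(v, w) \<in> arcs_ends G ^^ n \<Longrightarrow> v \<in> verts G \<Longrightarrow> w \<in> verts G"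
  by (cases n) (auto simp: arcs_ends_conv)

lemma dst_self: "dst v v = 0"
  using dst_le[of v v 0] by simp

lemma dst_eq: "v \<in> verts G \<Longrightarrow> w \<in> verts G \<Longrightarrow> dst v w = 0 \<Longrightarrow> v = w"
  using dst_relpow[of v w] by simp

lemma dst_sym: "v \<in> verts G \<Longrightarrow> w \<in> verts G \<Longrightarrow> dst v w = dst w v"
  using dst_relpow[of v w] dst_relpow[of w v] relpow_sym[OF arcs_ends_sym]
  by (intro antisym dst_le) (auto dest: symD)

lemma dst_tri: "u \<in> verts G \<Longrightarrow> v \<in> verts G \<Longrightarrow> w \<in> verts G \<Longrightarrow> dst u w \<le> dst u v + dst v w"
  using dst_relpow[of u v] dst_relpow[of v w] by (intro dst_le) (auto simp: relpow_add)

lemma dst_geodesic: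
  assumes v: "v \<in> verts G" and w: "w \<in> verts G" and k: "k \<le> dst v w"
  shows "\<exists>z\<in>verts G. dst v z = k \<and> dst z w = dst v w - k"
proof -
  have "(v, w) \<in> arcs_ends G ^^ (k + (dst v w - k))" using dst_relpow[OF v w] k by simp
  then obtain z where z: "(v, z) \<in> arcs_ends G ^^ k" "(z, w) \<in> arcs_ends G ^^ (dst v w - k)"
    unfolding relpow_add by auto
  have "z \<in> verts G" using relpow_verts[OF z(1) v] .
  then show ?thesis
    using dst_le[OF z(1)] dst_le[OF z(2)] dst_tri[OF v _ w, of z] k by (intro bexI[of _ z]) auto
qed

lemma dst_arc: "e \<in> arcs G \<Longrightarrow> dst (tail G e) (head G e) \<le> 1"
  by (rule dst_le) (auto simp: arcs_ends_conv)

lemma dst_towards: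
  assumes "v \<in> verts G" "z \<in> verts G" "dst v z = Suc k"
  shows "\<exists>e\<in>out_arcs G v. dst (head G e) z = k"
proof -
  obtain w where w: "w \<in> verts G" "dst v w = 1" "dst w z = k"
    using dst_geodesic[OF assms(1,2), of 1] assms(3) by auto
  have "(v, w) \<in> arcs_ends G" using dst_relpow[OF assms(1) w(1)] w(2) by simp
  then show ?thesis using w by (auto simp: arcs_ends_conv)
qed

lemma dst_ball:
  assumes v: "v \<in> verts G" and out: "\<And>w. w \<in> verts G \<Longrightarrow> finite (out_arcs G w) \<and> card (out_arcs G w) \<le> N"
  shows "finite {w \<in> verts G. dst v w \<le> r} \<and> card {w \<in> verts G. dst v w \<le> r} \<le> (N + 1) ^ r"
proof (induction r)
  case 0
  have "{w \<in> verts G. dst v w \<le> 0} = {v}" using v dst_eq dst_self by auto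
  then show ?case by simp
next
  case (Suc r)
  let ?B = "{w \<in> verts G. dst v w \<le> r}" and ?I = "\<lambda>w. insert w (head G ` out_arcs G w)"
  have sub: "{w \<in> verts G. dst v w \<le> Suc r} \<subseteq> (\<Union>w\<in>?B. ?I w)"
  proof
    fix w assume w: "w \<in> {w \<in> verts G. dst v w \<le> Suc r}"
    show "w \<in> (\<Union>w\<in>?B. ?I w)"
    proof (cases "dst v w \<le> r")
      case False
      then have "dst v w = Suc r" using w by auto
      then have "(v, w) \<in> arcs_ends G ^^ Suc r" using dst_relpow[OF v, of w] w by simp
      then obtain u where u: "(v, u) \<in> arcs_ends G ^^ r" "(u, w) \<in> arcs_ends G" by (rule relpow_Suc_E)
      have "u \<in> ?B" using relpow_verts[OF u(1) v] dst_le[OF u(1)] by simp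
      moreover have "w \<in> ?I u" using u(2) by (auto simp: arcs_ends_conv)
      ultimately show ?thesis by blast
    qed (use w in auto)
  qed
  have fin: "finite (\<Union>w\<in>?B. ?I w)" using Suc out by auto
  have "card {w \<in> verts G. dst v w \<le> Suc r} \<le> card (\<Union>w\<in>?B. ?I w)" by (rule card_mono[OF fin sub])
  also have "\<dots> \<le> (\<Sum>w\<in>?B. card (?I w))" using Suc by (intro card_UN_le) auto
  also have "\<dots> \<le> (\<Sum>w\<in>?B. N + 1)"
  proof (rule sum_mono)
    fix w assume w: "w \<in> ?B"
    have "card (?I w) \<le> Suc (card (head G ` out_arcs G w))" by (rule card_insert_le_m1) auto
    also have "card (head G ` out_arcs G w) \<le> card (out_arcs G w)" using out w by (intro card_image_le) auto
    also have "card (out_arcs G w) \<le> N" using out w by auto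
    finally show "card (?I w) \<le> N + 1" by simp
  qed
  also have "\<dots> = card ?B * (N + 1)" by simp
  also have "\<dots> \<le> (N + 1) ^ r * (N + 1)" using Suc by (intro mult_right_mono) auto
  finally show ?case using finite_subset[OF sub fin] by (simp add: mult.commute)
qed

lemma dst_automorphism:
  assumes "graph_automorphism G arev \<phi> \<psi>" "v \<in> verts G" "w \<in> verts G"
  shows "dst (\<phi> v) (\<phi> w) = dst v w"
proof (rule antisym)
  have bij: "bij_betw \<phi> (verts G) (verts G)" "bij_betw \<psi> (arcs G) (arcs G)"
    and ends: "\<And>e. e \<in> arcs G \<Longrightarrow> tail G (\<psi> e) = \<phi> (tail G e) \<and> head G (\<psi> e) = \<phi> (head G e)"
    using assms(1) by (auto simp: graph_automorphism_def)
  have "(\<phi> v, \<phi> w) \<in> arcs_ends G ^^ n" if "(v, w) \<in> arcs_ends G ^^ n" for n v w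
    using that
  proof (induction n arbitrary: w)
    case (Suc n)
    then obtain u where u: "(v, u) \<in> arcs_ends G ^^ n" "(u, w) \<in> arcs_ends G" by auto
    then obtain e where e: "e \<in> arcs G" "u = tail G e" "w = head G e" by (auto simp: arcs_ends_conv)
    have "\<psi> e \<in> arcs G" using bij(2) e by (auto simp: bij_betw_def)
    then have "(\<phi> u, \<phi> w) \<in> arcs_ends G"
      using ends[OF e(1)] e unfolding arcs_ends_conv by force
    then show ?case using Suc.IH[OF u(1)] by auto
  qed simp
  then show "dst (\<phi> v) (\<phi> w) \<le> dst v w" using dst_relpow assms by (intro dst_le) blast
  have "(v, w) \<in> arcs_ends G ^^ n"
    if "(\<phi> v, \<phi> w) \<in> arcs_ends G ^^ n" "v \<in> verts G" "w \<in> verts G" for n v w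
    using that
  proof (induction n arbitrary: w)
    case 0
    then show ?case using bij(1) by (auto simp: bij_betw_def dest: inj_onD)
  next
    case (Suc n)
    then obtain u where u: "(\<phi> v, u) \<in> arcs_ends G ^^ n" "(u, \<phi> w) \<in> arcs_ends G" by auto
    then obtain f where f: "f \<in> arcs G" "u = tail G f" "\<phi> w = head G f" by (auto simp: arcs_ends_conv)
    then obtain e where e: "e \<in> arcs G" "f = \<psi> e" using bij(2) by (auto simp: bij_betw_def)
    have "\<phi> (head G e) = \<phi> w" using f ends[OF e(1)] e by simp
    then have "head G e = w"
      using bij(1) head_in_verts[OF e(1)] Suc.prems(3) unfolding bij_betw_def by (blast dest: inj_onD)
    moreover have "(v, tail G e) \<in> arcs_ends G ^^ n"
      using Suc u f ends[OF e(1)] e by (intro Suc.IH) auto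
    ultimately show ?case using e by (auto simp: arcs_ends_conv)
  qed
  moreover have "\<phi> v \<in> verts G" "\<phi> w \<in> verts G" using bij(1) assms by (auto simp: bij_betw_def)
  ultimately show "dst v w \<le> dst (\<phi> v) (\<phi> w)" using dst_relpow assms by (intro dst_le) blast
qed

lemma ept_0: "ept e 0 = vpt (tail G e)" and ept_1: "ept e 1 = vpt (head G e)"
  by (auto simp: edge_point_def)

lemma vpt_in: "v \<in> verts G \<Longrightarrow> vpt v \<in> M"
  by (simp add: realization_def)

lemma ept_in: "e \<in> arcs G \<Longrightarrow> s \<in> {0..1} \<Longrightarrow> ept e s \<in> M"
  unfolding realization_def edge_segment_def by blast

lemma realization_cases:
  assumes "x \<in> M"
  obtains v where "v \<in> verts G" "x = vpt v" | e t where "e \<in> arcs G" "0 < t" "t < 1" "x = ept e t"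
proof -
  from assms consider v where "v \<in> verts G" "x = vpt v"
    | e t where "e \<in> arcs G" "t \<in> {0..1}" "x = ept e t"
    by (auto simp: realization_def edge_segment_def)
  then show thesis
  proof cases
    case 2
    then consider "t = 0" | "t = 1" | "0 < t" "t < 1" by fastforce
    then show thesis
    proof cases
      case 1 then show thesis using 2 that(1)[of "tail G e"] by (simp add: ept_0)
    next
      case 2 then show thesis using \<open>e \<in> arcs G\<close> \<open>x = ept e t\<close> that(1)[of "head G e"] by (simp add: ept_1)
    qed (use 2 that(2) in blast)
  qed (rule that(1))
qed

lemma relpow_pl_path: "(v, w) \<in> arcs_ends G ^^ n \<Longrightarrow> \<exists>p. pl_path G arev (vpt v) p (vpt w) \<and> pl_length p = real n"
proof (induction n arbitrary: w)
  case 0 then show ?case by (intro exI[of _ "[]"]) simp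
next
  case (Suc n)
  then obtain u where u: "(v, u) \<in> arcs_ends G ^^ n" "(u, w) \<in> arcs_ends G" by auto
  then obtain e where e: "e \<in> arcs G" "u = tail G e" "w = head G e" by (auto simp: arcs_ends_conv)
  obtain p where p: "pl_path G arev (vpt v) p (vpt u)" "pl_length p = real n" using Suc.IH[OF u(1)] by blast
  have "pl_path G arev (vpt u) [(e, 0, 1)] (vpt w)" using e by (simp add: ept_0 ept_1)
  then show ?case using pl_path_append[OF p(1)] p(2) by (intro exI[of _ "p @ [(e, 0, 1)]"]) auto
qed

lemma path_to_vertex:
  assumes "x \<in> M" obtains v p where "v \<in> verts G" "pl_path G arev x p (vpt v)"
  using assms
proof (cases rule: realization_cases)
  case (1 v) then show thesis using that[of v "[]"] by simp
next
  case (2 e t)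
  have "pl_path G arev x [(e, t, 0)] (vpt (tail G e))" using 2 by (simp add: ept_0)
  then show thesis using 2 that by (meson tail_in_verts)
qed

lemma path_exists: "x \<in> M \<Longrightarrow> y \<in> M \<Longrightarrow> \<exists>p. pl_path G arev x p y"
  by (meson dst_relpow path_to_vertex pl_path_append pl_path_rev relpow_pl_path)

lemma pd_le: "x \<in> M \<Longrightarrow> y \<in> M \<Longrightarrow> pl_path G arev x p y \<Longrightarrow> pd x y \<le> pl_length p"
proof -
  assume "x \<in> M" "y \<in> M" and p: "pl_path G arev x p y"
  moreover have "bdd_below (pl_length ` {p. pl_path G arev x p y})"
    by (rule bdd_belowI2[of _ 0]) (rule pl_length_nonneg)
  then have "(INF p \<in> {p. pl_path G arev x p y}. pl_length p) \<le> pl_length p"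
    using p by (intro cINF_lower) auto
  ultimately show "pd x y \<le> pl_length p" by (simp add: path_metric_def)
qed

lemma pd_ge:
  assumes "x \<in> M" "y \<in> M" "\<And>p. pl_path G arev x p y \<Longrightarrow> c \<le> pl_length p"
  shows "c \<le> pd x y"
  using assms path_exists[OF assms(1,2)] unfolding path_metric_def by (auto intro!: cINF_greatest)

lemma pd_nonneg: "0 \<le> pd x y"
proof (cases "x \<in> M \<and> y \<in> M")
  case True then show ?thesis using pl_length_nonneg by (intro pd_ge) auto
next
  case False then show ?thesis by (auto simp: path_metric_def)
qed

lemma pd_sym_le: "x \<in> M \<Longrightarrow> y \<in> M \<Longrightarrow> pd y x \<le> pd x y"
proof (rule pd_ge)
  fix p assume xy: "x \<in> M" "y \<in> M" and p: "pl_path G arev x p y"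
  obtain q where q: "pl_path G arev y q x" "pl_length q = pl_length p" using pl_path_rev[OF p] by blast
  then show "pd y x \<le> pl_length p" using pd_le[OF xy(2,1) q(1)] by simp
qed

lemma pd_tri:
  assumes "x \<in> M" "y \<in> M" "z \<in> M" shows "pd x z \<le> pd x y + pd y z"
proof -
  have "pd x z - pd y z \<le> pd x y"
  proof (rule pd_ge[OF assms(1,2)])
    fix p assume p: "pl_path G arev x p y"
    have "pd x z - pl_length p \<le> pd y z"
    proof (rule pd_ge[OF assms(2,3)])
      fix q assume q: "pl_path G arev y q z"
      then show "pd x z - pl_length p \<le> pl_length q"
        using pd_le[OF assms(1,3) pl_path_append[OF p q]] by simp
    qed
    then show "pd x z - pd y z \<le> pl_length p" by linarith
  qed
  then show ?thesis by linarith
qed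

section \<open>Lower bounds for the path metric by Lipschitz functions\<close>

lemma pd_lipschitz:
  assumes "\<And>e s t. e \<in> arcs G \<Longrightarrow> s \<in> {0..1} \<Longrightarrow> t \<in> {0..1} \<Longrightarrow>
    \<bar>f (ept e s) - f (ept e t)\<bar> \<le> \<bar>s - t\<bar>" and "x \<in> M" "y \<in> M"
  shows "\<bar>f x - f y\<bar> \<le> pd x y"
  by (rule pd_ge[OF assms(2,3)]) (rule pl_path_lipschitz[OF assms(1)])

text \<open>Distance from \<open>v\<close> in the realization: an interior point is reached through
  one end of its edge or through the other.\<close>

definition hgt :: "'v \<Rightarrow> 'v + 'e \<times> real \<Rightarrow> real" where
  "hgt v r = (case r of Inl w \<Rightarrow> real (dst v w)
    | Inr (e, t) \<Rightarrow> min (real (dst v (tail G e)) + t) (real (dst v (head G e)) + 1 - t))"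

lemma lift_hgt:
  assumes v: "v \<in> verts G" and e: "e \<in> arcs G" and t: "t \<in> {0..1}"
  shows "lift (hgt v) (ept e t) = min (real (dst v (tail G e)) + t) (real (dst v (head G e)) + 1 - t)"
proof -
  have 1: "dst v (head G e) \<le> dst v (tail G e) + 1" "dst v (tail G e) \<le> dst v (head G e) + 1"
    using dst_tri[OF v, of "tail G e" "head G e"] dst_tri[OF v, of "head G e" "tail G e"] dst_arc[OF e]
      dst_sym[of "tail G e" "head G e"] e by auto
  then have "real (dst v (head G e)) \<le> real (dst v (tail G e)) + 1"
    "real (dst v (tail G e)) \<le> real (dst v (head G e)) + 1" by linarith+
  moreover have "lift (hgt v) {Inr (e, t), Inr (arev e, 1 - t)} = hgt v (Inr (e, t))"
    by (rule lift_pair) (use e in \<open>simp add: hgt_def min.commute\<close>)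
  ultimately show ?thesis using t by (auto simp: edge_point_def hgt_def)
qed

lemma pd_hgt: "v \<in> verts G \<Longrightarrow> y \<in> M \<Longrightarrow> lift (hgt v) y \<le> pd (vpt v) y"
proof -
  assume v: "v \<in> verts G" and y: "y \<in> M"
  have "\<bar>lift (hgt v) (vpt v) - lift (hgt v) y\<bar> \<le> pd (vpt v) y"
    by (rule pd_lipschitz) (use v y lift_hgt[OF v] vpt_in in \<open>auto simp: min_def\<close>)
  then show ?thesis by (simp add: hgt_def dst_self)
qed

lemma pd_vertices:
  assumes v: "v \<in> verts G" and w: "w \<in> verts G" shows "pd (vpt v) (vpt w) = real (dst v w)"
proof (rule antisym)
  show "pd (vpt v) (vpt w) \<le> real (dst v w)"
    using relpow_pl_path[OF dst_relpow[OF v w]] pd_le[OF vpt_in[OF v] vpt_in[OF w]] by fastforce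
  show "real (dst v w) \<le> pd (vpt v) (vpt w)"
    using pd_hgt[OF v vpt_in[OF w]] by (simp add: hgt_def)
qed

text \<open>Distance from the interior point \<open>(e, s)\<close>, cut off at the distance to the
  nearer end of \<open>e\<close>; it is therefore constant off the edge, and no distances between
  vertices enter.\<close>

definition offset :: "'e \<Rightarrow> real \<Rightarrow> 'v + 'e \<times> real \<Rightarrow> real" where
  "offset e s r = (case r of Inl w \<Rightarrow> min s (1 - s)
    | Inr (f, t) \<Rightarrow> if f = e then min \<bar>t - s\<bar> (min s (1 - s))
        else if f = arev e then min \<bar>1 - t - s\<bar> (min s (1 - s)) else min s (1 - s))"

lemma lift_offset:
  assumes e: "e \<in> arcs G" and s: "0 < s" "s < 1" and f: "f \<in> arcs G" and t: "t \<in> {0..1}"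
  shows "lift (offset e s) (ept f t) = (if f = e then min \<bar>t - s\<bar> (min s (1 - s))
        else if f = arev e then min \<bar>1 - t - s\<bar> (min s (1 - s)) else min s (1 - s))"
proof -
  have "lift (offset e s) {Inr (f, t), Inr (arev f, 1 - t)} = offset e s (Inr (f, t))"
    by (rule lift_pair) (use e arev_neq[OF e] arev_neq[OF f] in \<open>auto simp: offset_def arev_eq_iff\<close>)
  then show ?thesis using t s by (auto simp: edge_point_def offset_def)
qed

text \<open>\<open>hgt\<close> separates a vertex from all other points, and \<open>offset\<close>
  separates an interior point.\<close>

lemma pd_zero:
  assumes x: "x \<in> M" and y: "y \<in> M" and z: "pd x y = 0" shows "x = y"
  using x
proof (cases rule: realization_cases)
  case (1 v)
  have h: "lift (hgt v) y \<le> 0" using pd_hgt[OF 1(1) y] z 1 by simp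
  show ?thesis using y
  proof (cases rule: realization_cases)
    case w: (1 w)
    then show ?thesis using h 1 dst_eq by (simp add: hgt_def)
  next
    case (2 e t)
    then show ?thesis using h lift_hgt[OF 1(1) 2(1), of t] by (auto simp: min_def split: if_splits)
  qed
next
  case (2 e s)
  have "\<bar>lift (offset e s) x - lift (offset e s) y\<bar> \<le> pd x y"
  proof (rule pd_lipschitz[OF _ x y])
    fix f t u assume f: "f \<in> arcs G" and t: "t \<in> {0..1::real}" and u: "u \<in> {0..1::real}"
    have *: "\<bar>min \<bar>t - s\<bar> m - min \<bar>u - s\<bar> m\<bar> \<le> \<bar>t - u\<bar>"
      "\<bar>min \<bar>1 - t - s\<bar> m - min \<bar>1 - u - s\<bar> m\<bar> \<le> \<bar>t - u\<bar>" for m :: real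
      by linarith+
    consider "f = e" | "f = arev e" "f \<noteq> e" | "f \<noteq> e" "f \<noteq> arev e" by blast
    then show "\<bar>lift (offset e s) (ept f t) - lift (offset e s) (ept f u)\<bar> \<le> \<bar>t - u\<bar>"
    proof cases
      case 1
      show ?thesis unfolding lift_offset[OF 2(1-3) f t] lift_offset[OF 2(1-3) f u]
        by (simp only: 1 if_True simp_thms) (rule *)
    next
      case 2
      show ?thesis unfolding lift_offset[OF \<open>e \<in> arcs G\<close> \<open>0 < s\<close> \<open>s < 1\<close> f t]
          lift_offset[OF \<open>e \<in> arcs G\<close> \<open>0 < s\<close> \<open>s < 1\<close> f u]
        using 2(2) by (simp only: 2(1) if_False if_True simp_thms) (rule *)
    next
      case 3
      show ?thesis unfolding lift_offset[OF 2(1-3) f t] lift_offset[OF 2(1-3) f u]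
        using 3 by simp
    qed
  qed
  moreover have "lift (offset e s) x = 0" using 2 by (simp add: lift_offset)
  ultimately have h: "lift (offset e s) y = 0" using z by simp
  show ?thesis using y
  proof (cases rule: realization_cases)
    case (1 w)
    then show ?thesis using h 2 by (simp add: offset_def)
  next
    case f: (2 f t)
    then have "f = e \<and> t = s \<or> f = arev e \<and> t = 1 - s"
      using h 2 arev_neq[OF 2(1)] by (auto simp: lift_offset min_def split: if_splits)
    then show ?thesis
      using f 2 by (auto simp: edge_point_def)
  qed
qed

lemma metric_space: "Metric_space M pd"
proof
  show "0 \<le> pd x y" for x y by (rule pd_nonneg)
  show "pd x y = pd y x" for x y
  proof (cases "x \<in> M \<and> y \<in> M")
    case True then show ?thesis using pd_sym_le by (intro antisym) auto
  next
    case False then show ?thesis by (auto simp: path_metric_def)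
  qed
  show "pd x y = 0 \<longleftrightarrow> x = y" if "x \<in> M" "y \<in> M" for x y
    using that pd_zero pd_le[of x x "[]"] pd_nonneg[of x x] by auto
  show "pd x z \<le> pd x y + pd y z" if "x \<in> M" "y \<in> M" "z \<in> M" for x y z
    using that by (rule pd_tri)
qed

lemma pd_ept: "e \<in> arcs G \<Longrightarrow> s \<in> {0..1} \<Longrightarrow> t \<in> {0..1} \<Longrightarrow> pd (ept e s) (ept e t) \<le> \<bar>s - t\<bar>"
  using pd_le[of "ept e s" "ept e t" "[(e, s, t)]"] ept_in by auto

lemma near_vertex:
  assumes "x \<in> M" obtains v where "v \<in> verts G" "pd x (vpt v) \<le> 1"
  using assms
proof (cases rule: realization_cases)
  case (1 v) then show thesis using that[of v] pd_vertices[of v v] dst_self by simp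
next
  case (2 e t)
  then show thesis using that[of "tail G e"] pd_ept[of e t 0] by (simp add: ept_0)
qed

end


section \<open>Boundary points\<close>

text \<open>Two constants are kept: the integer \<open>De\<close> for vertices drives the chains,
  the real \<open>\<delta>\<close> for all points serves the boundary.\<close>

locale hyperbolic_realization =
  connected_digraph G arev + hyperbolic_digraph G arev "gdist G" De NB deg
  for G :: "('v, 'e) pre_digraph" and arev De NB deg +
  fixes \<delta> :: real and bv :: 'v
  assumes hyp: "w \<in> realization G arev \<Longrightarrow> x \<in> realization G arev \<Longrightarrow> y \<in> realization G arev \<Longrightarrow>
      z \<in> realization G arev \<Longrightarrow>
      min (gromov_product (path_metric G arev) w x y) (gromov_product (path_metric G arev) w y z) - \<delta>
        \<le> gromov_product (path_metric G arev) w x z"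
    and delta_nonneg: "0 \<le> \<delta>"
    and base: "bv \<in> verts G"
begin

abbreviation "GP \<equiv> gromov_product pd"
abbreviation "bpt \<equiv> {Inl bv} :: ('v, 'e) point"
abbreviation "bd \<equiv> graph_boundary G arev"
abbreviation "cpl \<equiv> gromov_completion M pd"
abbreviation "ext \<equiv> ext_gromov_product pd"

lemma bpt: "bpt \<in> M"
  using base by (rule vpt_in)

lemma pd_comm: "pd x y = pd y x"
  using metric_space by (rule Metric_space.commute)

lemma pd_self: "pd x x = 0"
proof (cases "x \<in> M")
  case True then show ?thesis using metric_space by (simp add: Metric_space.mdist_zero)
qed (simp add: path_metric_def)

lemma GP_twice: "2 * GP w x y = pd x w + pd y w - pd x y"
  by (simp add: gromov_product_def)

lemma GP_sym: "GP w x y = GP w y x"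
  using GP_twice[of w x y] GP_twice[of w y x] pd_comm[of x y] by linarith

lemma GP_move:
  assumes "w \<in> M" "x \<in> M" "y \<in> M" "x' \<in> M" shows "GP w x' y \<ge> GP w x y - pd x x'"
  using GP_twice[of w x y] GP_twice[of w x' y] pd_tri[of x x' w] pd_tri[of x' x y] pd_comm[of x x'] assms
  by linarith

lemma GP_move2:
  assumes "w \<in> M" "x \<in> M" "y \<in> M" "y' \<in> M" shows "GP w x y' \<ge> GP w x y - pd y y'"
  using GP_move[of w y x y'] assms GP_sym by metis

lemma GP_base:
  assumes "w \<in> M" "x \<in> M" "y \<in> M" "w' \<in> M" shows "GP w' x y \<ge> GP w x y - pd w w'"
  using GP_twice[of w x y] GP_twice[of w' x y] pd_tri[of x w' w] pd_tri[of y w' w] pd_comm[of w w'] assms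
  by linarith

lemma GP_hyp:
  assumes "w \<in> M" "x \<in> M" "y \<in> M" "z \<in> M" "C \<le> GP w x y" "C \<le> GP w y z"
  shows "C - \<delta> \<le> GP w x z"
  using hyp[OF assms(1-4)] assms(5,6) by linarith

lemma GP_vertices:
  assumes "x \<in> verts G" "a \<in> verts G" "b \<in> verts G"
  shows "2 * GP (vpt x) (vpt a) (vpt b) = real (gp x a b)"
  using gp_eq[OF assms] pd_vertices[OF assms(2,1)] pd_vertices[OF assms(3,1)] pd_vertices[OF assms(2,3)]
    GP_twice[of "vpt x" "vpt a" "vpt b"] by linarith

section \<open>Sequences converging to infinity\<close>

lemma asymptotic_iff:
  "asymptotic M pd x y \<longleftrightarrow> (\<forall>w\<in>M. \<forall>C. \<exists>N. \<forall>i\<ge>N. \<forall>j\<ge>N. C \<le> GP w (x i) (y j))"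
  unfolding asymptotic_def filterlim_at_top eventually_prod_sequentially by (simp, meson)

lemma asymptoticD:
  "asymptotic M pd x y \<Longrightarrow> w \<in> M \<Longrightarrow> \<exists>N. \<forall>i\<ge>N. \<forall>j\<ge>N. C \<le> GP w (x i) (y j)"
  unfolding asymptotic_iff by blast

lemma asymptotic_sym: "asymptotic M pd x y \<Longrightarrow> asymptotic M pd y x"
  unfolding asymptotic_iff using GP_sym by metis

lemma asymptotic_trans:
  assumes M: "range x \<subseteq> M" "range y \<subseteq> M" "range z \<subseteq> M"
    and xy: "asymptotic M pd x y" and yz: "asymptotic M pd y z"
  shows "asymptotic M pd x z"
  unfolding asymptotic_iff
proof (intro ballI allI)
  fix w C assume w: "w \<in> M"
  obtain N where N: "\<And>i j. N \<le> i \<Longrightarrow> N \<le> j \<Longrightarrow> C + \<delta> \<le> GP w (x i) (y j)"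
    using asymptoticD[OF xy w, of "C + \<delta>"] by blast
  obtain N' where N': "\<And>i j. N' \<le> i \<Longrightarrow> N' \<le> j \<Longrightarrow> C + \<delta> \<le> GP w (y i) (z j)"
    using asymptoticD[OF yz w, of "C + \<delta>"] by blast
  show "\<exists>N. \<forall>i\<ge>N. \<forall>j\<ge>N. C \<le> GP w (x i) (z j)"
  proof (intro exI[of _ "max N N'"] allI impI)
    fix i j assume ij: "max N N' \<le> i" "max N N' \<le> j"
    have "C + \<delta> - \<delta> \<le> GP w (x i) (z j)"
      by (rule GP_hyp[OF w, of _ "y (max N N')"]) (use M ij N N' in auto)
    then show "C \<le> GP w (x i) (z j)" by simp
  qed
qed

abbreviation "seqs \<equiv> gromov_sequences M pd"
definition "asym_rel = {(x, y). x \<in> seqs \<and> y \<in> seqs \<and> asymptotic M pd x y}"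

lemma bd_eq: "bd = seqs // asym_rel"
  by (simp add: graph_boundary_def gromov_boundary_def asym_rel_def)

lemma seqs_range: "x \<in> seqs \<Longrightarrow> range x \<subseteq> M"
  by (simp add: gromov_sequences_def)

lemma equiv_asym: "equiv seqs asym_rel"
proof (rule equivI)
  show "refl_on seqs asym_rel" by (auto simp: refl_on_def asym_rel_def gromov_sequences_def)
  show "sym asym_rel" by (auto simp: sym_def asym_rel_def asymptotic_sym)
  show "trans asym_rel"
    unfolding trans_def asym_rel_def using asymptotic_trans seqs_range by blast
qed (auto simp: asym_rel_def)

lemma bdD:
  assumes "\<xi> \<in> bd"
  shows "\<xi> \<noteq> {}" "x \<in> \<xi> \<Longrightarrow> range x \<subseteq> M" "x \<in> \<xi> \<Longrightarrow> y \<in> \<xi> \<Longrightarrow> asymptotic M pd x y"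
    "x \<in> \<xi> \<Longrightarrow> range y \<subseteq> M \<Longrightarrow> asymptotic M pd x y \<Longrightarrow> y \<in> \<xi>"
proof -
  have \<xi>: "\<xi> \<in> seqs // asym_rel" using assms by (simp add: bd_eq)
  have sub: "\<xi> \<subseteq> seqs" using \<xi> equiv_asym by (rule in_quotient_imp_subset[rotated])
  show "\<xi> \<noteq> {}" using in_quotient_imp_non_empty[OF equiv_asym \<xi>] .
  show "x \<in> \<xi> \<Longrightarrow> range x \<subseteq> M" using sub seqs_range by blast
  show "x \<in> \<xi> \<Longrightarrow> y \<in> \<xi> \<Longrightarrow> asymptotic M pd x y"
    using in_quotient_imp_in_rel[OF equiv_asym \<xi>, of x y] by (auto simp: asym_rel_def)
  show "y \<in> \<xi>" if x: "x \<in> \<xi>" and y: "range y \<subseteq> M" and xy: "asymptotic M pd x y"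
  proof -
    have xM: "range x \<subseteq> M" using x sub seqs_range by blast
    have "asymptotic M pd y y" using asymptotic_trans[OF y xM y asymptotic_sym[OF xy] xy] .
    then have "(x, y) \<in> asym_rel" using x sub y xy by (auto simp: asym_rel_def gromov_sequences_def)
    then show ?thesis using in_quotient_imp_closed[OF equiv_asym \<xi> x] by blast
  qed
qed

lemma bd_near:
  assumes \<xi>: "\<xi> \<in> bd" and x: "x \<in> \<xi>" and y: "range y \<subseteq> M" and near: "\<And>n. pd (x n) (y n) \<le> c"
  shows "y \<in> \<xi>"
proof (rule bdD(4)[OF \<xi> x y])
  have xM: "range x \<subseteq> M" using bdD(2)[OF \<xi> x] .
  show "asymptotic M pd x y"
    unfolding asymptotic_iff
  proof (intro ballI allI)
    fix w C assume w: "w \<in> M"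
    obtain N where N: "\<And>i j. N \<le> i \<Longrightarrow> N \<le> j \<Longrightarrow> C + c \<le> GP w (x i) (x j)"
      using asymptoticD[OF bdD(3)[OF \<xi> x x] w, of "C + c"] by blast
    have "C \<le> GP w (x i) (y j)" if "N \<le> i" "N \<le> j" for i j
    proof -
      have "x i \<in> M" "x j \<in> M" "y j \<in> M" using xM y by auto
      then show ?thesis using N[OF that] GP_move2[OF w, of "x i" "x j" "y j"] near[of j] by linarith
    qed
    then show "\<exists>N. \<forall>i\<ge>N. \<forall>j\<ge>N. C \<le> GP w (x i) (y j)" by blast
  qed
qed

text \<open>Flows exist between vertices only, so boundary points are approached by vertex
  sequences; this loses nothing because every point of the realization is within 1 of a
  vertex.\<close>

definition vseq :: "(nat \<Rightarrow> 'v) \<Rightarrow> ('v, 'e) end_point \<Rightarrow> bool" where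
  "vseq a \<xi> \<longleftrightarrow> (\<forall>n. a n \<in> verts G) \<and> (\<lambda>n. vpt (a n)) \<in> \<xi>"

lemma vseq_near:
  assumes \<xi>: "\<xi> \<in> bd" and x: "x \<in> \<xi>"
  obtains a where "vseq a \<xi>" "\<And>n. pd (x n) (vpt (a n)) \<le> 1"
proof -
  have ex: "\<exists>v. v \<in> verts G \<and> pd (x n) (vpt v) \<le> 1" for n
  proof -
    have "x n \<in> M" using bdD(2)[OF \<xi> x] by auto
    then obtain v where "v \<in> verts G" "pd (x n) (vpt v) \<le> 1" by (rule near_vertex)
    then show ?thesis by (intro exI[of _ v] conjI)
  qed
  define a where "a n = (SOME v. v \<in> verts G \<and> pd (x n) (vpt v) \<le> 1)" for n
  have a: "a n \<in> verts G" "pd (x n) (vpt (a n)) \<le> 1" for n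
    using someI_ex[OF ex[of n]] by (simp_all add: a_def)
  have "(\<lambda>n. vpt (a n)) \<in> \<xi>" by (rule bd_near[OF \<xi> x _ a(2)]) (use a(1) vpt_in in auto)
  then show thesis by (intro that[of a]) (auto simp: vseq_def a)
qed

definition vs :: "('v, 'e) end_point \<Rightarrow> nat \<Rightarrow> 'v" where
  "vs \<xi> = (SOME a. vseq a \<xi>)"

lemma vs:
  assumes "\<xi> \<in> bd" shows "vseq (vs \<xi>) \<xi>"
proof -
  obtain x where "x \<in> \<xi>" using bdD(1)[OF assms] by blast
  then obtain a where "vseq a \<xi>" using vseq_near[OF assms] by blast
  then show ?thesis unfolding vs_def by (rule someI[of "\<lambda>a. vseq a \<xi>"])
qed

lemma vseqD: "vseq a \<xi> \<Longrightarrow> a n \<in> verts G"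
  by (simp add: vseq_def)

lemma vseq_GP:
  assumes "\<xi> \<in> bd" "vseq a \<xi>" "vseq a' \<xi>" "w \<in> M"
  obtains N where "\<And>i j. N \<le> i \<Longrightarrow> N \<le> j \<Longrightarrow> C \<le> GP w (vpt (a i)) (vpt (a' j))"
  using asymptoticD[OF bdD(3)[OF assms(1)] assms(4), of "\<lambda>n. vpt (a n)" "\<lambda>n. vpt (a' n)" C] assms(2,3)
  unfolding vseq_def by blast


section \<open>The flow between boundary points\<close>

text \<open>The limit is taken along chosen sequences; \<open>q_lim\<close> shows that all vertex
  sequences give the same value.\<close>

definition q :: "('v, 'e) bicombing" where
  "q \<xi> \<eta> e = (if e \<in> arcs G then lim (\<lambda>n. qflow (vs \<xi> n) (vs \<eta> n) e) else 0)"

lemma KF_nonneg: "0 \<le> KF"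
  using KS_nonneg KT_nonneg by (simp add: KF_def)

lemma KF_small:
  assumes "0 < \<epsilon>"
  obtains C where "\<And>r. C \<le> r \<Longrightarrow> KF * exp (- th * (2 * r)) < \<epsilon>"
proof -
  define C where "C = ln ((KF + 1) / \<epsilon>) / (2 * th)"
  have "KF * exp (- th * (2 * r)) < \<epsilon>" if "C \<le> r" for r
  proof -
    have "ln ((KF + 1) / \<epsilon>) = th * (2 * C)" using th_pos by (simp add: C_def)
    also have "\<dots> \<le> th * (2 * r)" using that th_pos by simp
    finally have "exp (- th * (2 * r)) \<le> exp (- ln ((KF + 1) / \<epsilon>))" by simp
    also have "\<dots> = \<epsilon> / (KF + 1)" using assms KF_nonneg by (simp add: exp_minus)
    finally have "(KF + 1) * exp (- th * (2 * r)) \<le> \<epsilon>"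
      using KF_nonneg by (simp add: field_simps)
    moreover have "0 < exp (- th * (2 * r))" by simp
    ultimately show ?thesis unfolding distrib_right by linarith
  qed
  then show thesis by (rule that)
qed

lemma qflow_near_GP:
  assumes e: "e \<in> arcs G" and v: "a \<in> verts G" "b \<in> verts G" "a' \<in> verts G" "b' \<in> verts G"
    and C: "C \<le> GP (vpt (tail G e)) (vpt a) (vpt a')" "C \<le> GP (vpt (tail G e)) (vpt b) (vpt b')"
  shows "\<bar>qflow a b e - qflow a' b' e\<bar> \<le> 2 * (KF * exp (- th * (2 * C)))"
proof -
  have x: "tail G e \<in> verts G" using e by simp
  have "KF * exp (- th * real (gp (tail G e) c c')) \<le> KF * exp (- th * (2 * C))"
    if "c \<in> verts G" "c' \<in> verts G" "C \<le> GP (vpt (tail G e)) (vpt c) (vpt c')" for c c'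
  proof -
    have "2 * C \<le> real (gp (tail G e) c c')" using GP_vertices[OF x that(1,2)] that(3) by linarith
    then have "th * (2 * C) \<le> th * real (gp (tail G e) c c')" using th_pos by (intro mult_left_mono) auto
    then show ?thesis using KF_nonneg by (intro mult_left_mono) auto
  qed
  from this[OF v(1,3) C(1)] this[OF v(2,4) C(2)] show ?thesis
    using qflow_near[OF e v] by linarith
qed

text \<open>Two sequences at each end let one estimate serve both for the Cauchy property and for
  the independence of the choice.\<close>

lemma qflow_cauchy:
  assumes e: "e \<in> arcs G" and bd: "\<xi> \<in> bd" "\<eta> \<in> bd"
    and a: "vseq a \<xi>" "vseq a' \<xi>" and b: "vseq b \<eta>" "vseq b' \<eta>" and eps: "0 < \<epsilon>"
  obtains N where "\<And>m n. N \<le> m \<Longrightarrow> N \<le> n \<Longrightarrow> \<bar>qflow (a m) (b m) e - qflow (a' n) (b' n) e\<bar> < \<epsilon>"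
proof -
  obtain C where C: "\<And>r. C \<le> r \<Longrightarrow> KF * exp (- th * (2 * r)) < \<epsilon> / 2"
    using KF_small[of "\<epsilon> / 2"] eps by auto
  have x: "vpt (tail G e) \<in> M" using e by (intro vpt_in) auto
  obtain N where N: "\<And>i j. N \<le> i \<Longrightarrow> N \<le> j \<Longrightarrow> C \<le> GP (vpt (tail G e)) (vpt (a i)) (vpt (a' j))"
    using vseq_GP[OF bd(1) a x] by blast
  obtain N' where N': "\<And>i j. N' \<le> i \<Longrightarrow> N' \<le> j \<Longrightarrow> C \<le> GP (vpt (tail G e)) (vpt (b i)) (vpt (b' j))"
    using vseq_GP[OF bd(2) b x] by blast
  show thesis
  proof (rule that[of "max N N'"])
    fix m n assume mn: "max N N' \<le> m" "max N N' \<le> n"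
    have "\<bar>qflow (a m) (b m) e - qflow (a' n) (b' n) e\<bar> \<le> 2 * (KF * exp (- th * (2 * C)))"
      by (rule qflow_near_GP[OF e]) (use a b vseqD mn N N' in auto)
    also have "\<dots> < \<epsilon>" using C[of C] by simp
    finally show "\<bar>qflow (a m) (b m) e - qflow (a' n) (b' n) e\<bar> < \<epsilon>" .
  qed
qed

lemma q_lim:
  assumes e: "e \<in> arcs G" and bd: "\<xi> \<in> bd" "\<eta> \<in> bd" and a: "vseq a \<xi>" and b: "vseq b \<eta>"
  shows "(\<lambda>n. qflow (a n) (b n) e) \<longlonglongrightarrow> q \<xi> \<eta> e"
proof -
  note v = vs[OF bd(1)] vs[OF bd(2)]
  have "Cauchy (\<lambda>n. qflow (vs \<xi> n) (vs \<eta> n) e)"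
    unfolding Cauchy_def dist_real_def
  proof (intro allI impI)
    fix \<epsilon> :: real assume "0 < \<epsilon>"
    then show "\<exists>N. \<forall>m\<ge>N. \<forall>n\<ge>N. \<bar>qflow (vs \<xi> m) (vs \<eta> m) e - qflow (vs \<xi> n) (vs \<eta> n) e\<bar> < \<epsilon>"
      using qflow_cauchy[OF e bd v(1) v(1) v(2) v(2)] by metis
  qed
  then have "convergent (\<lambda>n. qflow (vs \<xi> n) (vs \<eta> n) e)" by (simp add: Cauchy_convergent_iff)
  then have lim: "(\<lambda>n. qflow (vs \<xi> n) (vs \<eta> n) e) \<longlonglongrightarrow> q \<xi> \<eta> e"
    using e by (simp add: q_def convergent_LIMSEQ_iff)
  have "(\<lambda>n. qflow (a n) (b n) e - qflow (vs \<xi> n) (vs \<eta> n) e) \<longlonglongrightarrow> 0"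
  proof (rule LIMSEQ_I)
    fix \<epsilon> :: real assume "0 < \<epsilon>"
    then show "\<exists>N. \<forall>n\<ge>N. norm (qflow (a n) (b n) e - qflow (vs \<xi> n) (vs \<eta> n) e - 0) < \<epsilon>"
      using qflow_cauchy[OF e bd a v(1) b v(2), of \<epsilon>] by (metis diff_zero real_norm_def)
  qed
  from tendsto_add[OF this lim] show ?thesis by simp
qed

lemma q_outside: "e \<notin> arcs G \<Longrightarrow> q \<xi> \<eta> e = 0"
  by (simp add: q_def)

lemma q_antisym:
  assumes "\<xi> \<in> bd" "\<eta> \<in> bd" shows "q \<eta> \<xi> e = - q \<xi> \<eta> e"
proof (cases "e \<in> arcs G")
  case True
  have "(\<lambda>n. - qflow (vs \<xi> n) (vs \<eta> n) e) \<longlonglongrightarrow> - q \<xi> \<eta> e"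
    using q_lim[OF True assms vs vs] assms by (intro tendsto_minus) auto
  moreover have "(\<lambda>n. - qflow (vs \<xi> n) (vs \<eta> n) e) \<longlonglongrightarrow> q \<eta> \<xi> e"
    using q_lim[OF True assms(2,1) vs vs] assms by (subst qflow_antisym[symmetric]) auto
  ultimately show ?thesis using LIMSEQ_unique by blast
qed (simp add: q_outside)

lemma q_bound:
  assumes "\<xi> \<in> bd" "\<eta> \<in> bd" shows "\<bar>q \<xi> \<eta> e\<bar> \<le> K0"
proof (cases "e \<in> arcs G")
  case True
  have "(\<lambda>n. \<bar>qflow (vs \<xi> n) (vs \<eta> n) e\<bar>) \<longlonglongrightarrow> \<bar>q \<xi> \<eta> e\<bar>"
    using q_lim[OF True assms vs vs] assms by (intro tendsto_rabs) auto
  then show ?thesis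
    by (rule LIMSEQ_le_const2) (use qflow_bound[OF True] vseqD vs assms in blast)
qed (use K0_pos in \<open>simp add: q_outside\<close>)

lemma q_near:
  assumes e: "e \<in> arcs G" and bd: "\<xi> \<in> bd" "\<eta> \<in> bd" "\<xi>' \<in> bd" "\<eta>' \<in> bd"
    and v: "vseq a \<xi>" "vseq b \<eta>" "vseq a' \<xi>'" "vseq b' \<eta>'"
    and C: "\<And>n. N \<le> n \<Longrightarrow> C \<le> GP (vpt (tail G e)) (vpt (a n)) (vpt (a' n))"
      "\<And>n. N \<le> n \<Longrightarrow> C \<le> GP (vpt (tail G e)) (vpt (b n)) (vpt (b' n))"
  shows "\<bar>q \<xi> \<eta> e - q \<xi>' \<eta>' e\<bar> \<le> 2 * (KF * exp (- th * (2 * C)))"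
proof -
  have "(\<lambda>n. \<bar>qflow (a n) (b n) e - qflow (a' n) (b' n) e\<bar>) \<longlonglongrightarrow> \<bar>q \<xi> \<eta> e - q \<xi>' \<eta>' e\<bar>"
    by (intro tendsto_rabs tendsto_diff q_lim e bd v)
  then show ?thesis
  proof (rule LIMSEQ_le_const2)
    show "\<exists>N. \<forall>n\<ge>N. \<bar>qflow (a n) (b n) e - qflow (a' n) (b' n) e\<bar> \<le> 2 * (KF * exp (- th * (2 * C)))"
      using v by (intro exI[of _ N] allI impI qflow_near_GP e C vseqD) auto
  qed
qed


section \<open>Neighbourhoods of boundary points\<close>

lemma rep_range: "a \<in> cpl \<Longrightarrow> x \<in> representing_sequences a \<Longrightarrow> x i \<in> M"
  using bdD(2) unfolding gromov_completion_def graph_boundary_def[symmetric]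
  by (fastforce simp: representing_sequences_def split: sum.splits)

lemma ext_lower: "ereal R < ext w a b \<Longrightarrow> R' \<le> R \<Longrightarrow> ereal R' < ext w a b"
  by (rule le_less_trans[of _ "ereal R"]) auto

lemma ext_greaterE:
  assumes "ereal R < ext w a b"
  obtains x y N where "x \<in> representing_sequences a" "y \<in> representing_sequences b"
    "\<And>i j. N \<le> i \<Longrightarrow> N \<le> j \<Longrightarrow> R < GP w (x i) (y j)"
proof -
  obtain x y where xy: "x \<in> representing_sequences a" "y \<in> representing_sequences b"
    and "ereal R < Liminf (sequentially \<times>\<^sub>F sequentially) (\<lambda>(i, j). ereal (GP w (x i) (y j)))"
    using assms unfolding ext_gromov_product_def less_SUP_iff by auto
  then have "eventually (\<lambda>p. ereal R < (\<lambda>(i, j). ereal (GP w (x i) (y j))) p) (sequentially \<times>\<^sub>F sequentially)"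
    by (intro less_LiminfD)
  then obtain N where "\<forall>m\<ge>N. \<forall>n\<ge>N. R < GP w (x n) (y m)"
    unfolding eventually_prod_sequentially by auto
  then show thesis using that[OF xy] by blast
qed

lemma ext_greaterI:
  assumes "x \<in> representing_sequences a" "y \<in> representing_sequences b"
    and "\<And>i j. N \<le> i \<Longrightarrow> N \<le> j \<Longrightarrow> R' \<le> GP w (x i) (y j)" and "R < R'"
  shows "ereal R < ext w a b"
proof -
  have "ereal R' \<le> Liminf (sequentially \<times>\<^sub>F sequentially) (\<lambda>(i, j). ereal (GP w (x i) (y j)))"
    by (rule Liminf_bounded) (use assms(3) in \<open>auto simp: eventually_prod_sequentially\<close>)
  also have "\<dots> \<le> ext w a b"
    unfolding ext_gromov_product_def by (rule SUP_upper2[of "(x, y)"]) (use assms in auto)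
  finally show ?thesis using assms(4) by (meson ereal_less_ereal_Ex less_ereal.simps(1) less_le_trans)
qed

lemma Inr_cpl: "Inr \<xi> \<in> cpl \<longleftrightarrow> \<xi> \<in> bd" and Inl_cpl: "Inl p \<in> cpl \<longleftrightarrow> p \<in> M"
  by (auto simp: gromov_completion_def graph_boundary_def)

lemma rep_Inr: "representing_sequences (Inr \<xi>) = \<xi>" and rep_Inl: "representing_sequences (Inl p) = {\<lambda>_. p}"
  by (auto simp: representing_sequences_def)

lemma ext_self:
  assumes "\<xi> \<in> bd" "w \<in> M" shows "ereal R < ext w (Inr \<xi>) (Inr \<xi>)"
proof -
  obtain x where x: "x \<in> \<xi>" using bdD(1)[OF assms(1)] by blast
  obtain N where "\<And>i j. N \<le> i \<Longrightarrow> N \<le> j \<Longrightarrow> R + 1 \<le> GP w (x i) (x j)"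
    using asymptoticD[OF bdD(3)[OF assms(1) x x] assms(2), of "R + 1"] by blast
  then show ?thesis using x by (intro ext_greaterI[of x _ x]) (auto simp: rep_Inr)
qed

text \<open>The two products may be witnessed by different sequences of \<open>\<zeta>\<close>.
  Passing through both costs \<open>\<delta>\<close> twice, and the remaining 1 gives the strict
  inequality for the lower limit.\<close>

lemma ext_trans:
  assumes \<zeta>: "\<zeta> \<in> bd" and a: "a \<in> cpl" and b: "b \<in> cpl" and w: "w \<in> M"
    and 1: "ereal (R + 2 * \<delta> + 1) < ext w a (Inr \<zeta>)" and 2: "ereal (R + 2 * \<delta> + 1) < ext w (Inr \<zeta>) b"
  shows "ereal R < ext w a b"
proof -
  obtain x y N where x: "x \<in> representing_sequences a" and y: "y \<in> \<zeta>"
    and N: "\<And>i j. N \<le> i \<Longrightarrow> N \<le> j \<Longrightarrow> R + 2 * \<delta> + 1 < GP w (x i) (y j)"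
    using ext_greaterE[OF 1] by (metis rep_Inr)
  obtain y' z N' where y': "y' \<in> \<zeta>" and z: "z \<in> representing_sequences b"
    and N': "\<And>i j. N' \<le> i \<Longrightarrow> N' \<le> j \<Longrightarrow> R + 2 * \<delta> + 1 < GP w (y' i) (z j)"
    using ext_greaterE[OF 2] by (metis rep_Inr)
  obtain N'' where N'': "\<And>i j. N'' \<le> i \<Longrightarrow> N'' \<le> j \<Longrightarrow> R + 2 * \<delta> + 1 \<le> GP w (y i) (y' j)"
    using asymptoticD[OF bdD(3)[OF \<zeta> y y'] w, of "R + 2 * \<delta> + 1"] by blast
  let ?n = "max N (max N' N'')"
  have yM: "y ?n \<in> M" "y' ?n \<in> M" using bdD(2)[OF \<zeta> y] bdD(2)[OF \<zeta> y'] by auto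
  show ?thesis
  proof (rule ext_greaterI[OF x z, of ?n "R + 1"])
    fix i j assume ij: "?n \<le> i" "?n \<le> j"
    have xz: "x i \<in> M" "z j \<in> M" using rep_range a b x z by auto
    have "R + 2 * \<delta> + 1 - \<delta> \<le> GP w (y ?n) (z j)"
    proof (rule GP_hyp[OF w yM xz(2)])
      show "R + 2 * \<delta> + 1 \<le> GP w (y ?n) (y' ?n)" by (rule N'') auto
      show "R + 2 * \<delta> + 1 \<le> GP w (y' ?n) (z j)" by (rule less_imp_le, rule N') (use ij in auto)
    qed
    moreover have "R + 2 * \<delta> + 1 - \<delta> \<le> GP w (x i) (y ?n)" using N[of i ?n] ij delta_nonneg by auto
    ultimately have "R + 2 * \<delta> + 1 - \<delta> - \<delta> \<le> GP w (x i) (z j)"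
      using GP_hyp[OF w xz(1) yM(1) xz(2)] by blast
    then show "R + 1 \<le> GP w (x i) (z j)" by simp
  qed simp
qed

lemma ext_base:
  assumes a: "a \<in> cpl" and b: "b \<in> cpl" and w: "w \<in> M" "w' \<in> M"
    and "ereal (R + pd w w') < ext w a b"
  shows "ereal R < ext w' a b"
proof -
  obtain R' where R': "R + pd w w' < R'" "ereal R' < ext w a b"
    using ereal_dense2[OF assms(5)] by auto
  obtain x y N where x: "x \<in> representing_sequences a" "y \<in> representing_sequences b"
    and N: "\<And>i j. N \<le> i \<Longrightarrow> N \<le> j \<Longrightarrow> R' < GP w (x i) (y j)"
    using ext_greaterE[OF R'(2)] by metis
  show ?thesis
  proof (rule ext_greaterI[OF x, of N "R' - pd w w'"])
    fix i j assume "N \<le> i" "N \<le> j"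
    then show "R' - pd w w' \<le> GP w' (x i) (y j)"
      using N[of i j] GP_base[OF w(1) _ _ w(2), of "x i" "y j"] rep_range a b x by fastforce
  qed (use R' in simp)
qed

lemma ext_point_move:
  assumes a: "a \<in> cpl" and p: "p \<in> M" "p' \<in> M" "w \<in> M" and "pd p p' \<le> 1"
    and "ereal (R + 2) < ext w a (Inl p)"
  shows "ereal R < ext w a (Inl p')"
proof -
  obtain x N where x: "x \<in> representing_sequences a"
    and N: "\<And>i j. N \<le> i \<Longrightarrow> N \<le> j \<Longrightarrow> R + 2 < GP w (x i) p"
    using ext_greaterE[OF assms(6)] by (auto simp: rep_Inl) metis
  show ?thesis
  proof (rule ext_greaterI[OF x, of "\<lambda>_. p'" _ N "R + 1"])
    fix i j :: nat assume "N \<le> i" "N \<le> j"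
    then show "R + 1 \<le> GP w (x i) p'"
      using N[of i j] GP_move2[OF p(3) _ p(1,2), of "x i"] rep_range[OF a x] assms(5) by fastforce
  qed (auto simp: rep_Inl)
qed

lemma completion_openin: "openin (completion_topology M pd) U \<longleftrightarrow> completion_open M pd U"
  unfolding completion_topology_def by (simp add: topology_inverse'[OF istopology_completion_open])

text \<open>The set of all points at large Gromov product with \<open>\<xi>\<close> need not be open; \<open>W\<close> is its interior.\<close>

lemma completion_neighbourhood:
  assumes \<xi>: "\<xi> \<in> bd"
  obtains W where "completion_open M pd W" "Inr \<xi> \<in> W" "\<And>a. a \<in> W \<Longrightarrow> ereal R < ext bpt (Inr \<xi>) a"
proof -
  interpret Ms: Metric_space M pd by (rule metric_space)
  define N where "N = {a \<in> cpl. ereal R < ext bpt (Inr \<xi>) a}"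
  \<comment> \<open>\<open>W1\<close> and \<open>W2\<close> are the candidates for the interior of
    \<open>N\<close>, in the space and at infinity.\<close>
  define W1 where "W1 = {p \<in> M. \<exists>r>0. \<forall>p'\<in>Ms.mball p r. Inl p' \<in> N}"
  define W2 where "W2 = {\<eta> \<in> bd. \<exists>R'. {b \<in> cpl. ereal R' < ext bpt (Inr \<eta>) b} \<subseteq> N}"
  let ?W = "Inl ` W1 \<union> Inr ` W2"
  have Inl_W: "Inl -` ?W = W1" by auto
  have "completion_open M pd ?W"
    unfolding completion_open_def
  proof (intro conjI allI impI ballI)
    show "?W \<subseteq> cpl" by (auto simp: W1_def W2_def Inl_cpl Inr_cpl)
    show "openin Ms.mtopology (Inl -` ?W)"
      unfolding Inl_W Ms.openin_mtopology
    proof (intro conjI allI impI)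
      show "W1 \<subseteq> M" by (auto simp: W1_def)
      fix p assume "p \<in> W1"
      then obtain r where r: "p \<in> M" "0 < r" "\<And>p'. p' \<in> Ms.mball p r \<Longrightarrow> Inl p' \<in> N" by (auto simp: W1_def)
      have "Ms.mball p (r / 2) \<subseteq> W1"
      proof
        fix x assume x: "x \<in> Ms.mball p (r / 2)"
        have "Inl p' \<in> N" if "p' \<in> Ms.mball x (r / 2)" for p'
          using r(3)[of p'] x that Ms.triangle[of p x p'] by auto
        then show "x \<in> W1" using x r by (auto simp: W1_def intro!: exI[of _ "r / 2"])
      qed
      then show "\<exists>r>0. Ms.mball p r \<subseteq> W1" using r(2) by (intro exI[of _ "r / 2"]) auto
    qed
    fix \<eta> w assume "Inr \<eta> \<in> ?W" and w: "w \<in> M"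
    then obtain R' where \<eta>: "\<eta> \<in> bd" and R': "{b \<in> cpl. ereal R' < ext bpt (Inr \<eta>) b} \<subseteq> N"
      by (auto simp: W2_def)
    have \<eta>c: "Inr \<eta> \<in> cpl" using \<eta> by (simp add: Inr_cpl)
    \<comment> \<open>Large enough for both kinds of points: \<open>R' + 2\<close> allows a move
      within a unit ball, \<open>R' + 2 * \<delta> + 1\<close> allows
      \<open>ext_trans\<close>.\<close>
    define R1 where "R1 = R' + 2 * \<delta> + 2"
    have "a \<in> ?W" if a: "a \<in> cpl" "ereal (R1 + pd w bpt) < ext w (Inr \<eta>) a" for a
    proof -
      have a1: "ereal R1 < ext bpt (Inr \<eta>) a" by (rule ext_base[OF \<eta>c a(1) w bpt a(2)])
      show ?thesis
      proof (cases a)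
        case (Inl p)
        have p: "p \<in> M" using a Inl by (simp add: Inl_cpl)
        have "Inl p' \<in> N" if "p' \<in> Ms.mball p 1" for p'
        proof -
          have p': "p' \<in> M" "pd p p' \<le> 1" using that by auto
          have "ereal (R' + 2) < ext bpt (Inr \<eta>) (Inl p)"
            by (rule ext_lower[OF a1[unfolded Inl]]) (use delta_nonneg in \<open>simp add: R1_def\<close>)
          then have "ereal R' < ext bpt (Inr \<eta>) (Inl p')"
            by (rule ext_point_move[OF \<eta>c p p'(1) bpt p'(2)])
          then show ?thesis using R' p' by (auto simp: Inl_cpl)
        qed
        then show ?thesis using p Inl by (auto simp: W1_def intro!: exI[of _ 1])
      next
        case (Inr \<zeta>)
        have \<zeta>: "\<zeta> \<in> bd" using a Inr by (simp add: Inr_cpl)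
        have "{b \<in> cpl. ereal (R' + 2 * \<delta> + 1) < ext bpt (Inr \<zeta>) b} \<subseteq> N"
        proof
          fix b assume b: "b \<in> {b \<in> cpl. ereal (R' + 2 * \<delta> + 1) < ext bpt (Inr \<zeta>) b}"
          have 1: "ereal (R' + 2 * \<delta> + 1) < ext bpt (Inr \<eta>) (Inr \<zeta>)"
            by (rule ext_lower[OF a1[unfolded Inr]]) (simp add: R1_def)
          have "ereal R' < ext bpt (Inr \<eta>) b" by (rule ext_trans[OF \<zeta> \<eta>c _ bpt 1]) (use b in auto)
          then show "b \<in> N" using R' b by auto
        qed
        then show ?thesis using \<zeta> Inr by (auto simp: W2_def)
      qed
    qed
    then show "\<exists>R. {a \<in> cpl. ereal R < ext w (Inr \<eta>) a} \<subseteq> ?W" by blast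
  qed
  moreover have "Inr \<xi> \<in> ?W" using \<xi> by (auto simp: W2_def N_def)
  moreover have "ereal R < ext bpt (Inr \<xi>) a" if "a \<in> ?W" for a
  proof -
    have "a \<in> N" using that
    proof
      assume "a \<in> Inl ` W1"
      then obtain p r where "a = Inl p" "p \<in> M" "0 < r" "\<forall>p'\<in>Ms.mball p r. Inl p' \<in> N" by (auto simp: W1_def)
      then show ?thesis by auto
    next
      assume "a \<in> Inr ` W2"
      then obtain \<eta> R' where \<eta>: "a = Inr \<eta>" "\<eta> \<in> bd" "{b \<in> cpl. ereal R' < ext bpt (Inr \<eta>) b} \<subseteq> N"
        by (auto simp: W2_def)
      then show ?thesis using ext_self[OF \<eta>(2) bpt, of R'] by (auto simp: Inr_cpl)
    qed
    then show ?thesis by (simp add: N_def)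
  qed
  ultimately show thesis by (rule that)
qed

abbreviation "btop \<equiv> boundary_topology M pd"

lemma btop_subset: "topspace btop \<subseteq> bd"
  by (auto simp: boundary_topology_def topspace_pullback_topology graph_boundary_def)

lemma boundary_neighbourhood:
  assumes \<xi>: "\<xi> \<in> bd"
  obtains W where "openin btop W" "\<xi> \<in> W" "\<And>\<eta>. \<eta> \<in> W \<Longrightarrow> \<eta> \<in> bd \<and> ereal R < ext bpt (Inr \<xi>) (Inr \<eta>)"
proof -
  obtain W where W: "completion_open M pd W" "Inr \<xi> \<in> W" "\<And>a. a \<in> W \<Longrightarrow> ereal R < ext bpt (Inr \<xi>) a"
    using completion_neighbourhood[OF \<xi>] by metis
  show thesis
  proof (rule that[of "Inr -` W \<inter> bd"])
    show "openin btop (Inr -` W \<inter> bd)"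
      unfolding boundary_topology_def openin_pullback_topology graph_boundary_def[symmetric]
      using W(1) by (auto simp: completion_openin)
  qed (use W \<xi> in auto)
qed

text \<open>Replaces the neighbourhood by a product with the single vertices \<open>a n\<close>, so
  that the cut condition can be studied for flows between vertices, before the limit.\<close>

lemma graph_neighbourhood_GP:
  assumes \<xi>: "\<xi> \<in> bd" and U: "graph_neighbourhood G arev \<xi> U" and a: "vseq a \<xi>"
  obtains R N where "\<And>n p. N \<le> n \<Longrightarrow> p \<in> M \<Longrightarrow> R \<le> GP bpt (vpt (a n)) p \<Longrightarrow> p \<in> realization U arev"
proof -
  obtain N W where NW: "completion_open M pd W" "Inr \<xi> \<in> W" "W \<subseteq> N" "realization U arev = Inl -` N"
    using U unfolding graph_neighbourhood_def completion_openin by blast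
  then obtain R where R: "{a \<in> cpl. ereal R < ext bpt (Inr \<xi>) a} \<subseteq> W"
    using bpt unfolding completion_open_def by meson
  obtain n0 where n0: "\<And>i j. n0 \<le> i \<Longrightarrow> n0 \<le> j \<Longrightarrow> R + 1 + \<delta> \<le> GP bpt (vpt (a i)) (vpt (a j))"
    using vseq_GP[OF \<xi> a a bpt] by blast
  show thesis
  proof (rule that[of n0 "R + 1 + \<delta>"])
    fix n p assume n: "n0 \<le> n" and p: "p \<in> M" and GP: "R + 1 + \<delta> \<le> GP bpt (vpt (a n)) p"
    have "ereal R < ext bpt (Inr \<xi>) (Inl p)"
    proof (rule ext_greaterI[of "\<lambda>n. vpt (a n)" _ "\<lambda>_. p" _ n0 "R + 1"])
      fix i j :: nat assume i: "n0 \<le> i"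
      have "R + 1 + \<delta> - \<delta> \<le> GP bpt (vpt (a i)) p"
        by (rule GP_hyp[OF bpt _ _ p n0[OF i n] GP]) (use a vseqD vpt_in in auto)
      then show "R + 1 \<le> GP bpt (vpt (a i)) p" by simp
    qed (use a in \<open>auto simp: rep_Inr rep_Inl vseq_def\<close>)
    then have "Inl p \<in> W" using R p by (auto simp: Inl_cpl)
    then show "p \<in> realization U arev" using NW by auto
  qed
qed

end


text \<open>Every edge of the finite support enters once at its head and once, with the opposite
  sign, at its tail.\<close>

lemma sum_boundary_zero:
  fixes G :: "('v, 'e) pre_digraph" and g :: "'e \<Rightarrow> real"
  assumes out: "\<And>v. v \<in> S \<Longrightarrow> finite (out_arcs G v)" and inn: "\<And>v. v \<in> S \<Longrightarrow> finite (in_arcs G v)"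
    and E: "finite E" "\<And>e. e \<in> arcs G \<Longrightarrow> g e \<noteq> 0 \<Longrightarrow> e \<in> E" "E \<subseteq> arcs G"
    and S: "finite S" "tail G ` E \<subseteq> S" "head G ` E \<subseteq> S"
  shows "(\<Sum>v\<in>S. edge_boundary G g v) = 0"
proof -
  have "(\<Sum>v\<in>S. \<Sum>e\<in>in_arcs G v. g e) = (\<Sum>v\<in>S. \<Sum>e | e \<in> E \<and> head G e = v. g e)"
    using E inn by (intro sum.cong refl sum.mono_neutral_right) auto
  also have "\<dots> = sum g E" by (rule sum.group[OF E(1) S(1,3)])
  finally have 1: "(\<Sum>v\<in>S. \<Sum>e\<in>in_arcs G v. g e) = sum g E" .
  have "(\<Sum>v\<in>S. \<Sum>e\<in>out_arcs G v. g e) = (\<Sum>v\<in>S. \<Sum>e | e \<in> E \<and> tail G e = v. g e)"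
    using E out by (intro sum.cong refl sum.mono_neutral_right) auto
  also have "\<dots> = sum g E" by (rule sum.group[OF E(1) S(1,2)])
  finally show ?thesis using 1 by (simp add: edge_boundary_def sum_subtractf)
qed

context hyperbolic_realization
begin

section \<open>Bounded area\<close>

lemma q_area:
  assumes bd: "\<xi> \<in> bd" "\<eta> \<in> bd" "\<zeta> \<in> bd" and F: "finite F" "F \<subseteq> arcs G"
  shows "(\<Sum>e\<in>F. \<bar>q \<xi> \<eta> e + q \<eta> \<zeta> e + q \<zeta> \<xi> e\<bar>) \<le> KAREA"
proof (rule LIMSEQ_le_const2)
  show "(\<lambda>n. \<Sum>e\<in>F. \<bar>qflow (vs \<xi> n) (vs \<eta> n) e + qflow (vs \<eta> n) (vs \<zeta> n) e + qflow (vs \<zeta> n) (vs \<xi> n) e\<bar>)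
    \<longlonglongrightarrow> (\<Sum>e\<in>F. \<bar>q \<xi> \<eta> e + q \<eta> \<zeta> e + q \<zeta> \<xi> e\<bar>)"
    using F by (intro tendsto_sum tendsto_rabs tendsto_add q_lim bd vs) auto
  show "\<exists>N. \<forall>n\<ge>N. (\<Sum>e\<in>F. \<bar>qflow (vs \<xi> n) (vs \<eta> n) e + qflow (vs \<eta> n) (vs \<zeta> n) e + qflow (vs \<zeta> n) (vs \<xi> n) e\<bar>) \<le> KAREA"
    using area_bound[OF vseqD[OF vs[OF bd(1)]] vseqD[OF vs[OF bd(2)]] vseqD[OF vs[OF bd(3)]] F] by blast
qed

lemma q_bounded_area: "bounded_area G arev q"
  unfolding bounded_area_def
proof (intro exI[of _ KAREA] ballI conjI)
  fix \<xi> \<eta> \<zeta> assume bd: "\<xi> \<in> bd" "\<eta> \<in> bd" "\<zeta> \<in> bd"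
  let ?f = "\<lambda>e. \<bar>q \<xi> \<eta> e + q \<eta> \<zeta> e + q \<zeta> \<xi> e\<bar>"
  have b: "sum ?f F \<le> KAREA" if "finite F" "F \<subseteq> arcs G" for F
    using q_area[OF bd that] .
  show "?f summable_on arcs G"
    by (rule nonneg_bdd_above_summable_on) (auto intro!: bdd_aboveI2[of _ _ KAREA] b)
  then show "infsum ?f (arcs G) \<le> KAREA"
    by (rule infsum_le_finite_sums) (rule b)
qed


section \<open>Equivariance\<close>

text \<open>The sequence chosen for the image need not be the image of the chosen one. As an element
  of an image of sets it is nevertheless the image of some sequence in \<open>\<xi>\<close>, which
  consists of vertices since interior points of edges are mapped to interior points.\<close>

lemma vs_boundary_action:
  assumes aut: "graph_automorphism G arev \<phi> \<psi>" and \<xi>: "\<xi> \<in> bd"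
  obtains a where "vseq a \<xi>" "vs (boundary_action \<phi> \<psi> \<xi>) = (\<lambda>n. \<phi> (a n))"
proof -
  let ?\<xi> = "boundary_action \<phi> \<psi> \<xi>"
  have \<phi>: "\<phi> v \<in> verts G" if "v \<in> verts G" for v
    using aut that by (auto simp: graph_automorphism_def bij_betw_def)
  have "vseq (\<lambda>n. \<phi> (vs \<xi> n)) ?\<xi>"
    unfolding vseq_def
  proof (intro conjI allI)
    show "\<phi> (vs \<xi> n) \<in> verts G" for n using vs[OF \<xi>] by (simp add: vseq_def \<phi>)
    have "(\<lambda>n. vpt (\<phi> (vs \<xi> n))) = point_action \<phi> \<psi> \<circ> (\<lambda>n. vpt (vs \<xi> n))"
      by (simp add: fun_eq_iff point_action_def)
    then show "(\<lambda>n. vpt (\<phi> (vs \<xi> n))) \<in> ?\<xi>"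
      using vs[OF \<xi>] by (simp add: boundary_action_def vseq_def)
  qed
  then have v: "vseq (vs ?\<xi>) ?\<xi>" unfolding vs_def[of ?\<xi>] by (rule someI[of "\<lambda>a. vseq a ?\<xi>"])
  then obtain x where x: "x \<in> \<xi>" "(\<lambda>n. vpt (vs ?\<xi> n)) = point_action \<phi> \<psi> \<circ> x"
    by (auto simp: vseq_def boundary_action_def)
  have ex: "\<exists>u. u \<in> verts G \<and> x n = vpt u \<and> vs ?\<xi> n = \<phi> u" for n
  proof -
    have xM: "x n \<in> M" using bdD(2)[OF \<xi> x(1)] by auto
    have eq: "point_action \<phi> \<psi> (x n) = vpt (vs ?\<xi> n)" using fun_cong[OF x(2), of n] by simp
    show ?thesis using xM
    proof (cases rule: realization_cases)
      case (1 u)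
      then show ?thesis using eq by (auto simp: point_action_def)
    next
      case (2 e t)
      then have "Inr (e, t) \<in> x n" by (simp add: edge_point_def)
      then have "Inr (\<psi> e, t) \<in> point_action \<phi> \<psi> (x n)" by (force simp: point_action_def)
      then show ?thesis using eq by simp
    qed
  qed
  define a where "a n = (SOME u. u \<in> verts G \<and> x n = vpt u \<and> vs ?\<xi> n = \<phi> u)" for n
  have a: "a n \<in> verts G" "x n = vpt (a n)" "vs ?\<xi> n = \<phi> (a n)" for n
    using someI_ex[OF ex[of n]] by (simp_all add: a_def)
  have "vseq a \<xi>" using x(1) a(1,2) unfolding vseq_def by (simp flip: a(2))
  moreover have "vs ?\<xi> = (\<lambda>n. \<phi> (a n))" using a(3) by (rule ext)
  ultimately show thesis by (rule that)
qed

lemma qflow_automorphism: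
  assumes aut: "graph_automorphism G arev \<phi> \<psi>" and "a \<in> verts G" "b \<in> verts G" "e \<in> arcs G"
  shows "qflow (\<phi> a) (\<phi> b) (\<psi> e) = qflow a b e"
  using vflow_automorphism[OF aut dst_automorphism[OF aut]] assms(2-4) by (simp add: qflow_def)

lemma q_equivariant: "automorphism_equivariant G arev q"
  unfolding automorphism_equivariant_def
proof (intro allI impI ballI)
  fix \<phi> \<psi> \<xi> \<eta> assume aut: "graph_automorphism G arev \<phi> \<psi>" and bd: "\<xi> \<in> bd" "\<eta> \<in> bd"
  have bij: "bij_betw \<psi> (arcs G) (arcs G)" using aut by (simp add: graph_automorphism_def)
  obtain a where a: "vseq a \<xi>" "vs (boundary_action \<phi> \<psi> \<xi>) = (\<lambda>n. \<phi> (a n))"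
    using vs_boundary_action[OF aut bd(1)] by blast
  obtain b where b: "vseq b \<eta>" "vs (boundary_action \<phi> \<psi> \<eta>) = (\<lambda>n. \<phi> (b n))"
    using vs_boundary_action[OF aut bd(2)] by blast
  have eq: "q (boundary_action \<phi> \<psi> \<xi>) (boundary_action \<phi> \<psi> \<eta>) (\<psi> e) = q \<xi> \<eta> e" if e: "e \<in> arcs G" for e
  proof -
    have "\<psi> e \<in> arcs G" using bij e by (auto simp: bij_betw_def)
    then have "q (boundary_action \<phi> \<psi> \<xi>) (boundary_action \<phi> \<psi> \<eta>) (\<psi> e) =
        lim (\<lambda>n. qflow (\<phi> (a n)) (\<phi> (b n)) (\<psi> e))" by (simp add: q_def a(2) b(2))
    also have "\<dots> = lim (\<lambda>n. qflow (a n) (b n) e)"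
      using qflow_automorphism[OF aut vseqD[OF a(1)] vseqD[OF b(1)] e] by simp
    also have "\<dots> = q \<xi> \<eta> e" by (rule limI[OF q_lim[OF e bd a(1) b(1)]])
    finally show ?thesis .
  qed
  show "q (boundary_action \<phi> \<psi> \<xi>) (boundary_action \<phi> \<psi> \<eta>) = ell_infinity_action (arcs G) \<psi> (q \<xi> \<eta>)"
  proof
    fix e
    show "q (boundary_action \<phi> \<psi> \<xi>) (boundary_action \<phi> \<psi> \<eta>) e = ell_infinity_action (arcs G) \<psi> (q \<xi> \<eta>) e"
    proof (cases "e \<in> arcs G")
      case True
      have "inv_into (arcs G) \<psi> e \<in> arcs G" "\<psi> (inv_into (arcs G) \<psi> e) = e"
        using bij True by (auto simp: bij_betw_def inv_into_into f_inv_into_f)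
      then show ?thesis using eq[of "inv_into (arcs G) \<psi> e"] True by (simp add: ell_infinity_action_def)
    qed (simp add: q_outside ell_infinity_action_def)
  qed
qed


section \<open>Quasigeodesicity\<close>

lemma M4:
  assumes "x \<in> M" "y \<in> M" "z \<in> M" "w \<in> M"
  shows "pd x z + pd y w \<le> pd x y + pd z w + 2 * \<delta> \<or> pd x z + pd y w \<le> pd y z + pd x w + 2 * \<delta>"
  using hyp[OF assms(4,1,2,3)] GP_twice[of w x y] GP_twice[of w y z] GP_twice[of w x z] by linarith

text \<open>A single index \<open>n\<close> with nonzero flow suffices. The tail is then nearly on a
  geodesic between vertices within 1 of the points of the line at times \<open>- n\<close> and
  \<open>n\<close>; it is compared with the point of the line at the same distance from the former.
  The 4 collects the unit distances to the line.\<close>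

lemma q_support_geodesic:
  assumes bd: "\<xi> \<in> bd" "\<eta> \<in> bd" and line: "geodesic_line M pd \<xi> \<eta> \<gamma>"
    and e: "e \<in> arcs G" "q \<xi> \<eta> e \<noteq> 0"
  shows "\<exists>t. pd (vpt (tail G e)) (\<gamma> t) \<le> 90 * real De + 4 + 2 * \<delta>"
proof -
  have \<gamma>M: "\<gamma> t \<in> M" for t using line by (auto simp: geodesic_line_def)
  have \<gamma>: "pd (\<gamma> s) (\<gamma> t) = \<bar>s - t\<bar>" for s t using line by (simp add: geodesic_line_def)
  have ends: "(\<lambda>n. \<gamma> (- real n)) \<in> \<xi>" "(\<lambda>n. \<gamma> (real n)) \<in> \<eta>" using line by (auto simp: geodesic_line_def)
  obtain a where a: "vseq a \<xi>" "\<And>n. pd (\<gamma> (- real n)) (vpt (a n)) \<le> 1" using vseq_near[OF bd(1) ends(1)] by blast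
  obtain b where b: "vseq b \<eta>" "\<And>n. pd (\<gamma> (real n)) (vpt (b n)) \<le> 1" using vseq_near[OF bd(2) ends(2)] by blast
  have "\<exists>n. qflow (a n) (b n) e \<noteq> 0"
  proof (rule ccontr)
    assume "\<not> ?thesis"
    then have "(\<lambda>n. 0) \<longlonglongrightarrow> q \<xi> \<eta> e" using q_lim[OF e(1) bd a(1) b(1)] by simp
    then have "q \<xi> \<eta> e = 0" by (rule LIMSEQ_unique) (rule tendsto_const)
    then show False using e(2) by contradiction
  qed
  then obtain n where n: "qflow (a n) (b n) e \<noteq> 0" ..
  define r where "r = real n"
  let ?x = "tail G e" let ?p = "vpt (tail G e)"
  have v: "a n \<in> verts G" "b n \<in> verts G" "?x \<in> verts G" using a b vseqD e by auto
  note vM = vpt_in[OF v(1)] vpt_in[OF v(2)] vpt_in[OF v(3)]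
  have "gp ?x (a n) (b n) \<le> 90 * De" by (rule qflow_support[OF e(1) v(1,2) n])
  then have "real (gp ?x (a n) (b n)) \<le> 90 * real De" by linarith
  then have 1: "pd (vpt (a n)) ?p + pd (vpt (b n)) ?p \<le> pd (vpt (a n)) (vpt (b n)) + 90 * real De"
    using GP_vertices[OF v(3,1,2)] GP_twice[of ?p "vpt (a n)" "vpt (b n)"] by linarith
  define \<alpha> where "\<alpha> = pd ?p (\<gamma> (- r))"
  define \<beta> where "\<beta> = pd ?p (\<gamma> r)"
  have \<alpha>\<beta>: "\<alpha> + \<beta> \<le> 2 * r + 90 * real De + 4"
  proof -
    have "\<alpha> \<le> pd (vpt (a n)) ?p + 1"
      using pd_tri[OF vM(3,1) \<gamma>M[of "- r"]] a(2)[of n] pd_comm[of ?p "vpt (a n)"]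
        pd_comm[of "vpt (a n)" "\<gamma> (- r)"] by (simp add: \<alpha>_def r_def)
    moreover have "\<beta> \<le> pd (vpt (b n)) ?p + 1"
      using pd_tri[OF vM(3,2) \<gamma>M[of r]] b(2)[of n] pd_comm[of ?p "vpt (b n)"]
        pd_comm[of "vpt (b n)" "\<gamma> r"] by (simp add: \<beta>_def r_def)
    moreover have "pd (vpt (a n)) (vpt (b n)) \<le> 2 * r + 2"
      using pd_tri[OF vM(1) \<gamma>M vM(2), of "- r"] pd_tri[OF \<gamma>M[of "- r"] \<gamma>M[of r] vM(2)] \<gamma>[of "- r" r]
        a(2)[of n] b(2)[of n] pd_comm[of "vpt (a n)" "\<gamma> (- r)"] by (simp add: r_def)
    ultimately show ?thesis using 1 by linarith
  qed
  have r0: "0 \<le> r" and \<alpha>0: "0 \<le> \<alpha>" by (auto simp: r_def \<alpha>_def pd_nonneg)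
  show ?thesis
  proof (cases "\<alpha> \<le> 2 * r")
    case True
    have "pd (\<gamma> (\<alpha> - r)) (\<gamma> r) = 2 * r - \<alpha>" "pd (\<gamma> (- r)) (\<gamma> (\<alpha> - r)) = \<alpha>" "pd (\<gamma> (- r)) (\<gamma> r) = 2 * r"
      using True r0 \<alpha>0 by (simp_all add: \<gamma>)
    then have "pd ?p (\<gamma> (\<alpha> - r)) \<le> 90 * real De + 4 + 2 * \<delta>"
      using M4[OF vM(3) \<gamma>M[of "- r"] \<gamma>M[of "\<alpha> - r"] \<gamma>M[of r]] \<alpha>\<beta> \<alpha>_def \<beta>_def by linarith
    then show ?thesis ..
  next
    case False
    then have "pd ?p (\<gamma> r) \<le> 90 * real De + 4 + 2 * \<delta>" using \<alpha>\<beta> \<beta>_def delta_nonneg by linarith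
    then show ?thesis ..
  qed
qed

lemma q_quasigeodesic: "quasigeodesic G arev q"
  unfolding quasigeodesic_def
\<comment> \<open>Two further units lead from a point of the closure to a supporting edge and from
  there to its tail.\<close>
proof (rule exI[of _ "90 * real De + 6 + 2 * \<delta>"], intro ballI allI impI)
  interpret Ms: Metric_space M pd by (rule metric_space)
  fix \<xi> \<eta> \<gamma> x assume bd: "\<xi> \<in> bd" "\<eta> \<in> bd" and line: "geodesic_line M pd \<xi> \<eta> \<gamma>"
    and x: "x \<in> edge_support G arev (q \<xi> \<eta>)"
  have xM: "x \<in> M" and near: "\<exists>y\<in>\<Union>e\<in>{e \<in> arcs G. q \<xi> \<eta> e \<noteq> 0}. edge_segment G arev e. y \<in> Ms.mball x 1"
    using x unfolding edge_support_def Ms.metric_closure_of by auto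
  then obtain e y where e: "e \<in> arcs G" "q \<xi> \<eta> e \<noteq> 0" and y: "y \<in> edge_segment G arev e" "y \<in> Ms.mball x 1"
    by blast
  obtain s where s: "s \<in> {0..1}" "y = ept e s" using y(1) by (auto simp: edge_segment_def)
  have "pd y (vpt (tail G e)) \<le> 1" using pd_ept[OF e(1) s(1), of 0] s by (simp add: ept_0)
  moreover obtain t where t: "pd (vpt (tail G e)) (\<gamma> t) \<le> 90 * real De + 4 + 2 * \<delta>"
    using q_support_geodesic[OF bd line e] by blast
  moreover have "\<gamma> t \<in> M" using line by (auto simp: geodesic_line_def)
  moreover have "vpt (tail G e) \<in> M" using e by (intro vpt_in) auto
  ultimately have "pd x (\<gamma> t) \<le> 90 * real De + 6 + 2 * \<delta>"
    using pd_tri[of x y "\<gamma> t"] pd_tri[of y "vpt (tail G e)" "\<gamma> t"] y(2) xM by auto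
  then show "\<exists>t. pd x (\<gamma> t) \<le> 90 * real De + 6 + 2 * \<delta>" ..
qed


section \<open>Continuity\<close>

lemma ext_vseq:
  assumes \<xi>: "\<xi> \<in> bd" "\<xi>' \<in> bd" and R: "ereal (R + 2) < ext bpt (Inr \<xi>) (Inr \<xi>')"
  obtains a a' N where "vseq a \<xi>" "vseq a' \<xi>'" "\<And>n. N \<le> n \<Longrightarrow> R \<le> GP bpt (vpt (a n)) (vpt (a' n))"
proof -
  obtain x y N where x: "x \<in> \<xi>" and y: "y \<in> \<xi>'"
    and N: "\<And>i j. N \<le> i \<Longrightarrow> N \<le> j \<Longrightarrow> R + 2 < GP bpt (x i) (y j)"
    using ext_greaterE[OF R] by (metis rep_Inr)
  obtain a where a: "vseq a \<xi>" "\<And>n. pd (x n) (vpt (a n)) \<le> 1" using vseq_near[OF \<xi>(1) x] by blast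
  obtain a' where a': "vseq a' \<xi>'" "\<And>n. pd (y n) (vpt (a' n)) \<le> 1" using vseq_near[OF \<xi>(2) y] by blast
  show thesis
  proof (rule that[OF a(1) a'(1)])
    fix n assume n: "N \<le> n"
    have xM: "x n \<in> M" "y n \<in> M" using bdD(2)[OF \<xi>(1) x] bdD(2)[OF \<xi>(2) y] by auto
    have vM: "vpt (a n) \<in> M" "vpt (a' n) \<in> M" using a a' vseqD vpt_in by auto
    show "R \<le> GP bpt (vpt (a n)) (vpt (a' n))"
      using N[OF n n] GP_move[OF bpt xM vM(1)] GP_move2[OF bpt vM(1) xM(2) vM(2)] a(2)[of n] a'(2)[of n]
      by linarith
  qed
qed

lemma q_locally_close:
  assumes bd: "\<xi> \<in> bd" "\<eta> \<in> bd" and F: "finite F" "F \<subseteq> arcs G" and s: "0 < s"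
  obtains A B where "openin btop A" "\<xi> \<in> A" "openin btop B" "\<eta> \<in> B"
    "\<And>\<xi>' \<eta>' e. \<xi>' \<in> A \<Longrightarrow> \<eta>' \<in> B \<Longrightarrow> e \<in> F \<Longrightarrow> \<bar>q \<xi> \<eta> e - q \<xi>' \<eta>' e\<bar> \<le> s"
proof -
  obtain C where C: "\<And>r. C \<le> r \<Longrightarrow> KF * exp (- th * (2 * r)) < s / 2" using KF_small[of "s / 2"] s by auto
  \<comment> \<open>Changing the base point of a Gromov product costs at most the distance moved;
    \<open>m\<close> bounds it for the tails of all edges of \<open>F\<close>.\<close>
  define m where "m = (\<Sum>e\<in>F. pd bpt (vpt (tail G e)))"
  have m: "pd bpt (vpt (tail G e)) \<le> m" if "e \<in> F" for e
    unfolding m_def using that F pd_nonneg by (intro member_le_sum) auto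
  obtain A where A: "openin btop A" "\<xi> \<in> A"
    "\<And>\<zeta>. \<zeta> \<in> A \<Longrightarrow> \<zeta> \<in> bd \<and> ereal (C + m + 2) < ext bpt (Inr \<xi>) (Inr \<zeta>)"
    using boundary_neighbourhood[OF bd(1), of "C + m + 2"] by metis
  obtain B where B: "openin btop B" "\<eta> \<in> B"
    "\<And>\<zeta>. \<zeta> \<in> B \<Longrightarrow> \<zeta> \<in> bd \<and> ereal (C + m + 2) < ext bpt (Inr \<eta>) (Inr \<zeta>)"
    using boundary_neighbourhood[OF bd(2), of "C + m + 2"] by metis
  show thesis
  proof (rule that[OF A(1,2) B(1,2)])
    fix \<xi>' \<eta>' e assume in_A: "\<xi>' \<in> A" and in_B: "\<eta>' \<in> B" and eF: "e \<in> F"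
    have bd': "\<xi>' \<in> bd" "\<eta>' \<in> bd" using A(3)[OF in_A] B(3)[OF in_B] by auto
    have e: "e \<in> arcs G" using eF F by auto
    have xM: "vpt (tail G e) \<in> M" using e by (intro vpt_in) auto
    obtain a a' N where a: "vseq a \<xi>" "vseq a' \<xi>'" "\<And>n. N \<le> n \<Longrightarrow> C + m \<le> GP bpt (vpt (a n)) (vpt (a' n))"
      using ext_vseq[OF bd(1) bd'(1)] A(3)[OF in_A] by metis
    obtain b b' N' where b: "vseq b \<eta>" "vseq b' \<eta>'" "\<And>n. N' \<le> n \<Longrightarrow> C + m \<le> GP bpt (vpt (b n)) (vpt (b' n))"
      using ext_vseq[OF bd(2) bd'(2)] B(3)[OF in_B] by metis
    have shift: "C \<le> GP (vpt (tail G e)) (vpt u) (vpt u')"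
      if "u \<in> verts G" "u' \<in> verts G" "C + m \<le> GP bpt (vpt u) (vpt u')" for u u'
      using GP_base[OF bpt vpt_in[OF that(1)] vpt_in[OF that(2)] xM] that(3) m[OF eF] by linarith
    have "\<bar>q \<xi> \<eta> e - q \<xi>' \<eta>' e\<bar> \<le> 2 * (KF * exp (- th * (2 * C)))"
    proof (rule q_near[OF e bd bd' a(1) b(1) a(2) b(2), of "max N N'"])
      fix n assume n: "max N N' \<le> n"
      show "C \<le> GP (vpt (tail G e)) (vpt (a n)) (vpt (a' n))"
        using n by (intro shift a(3) vseqD[OF a(1)] vseqD[OF a(2)]) auto
      show "C \<le> GP (vpt (tail G e)) (vpt (b n)) (vpt (b' n))"
        using n by (intro shift b(3) vseqD[OF b(1)] vseqD[OF b(2)]) auto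
    qed
    then show "\<bar>q \<xi> \<eta> e - q \<xi>' \<eta>' e\<bar> \<le> s" using C[of C] by simp
  qed
qed

lemma q_ell_infinity: "\<xi> \<in> bd \<Longrightarrow> \<eta> \<in> bd \<Longrightarrow> q \<xi> \<eta> \<in> ell_infinity (arcs G)"
  unfolding ell_infinity_def using q_bound by (auto simp: q_outside intro!: boundedI[of _ K0])

text \<open>On \<open>F\<close> the smallness of \<open>D\<close> is used, off \<open>F\<close> only
  its boundedness together with the small tail of \<open>h\<close>.\<close>

lemma abs_infsum_le:
  fixes D h :: "'e \<Rightarrow> real"
  assumes h: "(\<lambda>e. \<bar>h e\<bar>) summable_on E" and F: "finite F" "F \<subseteq> E"
    and tail: "infsum (\<lambda>e. \<bar>h e\<bar>) E \<le> (\<Sum>e\<in>F. \<bar>h e\<bar>) + t"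
    and near: "\<And>e. e \<in> F \<Longrightarrow> \<bar>D e\<bar> \<le> s" and bound: "\<And>e. e \<in> E \<Longrightarrow> \<bar>D e\<bar> \<le> K" and K: "0 \<le> K" "0 \<le> s"
  shows "(\<lambda>e. h e * D e) summable_on E" "\<bar>infsum (\<lambda>e. h e * D e) E\<bar> \<le> s * (\<Sum>e\<in>F. \<bar>h e\<bar>) + K * t"
proof -
  have "(\<lambda>e. \<bar>h e * D e\<bar>) summable_on E"
  proof (rule summable_on_comparison_test[OF summable_on_cmult_right[OF h, of K]])
    show "\<bar>h e * D e\<bar> \<le> K * \<bar>h e\<bar>" if "e \<in> E" for e
      using mult_left_mono[OF bound[OF that], of "\<bar>h e\<bar>"] by (simp add: abs_mult mult.commute)
  qed auto
  then have abs: "(\<lambda>e. norm (h e * D e)) summable_on E" by simp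
  then show sm: "(\<lambda>e. h e * D e) summable_on E" by (rule abs_summable_summable)
  have "\<bar>infsum (\<lambda>e. h e * D e) E\<bar> \<le> infsum (\<lambda>e. \<bar>h e * D e\<bar>) E"
    using norm_infsum_bound[OF abs] by simp
  also have "\<dots> \<le> s * (\<Sum>e\<in>F. \<bar>h e\<bar>) + K * t"
  proof (rule infsum_le_finite_sums)
    show "(\<lambda>e. \<bar>h e * D e\<bar>) summable_on E" by fact
    fix F' assume F': "finite F'" "F' \<subseteq> E"
    have "(\<Sum>e\<in>F'. \<bar>h e * D e\<bar>) \<le> (\<Sum>e\<in>F \<union> (F' - F). \<bar>h e * D e\<bar>)"
      using F F' by (intro sum_mono2) auto
    also have "\<dots> = (\<Sum>e\<in>F. \<bar>h e * D e\<bar>) + (\<Sum>e\<in>F' - F. \<bar>h e * D e\<bar>)"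
      using F F' by (intro sum.union_disjoint) auto
    also have "(\<Sum>e\<in>F. \<bar>h e * D e\<bar>) \<le> (\<Sum>e\<in>F. s * \<bar>h e\<bar>)"
      using near by (intro sum_mono) (auto simp: abs_mult mult.commute[of s] intro!: mult_left_mono)
    also have "(\<Sum>e\<in>F' - F. \<bar>h e * D e\<bar>) \<le> (\<Sum>e\<in>F' - F. K * \<bar>h e\<bar>)"
      using bound F' by (intro sum_mono) (auto simp: abs_mult mult.commute[of K] intro!: mult_left_mono)
    also have "(\<Sum>e\<in>F' - F. K * \<bar>h e\<bar>) \<le> K * t"
    proof -
      have "(\<Sum>e\<in>F \<union> (F' - F). \<bar>h e\<bar>) \<le> infsum (\<lambda>e. \<bar>h e\<bar>) E"
        using F F' by (intro finite_sum_le_infsum[OF h]) auto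
      moreover have "(\<Sum>e\<in>F \<union> (F' - F). \<bar>h e\<bar>) = (\<Sum>e\<in>F. \<bar>h e\<bar>) + (\<Sum>e\<in>F' - F. \<bar>h e\<bar>)"
        using F F' by (intro sum.union_disjoint) auto
      ultimately have "(\<Sum>e\<in>F' - F. \<bar>h e\<bar>) \<le> t" using tail by linarith
      then show ?thesis using K by (simp add: sum_distrib_left[symmetric] mult_left_mono)
    qed
    finally show "(\<Sum>e\<in>F'. \<bar>h e * D e\<bar>) \<le> s * (\<Sum>e\<in>F. \<bar>h e\<bar>) + K * t"
      by (simp add: sum_distrib_left)
  qed
  finally show "\<bar>infsum (\<lambda>e. h e * D e) E\<bar> \<le> s * (\<Sum>e\<in>F. \<bar>h e\<bar>) + K * t" .
qed

abbreviation (input) "pair h f \<equiv> \<Sum>\<^sub>\<infinity>e\<in>arcs G. h e * f e"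

lemma q_pairing_continuous:
  assumes h: "h \<in> ell_one (arcs G)" and bd: "\<xi> \<in> bd" "\<eta> \<in> bd" and eps: "0 < \<epsilon>"
  obtains A B where "openin btop A" "\<xi> \<in> A" "openin btop B" "\<eta> \<in> B"
    "\<And>\<xi>' \<eta>'. \<xi>' \<in> A \<Longrightarrow> \<eta>' \<in> B \<Longrightarrow>
      \<bar>pair h (q \<xi> \<eta>) - pair h (q \<xi>' \<eta>')\<bar> < \<epsilon>"
proof -
  have sh: "(\<lambda>e. \<bar>h e\<bar>) summable_on arcs G" using h by (simp add: ell_one_def)
  \<comment> \<open>The part off \<open>F\<close> and the part on \<open>F\<close> are each allowed
    \<open>\<epsilon> / 4\<close>; the former involves \<open>2 * K0\<close> as a bound for the
    difference of two values of \<open>q\<close>.\<close>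
  define t where "t = \<epsilon> / (8 * K0)"
  have t: "0 < t" "2 * K0 * t = \<epsilon> / 4" using eps K0_pos by (auto simp: t_def)
  obtain F where F: "finite F" "F \<subseteq> arcs G"
    and "dist (\<Sum>e\<in>F. \<bar>h e\<bar>) (infsum (\<lambda>e. \<bar>h e\<bar>) (arcs G)) \<le> t"
    using has_sum_finite_approximation[OF has_sum_infsum[OF sh] t(1)] by blast
  then have tail: "infsum (\<lambda>e. \<bar>h e\<bar>) (arcs G) \<le> (\<Sum>e\<in>F. \<bar>h e\<bar>) + t"
    unfolding dist_real_def by linarith
  define H where "H = (\<Sum>e\<in>F. \<bar>h e\<bar>)"
  have H: "0 \<le> H" by (auto simp: H_def intro: sum_nonneg)
  define s where "s = \<epsilon> / (4 * (H + 1))"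
  have s: "0 < s" "s * (H + 1) = \<epsilon> / 4" using eps H by (auto simp: s_def field_simps)
  have sH: "s * H + 2 * K0 * t < \<epsilon>"
    using s t(2) eps by (simp add: distrib_left)
  obtain A B where AB: "openin btop A" "\<xi> \<in> A" "openin btop B" "\<eta> \<in> B"
    "\<And>\<xi>' \<eta>' e. \<xi>' \<in> A \<Longrightarrow> \<eta>' \<in> B \<Longrightarrow> e \<in> F \<Longrightarrow> \<bar>q \<xi> \<eta> e - q \<xi>' \<eta>' e\<bar> \<le> s"
    using q_locally_close[OF bd F s(1)] by metis
  show thesis
  proof (rule that[OF AB(1-4)])
    fix \<xi>' \<eta>' assume in_AB: "\<xi>' \<in> A" "\<eta>' \<in> B"
    have bd': "\<xi>' \<in> bd" "\<eta>' \<in> bd"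
      using in_AB AB(1,3) btop_subset openin_subset by blast+
    have sq: "(\<lambda>e. h e * q \<zeta> \<theta> e) summable_on arcs G" if "\<zeta> \<in> bd" "\<theta> \<in> bd" for \<zeta> \<theta>
      by (rule abs_infsum_le(1)[OF sh, of "{}" "infsum (\<lambda>e. \<bar>h e\<bar>) (arcs G)" _ 0 K0])
        (use q_bound[OF that] K0_pos in auto)
    have "\<bar>infsum (\<lambda>e. h e * (q \<xi> \<eta> e - q \<xi>' \<eta>' e)) (arcs G)\<bar> \<le> s * (\<Sum>e\<in>F. \<bar>h e\<bar>) + 2 * K0 * t"
    proof (rule abs_infsum_le(2)[OF sh F tail])
      show "\<bar>q \<xi> \<eta> e - q \<xi>' \<eta>' e\<bar> \<le> 2 * K0" for e
        using q_bound[OF bd, of e] q_bound[OF bd', of e] by linarith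
    qed (use AB(5)[OF in_AB] s K0_pos in auto)
    moreover have "infsum (\<lambda>e. h e * (q \<xi> \<eta> e - q \<xi>' \<eta>' e)) (arcs G) =
      pair h (q \<xi> \<eta>) - pair h (q \<xi>' \<eta>')"
    proof -
      have "(\<lambda>e. - (h e * q \<xi>' \<eta>' e)) summable_on arcs G" using sq[OF bd'] by (simp add: summable_on_uminus)
      from infsum_add[OF sq[OF bd] this] show ?thesis
        by (simp add: right_diff_distrib infsum_uminus)
    qed
    ultimately show "\<bar>pair h (q \<xi> \<eta>) - pair h (q \<xi>' \<eta>')\<bar> < \<epsilon>"
      using sH by (simp add: H_def)
  qed
qed

lemma q_weak_star_continuous: "weak_star_continuous G arev q"
  unfolding weak_star_continuous_def Let_def weak_star_topology_def continuous_on_generated_topo_iff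
proof (intro conjI allI impI)
  let ?T = "prod_topology btop btop" and ?f = "\<lambda>(\<xi>, \<eta>). q \<xi> \<eta>"
  have sub: "p \<in> topspace ?T \<Longrightarrow> fst p \<in> bd \<and> snd p \<in> bd" for p
    using btop_subset by (auto simp: topspace_prod_topology)
  show "?f ` topspace ?T \<subseteq> \<Union> {{f \<in> ell_infinity (arcs G). pair h f \<in> W} |h W.
      h \<in> ell_one (arcs G) \<and> open W}"
    unfolding topology_generated_by_topspace[symmetric] weak_star_topology_def[symmetric]
      topspace_weak_star_topology
    using sub q_ell_infinity by fastforce
  fix U assume "U \<in> {{f \<in> ell_infinity (arcs G). pair h f \<in> W} |h W.
      h \<in> ell_one (arcs G) \<and> open W}"
  then obtain h W where U: "U = {f \<in> ell_infinity (arcs G). pair h f \<in> W}"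
    and h: "h \<in> ell_one (arcs G)" and W: "open W" by blast
  show "openin ?T (?f -` U \<inter> topspace ?T)"
    unfolding openin_subopen[of _ "?f -` U \<inter> topspace ?T"]
  proof
    fix p assume p: "p \<in> ?f -` U \<inter> topspace ?T"
    obtain \<xi> \<eta> where \<xi>\<eta>: "p = (\<xi>, \<eta>)" by (cases p)
    have bd: "\<xi> \<in> bd" "\<eta> \<in> bd" using sub[of p] p \<xi>\<eta> by auto
    have "pair h (q \<xi> \<eta>) \<in> W" using p \<xi>\<eta> U by auto
    then obtain \<epsilon> where \<epsilon>: "0 < \<epsilon>" "\<And>y. \<bar>y - pair h (q \<xi> \<eta>)\<bar> < \<epsilon> \<Longrightarrow> y \<in> W"
      using W unfolding open_dist dist_real_def by blast
    obtain A B where AB: "openin btop A" "\<xi> \<in> A" "openin btop B" "\<eta> \<in> B"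
      "\<And>\<xi>' \<eta>'. \<xi>' \<in> A \<Longrightarrow> \<eta>' \<in> B \<Longrightarrow>
        \<bar>pair h (q \<xi> \<eta>) - pair h (q \<xi>' \<eta>')\<bar> < \<epsilon>"
      by (rule q_pairing_continuous[OF h bd \<epsilon>(1)], rule that)
    have "A \<times> B \<subseteq> ?f -` U \<inter> topspace ?T"
    proof
      fix p' assume p': "p' \<in> A \<times> B"
      then obtain \<xi>' \<eta>' where eq: "p' = (\<xi>', \<eta>')" and in_AB: "\<xi>' \<in> A" "\<eta>' \<in> B" by auto
      have top: "p' \<in> topspace ?T"
        using in_AB AB(1,3) openin_subset eq by (fastforce simp: topspace_prod_topology)
      have "pair h (q \<xi>' \<eta>') \<in> W"
        using AB(5)[OF in_AB] by (intro \<epsilon>(2)) (simp add: abs_minus_commute)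
      then have "q \<xi>' \<eta>' \<in> U" using sub[OF top] eq q_ell_infinity U by auto
      then show "p' \<in> ?f -` U \<inter> topspace ?T" using top eq by simp
    qed
    moreover have "openin ?T (A \<times> B)" using AB(1,3) by (simp add: openin_prod_Times_iff)
    ultimately show "\<exists>Z. openin ?T Z \<and> p \<in> Z \<and> Z \<subseteq> ?f -` U \<inter> topspace ?T"
      using \<xi>\<eta> AB(2,4) by (intro exI[of _ "A \<times> B"]) auto
  qed
qed


section \<open>The cut condition\<close>

lemma vseq_far:
  assumes "\<xi> \<in> bd" "vseq a \<xi>"
  obtains N where "\<And>n. N \<le> n \<Longrightarrow> R < dst bv (a n)"
proof -
  obtain N where N: "\<And>i j. N \<le> i \<Longrightarrow> N \<le> j \<Longrightarrow> real R + 1 \<le> GP bpt (vpt (a i)) (vpt (a j))"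
    using vseq_GP[OF assms(1,2,2) bpt] by blast
  show thesis
  proof (rule that[of N])
    fix n assume "N \<le> n"
    then have "real R + 1 \<le> GP bpt (vpt (a n)) (vpt (a n))" by (intro N)
    moreover have "2 * GP bpt (vpt (a n)) (vpt (a n)) = 2 * real (dst bv (a n))"
      using GP_twice[of bpt "vpt (a n)" "vpt (a n)"] pd_self pd_vertices[OF vseqD[OF assms(2)] base]
        dst_sym[OF vseqD[OF assms(2)] base] by simp
    ultimately show "R < dst bv (a n)" by linarith
  qed
qed

lemma edge_boundary_lim:
  assumes bd: "\<xi> \<in> bd" "\<eta> \<in> bd" and a: "vseq a \<xi>" and b: "vseq b \<eta>" and v: "v \<in> verts G"
  shows "(\<lambda>n. edge_boundary G (edge_restrict U (qflow (a n) (b n))) v)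
    \<longlonglongrightarrow> edge_boundary G (edge_restrict U (q \<xi> \<eta>)) v"
  unfolding edge_boundary_def edge_restrict_def
  by (intro tendsto_diff tendsto_sum) (auto intro!: q_lim[OF _ bd a b])

text \<open>The boundary at a vertex is a finite sum and passes to the limit; along the sequences it
  is eventually 0 because both ends leave every ball.\<close>

lemma q_boundary:
  assumes bd: "\<xi> \<in> bd" "\<eta> \<in> bd" and v: "v \<in> verts G"
  shows "edge_boundary G (q \<xi> \<eta>) v = 0"
proof -
  have restrict: "edge_boundary G (edge_restrict G f) v = edge_boundary G f v" for f
    unfolding edge_boundary_def edge_restrict_def by (intro arg_cong2[where f = "(-)"] sum.cong) auto
  have "(\<lambda>n. edge_boundary G (qflow (vs \<xi> n) (vs \<eta> n)) v) \<longlonglongrightarrow> edge_boundary G (q \<xi> \<eta>) v"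
    using edge_boundary_lim[OF bd vs[OF bd(1)] vs[OF bd(2)] v, of G] unfolding restrict .
  moreover have "(\<lambda>n. edge_boundary G (qflow (vs \<xi> n) (vs \<eta> n)) v) \<longlonglongrightarrow> 0"
  proof (rule tendsto_eventually)
    obtain N where N: "\<And>n. N \<le> n \<Longrightarrow> dst bv v < dst bv (vs \<xi> n)" using vseq_far[OF bd(1) vs[OF bd(1)]] by blast
    obtain N' where N': "\<And>n. N' \<le> n \<Longrightarrow> dst bv v < dst bv (vs \<eta> n)" using vseq_far[OF bd(2) vs[OF bd(2)]] by blast
    have "edge_boundary G (qflow (vs \<xi> n) (vs \<eta> n)) v = 0" if "max N N' \<le> n" for n
      using qflow_boundary[OF v vseqD[OF vs[OF bd(1)]] vseqD[OF vs[OF bd(2)]], of n n] N[of n] N'[of n] that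
      by auto
    then show "\<forall>\<^sub>F n in sequentially. edge_boundary G (qflow (vs \<xi> n) (vs \<eta> n)) v = 0"
      unfolding eventually_sequentially by blast
  qed
  ultimately show ?thesis using LIMSEQ_unique by blast
qed

text \<open>A realization knows only points. The midpoint determines its edge up to reversal, and
  \<open>U\<close> is closed under \<open>arev\<close>; an endpoint would say nothing about the
  edge.\<close>

lemma neighbourhood_edge:
  assumes U: "graph_neighbourhood G arev \<xi> U" and e: "e \<in> arcs G" and p: "ept e (1/2) \<in> realization U arev"
  shows "e \<in> arcs U"
proof -
  have closed: "arev ` arcs U \<subseteq> arcs U" using U by (simp add: graph_neighbourhood_def)
  have half: "ept e (1/2) = {Inr (e, 1/2), Inr (arev e, 1/2)}" by (simp add: edge_point_def)
  obtain f t where f: "f \<in> arcs U" "ept e (1/2) = edge_point U arev f t"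
    using p unfolding realization_def edge_segment_def half by auto
  have "Inr (e, 1/2) \<in> ept e (1/2)" by (simp add: half)
  then have "Inr (e, 1/2) \<in> edge_point U arev f t" unfolding f(2) .
  then have "e = f \<or> e = arev f" by (auto simp: edge_point_def split: if_splits)
  then show ?thesis using f(1) closed by auto
qed

text \<open>For large \<open>n\<close> the restricted flow between \<open>a n\<close> and
  \<open>b n\<close> has total boundary 0 and boundary -1 at the source \<open>a n\<close>. All else
  happens in a fixed ball \<open>B\<close>, where the boundary must add up to 1, and a sum over a
  fixed finite set passes to the limit.\<close>

lemma cut_sum:
  assumes bd: "\<xi> \<in> bd" "\<eta> \<in> bd" and U: "graph_neighbourhood G arev \<xi> U" and V: "graph_neighbourhood G arev \<eta> V"
    and disj: "realization U arev \<inter> realization V arev = {}"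
  defines "f \<equiv> edge_boundary G (edge_restrict U (q \<xi> \<eta>))"
  shows "finite {v \<in> verts G. f v \<noteq> 0} \<and> (\<Sum>v | v \<in> verts G \<and> f v \<noteq> 0. f v) = 1"
proof -
  define a where "a = vs \<xi>"
  define b where "b = vs \<eta>"
  have a: "vseq a \<xi>" and b: "vseq b \<eta>" using vs bd by (auto simp: a_def b_def)
  note aV = vseqD[OF a] and bV = vseqD[OF b]
  obtain R1 N1 where 1: "\<And>n p. N1 \<le> n \<Longrightarrow> p \<in> M \<Longrightarrow> R1 \<le> GP bpt (vpt (a n)) p \<Longrightarrow> p \<in> realization U arev"
    using graph_neighbourhood_GP[OF bd(1) U a] by metis
  obtain R2 N2 where 2: "\<And>n p. N2 \<le> n \<Longrightarrow> p \<in> M \<Longrightarrow> R2 \<le> GP bpt (vpt (b n)) p \<Longrightarrow> p \<in> realization V arev"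
    using graph_neighbourhood_GP[OF bd(2) V b] by metis
  define R where "R = max (max R1 R2) 0"
  define N where "N = max N1 N2"
  \<comment> \<open>At the tail of an edge that carries flow, the products with \<open>a n\<close>
    and \<open>b n\<close> add up to at least its distance from the base point minus
    \<open>45 * De\<close>. Beyond \<open>m\<close> one of them is thus at least
    \<open>R + 2\<close>, which leaves one unit for passing to the other end and one for passing to
    a midpoint.\<close>
  obtain m where m: "2 * R + 4 + 45 * real De \<le> real m" using real_arch_simple by blast
  define fn where "fn n = edge_boundary G (edge_restrict U (qflow (a n) (b n)))" for n
  define near where "near c v \<longleftrightarrow> R + 1 \<le> GP bpt (vpt c) (vpt v)" for c v
  have mid: "R \<le> GP bpt (vpt c) (ept e (1/2))"
    if "e \<in> arcs G" "v \<in> verts G" "c \<in> verts G" "near c v" "v = tail G e \<or> v = head G e" for c v e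
  proof -
    have "pd (vpt v) (ept e (1/2)) \<le> 1"
      using that(1,5) pd_ept[OF that(1), of 0 "1/2"] pd_ept[OF that(1), of 1 "1/2"] by (auto simp: ept_0 ept_1)
    then show ?thesis
      using GP_move2[OF bpt vpt_in[OF that(3)] vpt_in[OF that(2)] ept_in[OF that(1)], of "1/2"] that(4)
      by (simp add: near_def)
  qed
  have inU: "e \<in> arcs U" if "N \<le> n" "e \<in> arcs G" "v \<in> verts G" "near (a n) v" "v = tail G e \<or> v = head G e" for n e v
    using mid[OF that(2,3) aV that(4,5)] 1[OF _ ept_in[OF that(2)], of n "1/2"] that(1,2)
    by (intro neighbourhood_edge[OF U]) (auto simp: R_def N_def)
  have notU: "e \<notin> arcs U" if "N \<le> n" "e \<in> arcs G" "v \<in> verts G" "near (b n) v" "v = tail G e \<or> v = head G e" for n e v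
  proof
    assume e: "e \<in> arcs U"
    have "edge_point U arev e (1/2) \<in> edge_segment U arev e"
      unfolding edge_segment_def by (rule imageI) simp
    then have "edge_point U arev e (1/2) \<in> realization U arev"
      unfolding realization_def using e by blast
    moreover have "edge_point U arev e (1/2) = ept e (1/2)" by (simp add: edge_point_def)
    moreover have "ept e (1/2) \<in> realization V arev"
      using mid[OF that(2,3) bV that(4,5)] that(1,2) by (intro 2[OF _ ept_in]) (auto simp: R_def N_def)
    ultimately show False using disj by auto
  qed
  have not_both: "\<not> (near (a n) v \<and> near (b n) v)" if "N \<le> n" "v \<in> verts G" for n v
  proof
    assume *: "near (a n) v \<and> near (b n) v"
    have "vpt v \<in> realization U arev"
      using * that(1) by (intro 1[OF _ vpt_in[OF that(2)]]) (auto simp: near_def R_def N_def)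
    moreover have "vpt v \<in> realization V arev"
      using * that(1) by (intro 2[OF _ vpt_in[OF that(2)]]) (auto simp: near_def R_def N_def)
    ultimately show False using disj by blast
  qed
  have near_self: "near c c" if "c \<in> verts G" "m < dst bv c" for c
  proof -
    have "2 * GP bpt (vpt c) (vpt c) = 2 * real (dst bv c)"
      using GP_twice[of bpt "vpt c" "vpt c"] pd_self pd_vertices[OF that(1) base] dst_sym[OF that(1) base] by simp
    moreover have "real m \<le> real (dst bv c)" using that(2) by simp
    moreover have "0 \<le> R" by (simp add: R_def)
    ultimately show ?thesis using m unfolding near_def by linarith
  qed
  have edge_near: "near (a n) v \<or> near (b n) v"
    if "e \<in> arcs G" "v \<in> verts G" "v = tail G e \<or> v = head G e" "m < dst bv v" "qflow (a n) (b n) e \<noteq> 0" for n e v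
  proof -
    let ?x = "tail G e"
    have x: "?x \<in> verts G" using that(1) by simp
    note M3 = vpt_in[OF aV] vpt_in[OF bV] vpt_in[OF x] vpt_in[OF that(2)]
    have xv: "dst ?x v \<le> 1" using that(1,3) dst_arc dst_self by auto
    have "m \<le> dst bv ?x" using dst_tri[OF base x that(2)] xv that(4) by linarith
    then have mx: "real m \<le> pd (vpt ?x) bpt" using pd_vertices[OF x base] dst_sym[OF x base] by simp
    have "real (gp ?x (a n) (b n)) \<le> 90 * real De"
      using qflow_support[OF that(1) aV bV that(5)] by linarith
    then have "4 * R + 8 \<le> 2 * GP bpt (vpt (a n)) (vpt ?x) + 2 * GP bpt (vpt (b n)) (vpt ?x)"
      using GP_vertices[OF x aV bV, of n n] GP_twice[of "vpt ?x" "vpt (a n)" "vpt (b n)"]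
        GP_twice[of bpt "vpt (a n)" "vpt ?x"] GP_twice[of bpt "vpt (b n)" "vpt ?x"]
        pd_tri[OF M3(1) bpt M3(2), of n n] pd_comm[of bpt "vpt (b n)"] mx m by linarith
    then have "R + 2 \<le> GP bpt (vpt (a n)) (vpt ?x) \<or> R + 2 \<le> GP bpt (vpt (b n)) (vpt ?x)" by linarith
    moreover have "pd (vpt ?x) (vpt v) \<le> 1" using pd_vertices[OF x that(2)] xv by simp
    ultimately show ?thesis
      using GP_move2[OF bpt M3(1) M3(3,4), of n] GP_move2[OF bpt M3(2) M3(3,4), of n]
      unfolding near_def by linarith
  qed
  have bdry: "edge_boundary G g v = edge_boundary G h v"
    if "\<And>e. e \<in> arcs G \<Longrightarrow> v = tail G e \<or> v = head G e \<Longrightarrow> g e = h e" for g h v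
    unfolding edge_boundary_def using that by (intro arg_cong2[where f = "(-)"] sum.cong) auto
  have zero: "edge_boundary G (\<lambda>_. 0) v = 0" for v by (simp add: edge_boundary_def)
  have fnU: "fn n v = of_bool (v = b n) - of_bool (v = a n)" if "N \<le> n" "v \<in> verts G" "near (a n) v" for n v
  proof -
    have "fn n v = edge_boundary G (qflow (a n) (b n)) v"
      unfolding fn_def by (rule bdry) (use inU[OF that(1) _ that(2,3)] in \<open>auto simp: edge_restrict_def\<close>)
    then show ?thesis using qflow_boundary[OF that(2) aV bV] by simp
  qed
  \<comment> \<open>Close to \<open>a n\<close> all edges at \<open>v\<close> belong to
    \<open>U\<close>, so the boundary is that of the full flow; close to \<open>b n\<close> none do;
    elsewhere beyond \<open>m\<close> the edges carry no flow.\<close>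
  have fn0: "fn n v = 0" if n: "N \<le> n" and v: "v \<in> verts G" and far: "m < dst bv v" and va: "v \<noteq> a n" for n v
  proof -
    consider "near (a n) v" | "near (b n) v" | "\<not> near (a n) v" "\<not> near (b n) v" by blast
    then show ?thesis
    proof cases
      case 1
      have "v \<noteq> b n" using near_self[OF v far] not_both[OF n v] 1 by auto
      then show ?thesis using fnU[OF n v 1] va by simp
    next
      case 2
      have "fn n v = edge_boundary G (\<lambda>_. 0) v"
        unfolding fn_def by (rule bdry) (use notU[OF n _ v 2] in \<open>auto simp: edge_restrict_def\<close>)
      then show ?thesis by (simp add: zero)
    next
      case 3
      have "fn n v = edge_boundary G (\<lambda>_. 0) v"
        unfolding fn_def by (rule bdry) (use edge_near[OF _ v _ far] 3 in \<open>auto simp: edge_restrict_def\<close>)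
      then show ?thesis by (simp add: zero)
    qed
  qed
  have lim: "(\<lambda>n. fn n v) \<longlonglongrightarrow> f v" if "v \<in> verts G" for v
    unfolding fn_def f_def by (rule edge_boundary_lim[OF bd a b that])
  define B where "B = {v \<in> verts G. dst bv v \<le> m}"
  have finB: "finite B" unfolding B_def by (rule ball_finite[OF base])
  have f0: "f v = 0" if v: "v \<in> verts G" "v \<notin> B" for v
  proof -
    obtain N' where N': "\<And>n. N' \<le> n \<Longrightarrow> dst bv v < dst bv (a n)" using vseq_far[OF bd(1) a] by blast
    have "fn n v = 0" if "max N N' \<le> n" for n
      using N'[of n] that v by (intro fn0) (auto simp: B_def)
    then have "(\<lambda>n. fn n v) \<longlonglongrightarrow> 0"
      by (intro tendsto_eventually) (auto simp: eventually_sequentially intro!: exI[of _ "max N N'"])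
    then show ?thesis using lim[OF v(1)] LIMSEQ_unique by blast
  qed
  obtain N' where N': "\<And>n. N' \<le> n \<Longrightarrow> m < dst bv (a n)" using vseq_far[OF bd(1) a] by blast
  obtain N'' where N'': "\<And>n. N'' \<le> n \<Longrightarrow> m < dst bv (b n)" using vseq_far[OF bd(2) b] by blast
  have sum1: "(\<Sum>v\<in>B. fn n v) = 1" if n: "max N (max N' N'') \<le> n" for n
  proof -
    let ?E = "{e \<in> arcs G. edge_restrict U (qflow (a n) (b n)) e \<noteq> 0}"
    have "?E \<subseteq> (\<Union>x\<in>{x \<in> verts G. dst (a n) x \<le> dst (a n) (b n) + 90 * De}. out_arcs G x)"
    proof
      fix e assume e: "e \<in> ?E"
      then have eG: "e \<in> arcs G" and nz: "qflow (a n) (b n) e \<noteq> 0" by (auto simp: edge_restrict_def split: if_splits)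
      have "dst (a n) (tail G e) \<le> dst (a n) (b n) + 90 * De"
        using qflow_support[OF eG aV bV nz] gp_eq[OF tail_in_verts[OF eG] aV bV, of n n] by linarith
      then show "e \<in> (\<Union>x\<in>{x \<in> verts G. dst (a n) x \<le> dst (a n) (b n) + 90 * De}. out_arcs G x)"
        using eG by auto
    qed
    moreover have "finite (\<Union>x\<in>{x \<in> verts G. dst (a n) x \<le> dst (a n) (b n) + 90 * De}. out_arcs G x)"
      using ball_finite[OF aV] out_finite by (intro finite_UN_I) auto
    ultimately have finE: "finite ?E" by (rule finite_subset)
    define S where "S = insert (a n) B \<union> (tail G ` ?E \<union> head G ` ?E)"
    have S: "finite S" "S \<subseteq> verts G" using finE finB aV by (auto simp: S_def B_def)
    have "(\<Sum>v\<in>S. fn n v) = 0"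
      unfolding fn_def
      by (rule sum_boundary_zero[OF _ _ finE]) (use S out_finite in_finite in \<open>auto simp: S_def\<close>)
    moreover have "(\<Sum>v\<in>S. fn n v) = (\<Sum>v\<in>insert (a n) B. fn n v)"
    proof (rule sum.mono_neutral_right[OF S(1)])
      show "\<forall>v\<in>S - insert (a n) B. fn n v = 0"
        using S(2) n by (auto intro!: fn0 simp: B_def)
    qed (auto simp: S_def)
    moreover have "a n \<notin> B" using N'[of n] n by (auto simp: B_def)
    moreover have "fn n (a n) = - 1"
    proof -
      have self: "near (a n) (a n)" "near (b n) (b n)" using N'[of n] N''[of n] n aV bV by (auto intro: near_self)
      then have "a n \<noteq> b n" using not_both[OF _ aV, of n n] n by auto
      then show ?thesis using fnU[OF _ aV self(1)] n by simp
    qed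
    ultimately show ?thesis using finB by simp
  qed
  have "(\<lambda>n. \<Sum>v\<in>B. fn n v) \<longlonglongrightarrow> (\<Sum>v\<in>B. f v)"
    by (intro tendsto_sum lim) (auto simp: B_def)
  moreover have "(\<lambda>n. \<Sum>v\<in>B. fn n v) \<longlonglongrightarrow> 1"
    using sum1 by (intro tendsto_eventually) (auto simp: eventually_sequentially intro!: exI[of _ "max N (max N' N'')"])
  ultimately have "(\<Sum>v\<in>B. f v) = 1" using LIMSEQ_unique by blast
  moreover have sub: "{v \<in> verts G. f v \<noteq> 0} \<subseteq> B" using f0 by blast
  moreover have "(\<Sum>v | v \<in> verts G \<and> f v \<noteq> 0. f v) = (\<Sum>v\<in>B. f v)"
    using finB sub by (intro sum.mono_neutral_left) (auto simp: B_def)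
  ultimately show ?thesis using finite_subset[OF sub finB] by simp
qed

lemma q_ideal_bicombing: "ideal_bicombing G arev q"
  unfolding ideal_bicombing_def Let_def
proof (intro conjI ballI allI impI)
  fix \<xi> \<eta> assume bd: "\<xi> \<in> bd" "\<eta> \<in> bd"
  show "q \<xi> \<eta> \<in> ell_infinity (arcs G)" by (rule q_ell_infinity[OF bd])
  show "edge_boundary G (q \<xi> \<eta>) v = 0" if "v \<in> verts G" for v by (rule q_boundary[OF bd that])
  fix U V assume *: "\<xi> \<noteq> \<eta> \<and> graph_neighbourhood G arev \<xi> U \<and> graph_neighbourhood G arev \<eta> V \<and>
      realization U arev \<inter> realization V arev = {}"
  let ?f = "edge_boundary G (edge_restrict U (q \<xi> \<eta>))" and ?g = "edge_boundary G (edge_restrict V (q \<xi> \<eta>))"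
  have f: "finite {v \<in> verts G. ?f v \<noteq> 0} \<and> (\<Sum>v | v \<in> verts G \<and> ?f v \<noteq> 0. ?f v) = 1"
    by (rule cut_sum[OF bd]) (use * in auto)
  show "finite {v \<in> verts G. ?f v \<noteq> 0}" "(\<Sum>v | v \<in> verts G \<and> ?f v \<noteq> 0. ?f v) = 1" using f by auto
  \<comment> \<open>The claim at \<open>\<eta>\<close> is \<open>cut_sum\<close> with the ends
    exchanged, and antisymmetry of \<open>q\<close> turns the sum 1 into -1.\<close>
  let ?h = "edge_boundary G (edge_restrict V (q \<eta> \<xi>))"
  have h: "finite {v \<in> verts G. ?h v \<noteq> 0} \<and> (\<Sum>v | v \<in> verts G \<and> ?h v \<noteq> 0. ?h v) = 1"
    by (rule cut_sum[OF bd(2,1)]) (use * in auto)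
  have "edge_restrict V (q \<eta> \<xi>) = (\<lambda>e. - edge_restrict V (q \<xi> \<eta>) e)"
    using q_antisym[OF bd] by (auto simp: edge_restrict_def fun_eq_iff)
  then have gh: "?h = (\<lambda>v. - ?g v)"
    by (simp add: edge_boundary_def fun_eq_iff sum_negf)
  show "finite {v \<in> verts G. ?g v \<noteq> 0}" "(\<Sum>v | v \<in> verts G \<and> ?g v \<noteq> 0. ?g v) = - 1"
    using h unfolding gh by (simp_all add: sum_negf)
qed

end

theorem theorem2:
  fixes G :: "('v, 'e) pre_digraph" and arev :: "'e \<Rightarrow> 'e"
  assumes "bidirected_digraph G arev"
    and "Digraph_Component.connected G"
    and "bounded_valency G"
    and "hyperbolic_graph G arev"
  shows "\<exists>q. ideal_bicombing G arev q \<and> weak_star_continuous G arev q \<and>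
    quasigeodesic G arev q \<and> bounded_area G arev q \<and> automorphism_equivariant G arev q"
proof -
  interpret C: connected_digraph G arev
    using assms(1,2) by (intro connected_digraph.intro connected_digraph_axioms.intro)
  let ?M = "realization G arev" and ?pd = "path_metric G arev"
  obtain N where N: "\<And>v. v \<in> verts G \<Longrightarrow> finite (out_arcs G v) \<and> card (out_arcs G v) \<le> N"
    using assms(3) by (auto simp: bounded_valency_def)
  obtain \<delta>0 where \<delta>0: "\<And>w x y z. w \<in> ?M \<Longrightarrow> x \<in> ?M \<Longrightarrow> y \<in> ?M \<Longrightarrow> z \<in> ?M \<Longrightarrow>
      min (gromov_product ?pd w x y) (gromov_product ?pd w y z) - \<delta>0 \<le> gromov_product ?pd w x z"
    using assms(4) unfolding hyperbolic_graph_def gromov_hyperbolic_def by blast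
  define \<delta> where "\<delta> = max \<delta>0 0"
  have \<delta>: "min (gromov_product ?pd w x y) (gromov_product ?pd w y z) - \<delta> \<le> gromov_product ?pd w x z"
    if "w \<in> ?M" "x \<in> ?M" "y \<in> ?M" "z \<in> ?M" for w x y z
    using \<delta>0[OF that] by (simp add: \<delta>_def)
  \<comment> \<open>Gromov products contain a factor \<open>1 / 2\<close>, so the four-point
    inequality for distances has the error \<open>2 * \<delta>\<close>; the \<open>+ 1\<close>
    ensures that \<open>De\<close> is positive.\<close>
  define De where "De = nat \<lceil>2 * \<delta>\<rceil> + 1"
  have De: "2 * \<delta> \<le> real De" by (simp add: De_def) linarith
  obtain bv where bv: "bv \<in> verts G"
    using assms(2) unfolding Digraph_Component.connected_def strongly_connected_def
    by (auto simp: mk_symmetric_def)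
  have GP2: "2 * gromov_product ?pd w x y = ?pd x w + ?pd y w - ?pd x y" for w x y
    by (simp add: gromov_product_def)
  have four: "gdist G x z + gdist G y w \<le> gdist G x y + gdist G z w + De \<or>
      gdist G x z + gdist G y w \<le> gdist G y z + gdist G x w + De"
    if v: "x \<in> verts G" "y \<in> verts G" "z \<in> verts G" "w \<in> verts G" for x y z w
  proof -
    note pv = C.pd_vertices
    have "real (gdist G x z) + real (gdist G y w) \<le> real (gdist G x y) + real (gdist G z w) + real De \<or>
      real (gdist G x z) + real (gdist G y w) \<le> real (gdist G y z) + real (gdist G x w) + real De"
      using \<delta>[OF C.vpt_in[OF v(4)] C.vpt_in[OF v(1)] C.vpt_in[OF v(2)] C.vpt_in[OF v(3)]]
        GP2[of "{Inl w}" "{Inl x}" "{Inl y}"] GP2[of "{Inl w}" "{Inl y}" "{Inl z}"]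
        GP2[of "{Inl w}" "{Inl x}" "{Inl z}"] pv[OF v(1,4)] pv[OF v(2,4)] pv[OF v(1,2)] pv[OF v(3,4)]
        pv[OF v(2,3)] pv[OF v(1,3)] De by linarith
    then show ?thesis by linarith
  qed
  interpret H: hyperbolic_realization G arev De "\<lambda>r. (N + 1) ^ r" N \<delta> bv
  proof unfold_locales
    show "gdist G x z + gdist G y w \<le> gdist G x y + gdist G z w + De \<or>
      gdist G x z + gdist G y w \<le> gdist G y z + gdist G x w + De"
      if "x \<in> verts G" "y \<in> verts G" "z \<in> verts G" "w \<in> verts G" for x y z w
      by (rule four[OF that])
    show "gdist G x x = 0" for x by (rule C.dst_self)
    show "gdist G x y = gdist G y x" if "x \<in> verts G" "y \<in> verts G" for x y
      by (rule C.dst_sym[OF that])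
    show "gdist G x z \<le> gdist G x y + gdist G y z"
      if "x \<in> verts G" "y \<in> verts G" "z \<in> verts G" for x y z by (rule C.dst_tri[OF that])
    show "\<exists>z\<in>verts G. gdist G x z = k \<and> gdist G z y = gdist G x y - k"
      if "x \<in> verts G" "y \<in> verts G" "k \<le> gdist G x y" for x y k by (rule C.dst_geodesic[OF that])
    show "finite {y \<in> verts G. gdist G x y \<le> r}" "card {y \<in> verts G. gdist G x y \<le> r} \<le> (N + 1) ^ r"
      if "x \<in> verts G" for x r using C.dst_ball[OF that N, of r] by auto
    show "1 \<le> De" by (simp add: De_def)
    show "v = w" if "v \<in> verts G" "w \<in> verts G" "gdist G v w = 0" for v w by (rule C.dst_eq[OF that])
    show "gdist G (tail G e) (head G e) \<le> 1" if "e \<in> arcs G" for e by (rule C.dst_arc[OF that])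
    show "\<exists>e\<in>out_arcs G v. gdist G (head G e) z = k"
      if "v \<in> verts G" "z \<in> verts G" "gdist G v z = Suc k" for v z k by (rule C.dst_towards[OF that])
    show "finite (out_arcs G v)" "card (out_arcs G v) \<le> N" if "v \<in> verts G" for v using N[OF that] by auto
    show "0 \<le> \<delta>" by (simp add: \<delta>_def)
  qed (fact \<delta> bv)+
  show ?thesis
    using H.q_ideal_bicombing H.q_weak_star_continuous H.q_quasigeodesic H.q_bounded_area H.q_equivariant
    by blast
qed

end
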